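(* Let $n\ge 4$, $A_{2,n}=\mathbb C[p_{ij}]_{ij}/I_{2,n}$ the homogeneous coordinate ring of $\operatorname{Gr}(2,\mathbb C^n)$. (i) For every iterated sequence $S$ for $\operatorname{Gr}(2,\mathbb C^n)$ the (degree-graded) value semigroup of the associated valuation $\mathfrak v_S$ is generated by the images of the Plücker coordinates $\bar p_{ij}$, $1\le i<j\le n$; that is, the Plücker coordinates form a Khovanskii basis. (ii) For every iterated sequence $S$ for $\operatorname{Gr}(2,\mathbb C^n)$ there exists a maximal prime cone $C_S$ in $\operatorname{trop}(\operatorname{Gr}(2,\mathbb C^n))$ such that the associated toric degenerations of $\operatorname{Gr}(2,\mathbb C^n)$ are isomorphic, i.e. $\operatorname{gr}_S(A_{2,n})\cong\mathbb C[p_{ij}]_{ij}/\operatorname{in}_{C_S}(I_{2,n})$. (iii) For every maximal prime cone $C$ in $\operatorname{trop}(\operatorname{Gr}(2,\mathbb C^n))$ there exists an iterated sequence $S_C$ such that the induced toric degenerations of $\operatorname{Gr}(2,\mathbb C^n)$ are isomorphic, i.e. $\operatorname{gr}_{S_C}(A_{2,n})\cong\mathbb C[p_{ij}]_{ij}/\operatorname{in}_{C}(I_{2,n})$.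
   Context: $\mathbb C[p_{ij}]_{ij}$ is the polynomial ring in $p_{ij}$, $1\le i<j\le n$; $I_{2,n}$ is the Plücker ideal, generated by $p_{ij}p_{kl}-p_{ik}p_{jl}+p_{il}p_{jk}$ for $1\le i<j<k<l\le n$; $\bar p_{ij}$ is the class of $p_{ij}$ in $A_{2,n}$, graded by $\deg \bar p_{ij}=1$. Iterated sequences. For $1\le i<k\le n$ write $(i,k)$ for the positive root $\epsilon_i-\epsilon_k$ of $\mathfrak{sl}_n$, of height $k-i$, and let $f_{(i,k)}$ be the elementary matrix with $f_{(i,k)}e_i=e_k$ and $f_{(i,k)}e_l=0$ for $l\ne i$. An iterated sequence for $\operatorname{Gr}(2,\mathbb C^n)$ is a sequence of $d=2(n-2)$ roots $S=((i_n,n),(j_n,n),\dots,(i_3,3),(j_3,3))=(\beta_1,\dots,\beta_d)$ with $i_k\neq j_k$ in $\{1,\dots,k-1\}$ for all $3\le k\le n$. Valuation. Let $P_{ij}\in\mathbb C[x_1,\dots,x_d]$ be the coefficient of $e_i\wedge e_j$ in $\exp(x_1f_{\beta_1})\cdots\exp(x_df_{\beta_d})(e_1\wedge e_2)$. Let $\Psi(m)=\sum m_i\operatorname{ht}(\beta_i)$ on $\mathbb Z^d$ and define a total order: $m\prec_\Psi m'$ iff $\Psi(m)<\Psi(m')$, or $\Psi(m)=\Psi(m')$ and $m>_{lex}m'$. For $0\ne f\in A_{2,n}$ homogeneous of degree $r$, $\mathfrak v_S(f)\in\mathbb Z^d_{\ge0}$ is the $\prec_\Psi$-minimal exponent of a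 monomial occurring in the polynomial obtained from $f$ by substituting $\bar p_{ij}\mapsto P_{ij}$. The value semigroup is $\{(r,\mathfrak v_S(f))\mid r\ge 0,\ 0\neq f\in (A_{2,n})_r\}$, and $\operatorname{gr}_S(A_{2,n})=\bigoplus_{r\ge0}\bigoplus_{a\in\mathbb Z^d}F^r_{\succeq a}/F^r_{\succ a}$ with $F^r_{\succeq a}=\{0\}\cup\{f\in (A_{2,n})_r\mid \mathfrak v_S(f)\succeq_\Psi a\}$. Plücker coordinates form a Khovanskii basis if their images generate $\operatorname{gr}_S(A_{2,n})$ as an algebra. Tropical Grassmannian. For $w\in\mathbb R^{\binom n2}$, $\operatorname{in}_w(f)$ is the sum of the terms of $f$ of minimal $w$-weight, $\operatorname{in}_w(I)=\langle\operatorname{in}_w(f)\mid f\in I\rangle$. $\operatorname{trop}(\operatorname{Gr}(2,\mathbb C^n))=\{w\in\mathbb R^{\binom n2}\mid \operatorname{in}_w(I_{2,n})\text{ contains no monomial}\}$, with the fan structure of a subfan of the Gröbner fan of $I_{2,n}$; for a cone $C$ put $\operatorname{in}_C(I_{2,n})=\operatorname{in}_w(I_{2,n})$ for any $w$ in the relative interior of $C$. A maximal cone $C$ is prime if $\operatorname{in}_C(I_{2,n})$ is a prime ideal. *)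

theory Defs
  imports
    "HOL-Analysis.Analysis"
    "HOL-Algebra.QuotRing"
    "HOL-Algebra.Product_Groups"
    "HOL-Algebra.Generated_Rings"
    "HOL-Library.Poly_Mapping"
    "HOL-Library.Function_Algebras"
begin

section \<open>Polynomials\<close>

text \<open>
  Monomials are finitely supported exponent vectors; the product on the outer
  \<^typ>\<open>'a \<Rightarrow>\<^sub>0 'b\<close> is convolution, that is, multiplication of polynomials.
\<close>

type_synonym 'v monomial = "'v \<Rightarrow>\<^sub>0 nat"
type_synonym 'v mpoly = "'v monomial \<Rightarrow>\<^sub>0 complex"

definition Const :: "complex \<Rightarrow> 'v mpoly" where
  "Const c = Poly_Mapping.single 0 c"

definition Var :: "'v \<Rightarrow> 'v mpoly" where
  "Var v = Poly_Mapping.single (Poly_Mapping.single v 1) 1"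

definition poly_subst :: "('v \<Rightarrow> 'u mpoly) \<Rightarrow> 'v mpoly \<Rightarrow> 'u mpoly" where
  "poly_subst \<sigma> F =
    (\<Sum>m\<in>Poly_Mapping.keys F. Const (Poly_Mapping.lookup F m) *
       (\<Prod>v\<in>Poly_Mapping.keys m. \<sigma> v ^ Poly_Mapping.lookup m v))"

definition total_degree :: "'v monomial \<Rightarrow> nat" where
  "total_degree m = (\<Sum>v\<in>Poly_Mapping.keys m. Poly_Mapping.lookup m v)"

definition homogeneous :: "nat \<Rightarrow> 'v mpoly \<Rightarrow> bool" where
  "homogeneous r F \<longleftrightarrow> (\<forall>m\<in>Poly_Mapping.keys F. total_degree m = r)"


section \<open>Graded algebras over the complex numbers\<close>

text \<open>
  A graded complex algebra is given by a ring \<open>R\<close>, its structure map \<open>s\<close> from the complex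
  numbers and the family \<open>D\<close> of its homogeneous components.
\<close>

definition graded_alg_isomorphic ::
  "('a, 'x) ring_scheme \<Rightarrow> (complex \<Rightarrow> 'a) \<Rightarrow> (nat \<Rightarrow> 'a set) \<Rightarrow>
   ('b, 'y) ring_scheme \<Rightarrow> (complex \<Rightarrow> 'b) \<Rightarrow> (nat \<Rightarrow> 'b set) \<Rightarrow> bool" where
  "graded_alg_isomorphic R s D R' s' D' \<longleftrightarrow>
    (\<exists>h\<in>ring_iso R R'. (\<forall>c. h (s c) = s' c) \<and> (\<forall>r. h ` D r = D' r))"

definition generated_subalgebra ::
  "('a, 'x) ring_scheme \<Rightarrow> (complex \<Rightarrow> 'a) \<Rightarrow> 'a set \<Rightarrow> 'a set" where
  "generated_subalgebra R s G = generate_ring R (range s \<union> G)"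


section \<open>The homogeneous coordinate ring of the Grassmannian of planes\<close>

definition pairs :: "nat \<Rightarrow> (nat \<times> nat) set" where
  "pairs n = {(i, j). 1 \<le> i \<and> i < j \<and> j \<le> n}"

definition pring :: "nat \<Rightarrow> (nat \<times> nat) mpoly ring" where
  "pring n =
    \<lparr>carrier = {F. \<forall>m\<in>Poly_Mapping.keys F. Poly_Mapping.keys m \<subseteq> pairs n},
     mult = (*), one = 1, zero = 0, add = (+)\<rparr>"

definition plucker_ideal :: "nat \<Rightarrow> (nat \<times> nat) mpoly set" where
  "plucker_ideal n = Idl\<^bsub>pring n\<^esub>
    {Var (i, j) * Var (k, l) - Var (i, k) * Var (j, l) + Var (i, l) * Var (j, k) | i j k l.
       1 \<le> i \<and> i < j \<and> j < k \<and> k < l \<and> l \<le> n}"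

definition quot_const :: "nat \<Rightarrow> (nat \<times> nat) mpoly set \<Rightarrow> complex \<Rightarrow> (nat \<times> nat) mpoly set" where
  "quot_const n I c = I +>\<^bsub>pring n\<^esub> Const c"

definition quot_component ::
  "nat \<Rightarrow> (nat \<times> nat) mpoly set \<Rightarrow> nat \<Rightarrow> (nat \<times> nat) mpoly set set" where
  "quot_component n I r = {I +>\<^bsub>pring n\<^esub> F | F. F \<in> carrier (pring n) \<and> homogeneous r F}"

definition grass_ring :: "nat \<Rightarrow> (nat \<times> nat) mpoly set ring" where
  "grass_ring n = pring n Quot plucker_ideal n"

definition pbar :: "nat \<Rightarrow> nat \<times> nat \<Rightarrow> (nat \<times> nat) mpoly set" where
  "pbar n p = plucker_ideal n +>\<^bsub>pring n\<^esub> Var p"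


section \<open>Iterated sequences\<close>

text \<open>The pair \<open>(i, k)\<close> stands for the positive root \<open>\<epsilon>\<^sub>i - \<epsilon>\<^sub>k\<close>.\<close>

type_synonym root = "nat \<times> nat"

definition height :: "root \<Rightarrow> int" where
  "height \<beta> = int (snd \<beta>) - int (fst \<beta>)"

definition iterated_sequence :: "nat \<Rightarrow> root list \<Rightarrow> bool" where
  "iterated_sequence n S \<longleftrightarrow>
    (\<exists>i j. (\<forall>k\<in>{3..n}. i k \<in> {1..k - 1} \<and> j k \<in> {1..k - 1} \<and> i k \<noteq> j k) \<and>
       S = concat (map (\<lambda>k. [(i k, k), (j k, k)]) (rev [3..<Suc n])))"

text \<open>
  Vectors are coordinate functions on \<open>{1..n}\<close> with polynomial entries.  The endomorphism
  \<open>root_op (i, k)\<close> is the elementary matrix sending \<open>e\<^sub>i\<close> to \<open>e\<^sub>k\<close> and the other basis vectors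
  to zero.
\<close>

definition root_op :: "root \<Rightarrow> (nat \<Rightarrow> nat mpoly) \<Rightarrow> (nat \<Rightarrow> nat mpoly)" where
  "root_op \<beta> u = (\<lambda>l. if l = snd \<beta> then u (fst \<beta>) else 0)"

text \<open>
  The exponential series stops before \<open>n\<close>, since a strictly triangular matrix of size \<open>n\<close> has
  vanishing \<open>n\<close>-th power.
\<close>

definition exp_root_op ::
  "nat \<Rightarrow> nat mpoly \<Rightarrow> root \<Rightarrow> (nat \<Rightarrow> nat mpoly) \<Rightarrow> (nat \<Rightarrow> nat mpoly)" where
  "exp_root_op n x \<beta> u = (\<lambda>l. \<Sum>m<n. Const (1 / fact m) * x ^ m * ((root_op \<beta> ^^ m) u) l)"

definition seq_op :: "nat \<Rightarrow> root list \<Rightarrow> (nat \<Rightarrow> nat mpoly) \<Rightarrow> (nat \<Rightarrow> nat mpoly)" where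
  "seq_op n S = foldr (\<lambda>l. exp_root_op n (Var l) (S ! (l - 1))) [1..<Suc (length S)]"

definition basis_vec :: "nat \<Rightarrow> nat \<Rightarrow> nat mpoly" where
  "basis_vec a = (\<lambda>l. if l = a then 1 else 0)"

text \<open>The coefficient of \<open>e\<^sub>i \<and> e\<^sub>j\<close>, for \<open>i < j\<close>, in \<open>u \<and> v\<close>.\<close>

definition wedge_coeff :: "(nat \<Rightarrow> nat mpoly) \<Rightarrow> (nat \<Rightarrow> nat mpoly) \<Rightarrow> nat \<times> nat \<Rightarrow> nat mpoly" where
  "wedge_coeff u v p = u (fst p) * v (snd p) - u (snd p) * v (fst p)"

text \<open>Exponentials of Lie algebra elements act on the exterior square by \<open>g (u \<and> v) = g u \<and> g v\<close>.\<close>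

definition plucker_poly :: "nat \<Rightarrow> root list \<Rightarrow> nat \<times> nat \<Rightarrow> nat mpoly" where
  "plucker_poly n S = wedge_coeff (seq_op n S (basis_vec 1)) (seq_op n S (basis_vec 2))"


section \<open>The valuation and its associated graded algebra\<close>

text \<open>The lattice of integer vectors with coordinates \<open>1, \<dots>, d\<close>.\<close>

definition lattice_Z :: "nat \<Rightarrow> (nat \<Rightarrow>\<^sub>0 int) set" where
  "lattice_Z d = {a. Poly_Mapping.keys a \<subseteq> {1..d}}"

definition Psi :: "root list \<Rightarrow> (nat \<Rightarrow>\<^sub>0 int) \<Rightarrow> int" where
  "Psi S a = (\<Sum>l = 1..length S. Poly_Mapping.lookup a l * height (S ! (l - 1)))"

text \<open>
  The library order \<open><\<close> on \<^typ>\<open>nat \<Rightarrow>\<^sub>0 int\<close> is the lexicographic order in which the smallest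
  index is the most significant.
\<close>

definition prec :: "root list \<Rightarrow> (nat \<Rightarrow>\<^sub>0 int) \<Rightarrow> (nat \<Rightarrow>\<^sub>0 int) \<Rightarrow> bool" where
  "prec S a b \<longleftrightarrow> Psi S a < Psi S b \<or> (Psi S a = Psi S b \<and> b < a)"

definition exponents :: "nat mpoly \<Rightarrow> (nat \<Rightarrow>\<^sub>0 int) set" where
  "exponents G = Poly_Mapping.map int ` Poly_Mapping.keys G"

text \<open>The common value of the substitution on all representatives of a residue class.\<close>

definition class_subst :: "nat \<Rightarrow> root list \<Rightarrow> (nat \<times> nat) mpoly set \<Rightarrow> nat mpoly" where
  "class_subst n S f = the_elem (poly_subst (plucker_poly n S) ` f)"

definition val :: "nat \<Rightarrow> root list \<Rightarrow> (nat \<times> nat) mpoly set \<Rightarrow> (nat \<Rightarrow>\<^sub>0 int)" where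
  "val n S f =
    (THE a. a \<in> exponents (class_subst n S f) \<and>
       (\<forall>b\<in>exponents (class_subst n S f). b \<noteq> a \<longrightarrow> prec S a b))"

abbreviation grass_component :: "nat \<Rightarrow> nat \<Rightarrow> (nat \<times> nat) mpoly set set" where
  "grass_component n r \<equiv> quot_component n (plucker_ideal n) r"

definition value_semigroup :: "nat \<Rightarrow> root list \<Rightarrow> (nat \<times> (nat \<Rightarrow>\<^sub>0 int)) set" where
  "value_semigroup n S =
    {(r, val n S f) | r f. f \<in> grass_component n r \<and> f \<noteq> \<zero>\<^bsub>grass_ring n\<^esub>}"

definition submonoid_closed :: "'a::monoid_add set \<Rightarrow> bool" where
  "submonoid_closed M \<longleftrightarrow> 0 \<in> M \<and> (\<forall>x\<in>M. \<forall>y\<in>M. x + y \<in> M)"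

definition filt_ge ::
  "nat \<Rightarrow> root list \<Rightarrow> nat \<times> (nat \<Rightarrow>\<^sub>0 int) \<Rightarrow> (nat \<times> nat) mpoly set set" where
  "filt_ge n S = (\<lambda>(r, a). {\<zero>\<^bsub>grass_ring n\<^esub>} \<union>
    {f \<in> grass_component n r. f \<noteq> \<zero>\<^bsub>grass_ring n\<^esub> \<and> (a = val n S f \<or> prec S a (val n S f))})"

definition filt_gt ::
  "nat \<Rightarrow> root list \<Rightarrow> nat \<times> (nat \<Rightarrow>\<^sub>0 int) \<Rightarrow> (nat \<times> nat) mpoly set set" where
  "filt_gt n S = (\<lambda>(r, a). {\<zero>\<^bsub>grass_ring n\<^esub>} \<union>
    {f \<in> grass_component n r. f \<noteq> \<zero>\<^bsub>grass_ring n\<^esub> \<and> prec S a (val n S f)})"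

definition gr_piece ::
  "nat \<Rightarrow> root list \<Rightarrow> nat \<times> (nat \<Rightarrow>\<^sub>0 int) \<Rightarrow> (nat \<times> nat) mpoly set set monoid" where
  "gr_piece n S u = (grass_ring n)\<lparr>carrier := filt_ge n S u\<rparr> A_Mod filt_gt n S u"

definition gr_index :: "root list \<Rightarrow> (nat \<times> (nat \<Rightarrow>\<^sub>0 int)) set" where
  "gr_index S = UNIV \<times> lattice_Z (length S)"

type_synonym gr_elem = "nat \<times> (nat \<Rightarrow>\<^sub>0 int) \<Rightarrow> (nat \<times> nat) mpoly set set"

text \<open>The class of \<open>f\<close>, an element of \<open>filt_ge n S u\<close>, placed in the summand with index \<open>u\<close>.\<close>

definition gr_class ::
  "nat \<Rightarrow> root list \<Rightarrow> nat \<times> (nat \<Rightarrow>\<^sub>0 int) \<Rightarrow> (nat \<times> nat) mpoly set \<Rightarrow> gr_elem" where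
  "gr_class n S u f = (\<lambda>w\<in>gr_index S.
    if w = u then filt_gt n S u +>\<^bsub>grass_ring n\<^esub> f else \<one>\<^bsub>gr_piece n S w\<^esub>)"

text \<open>
  The direct sum of the quotients.  The product is induced by \<open>[f] [g] = [f g]\<close>, where
  \<^const>\<open>rcoset_mult\<close> multiplies two cosets; the quotients \<^const>\<open>gr_piece\<close> are additive groups
  in multiplicative notation, so \<^const>\<open>finprod\<close> is a sum of cosets.
\<close>

definition gr_ring :: "nat \<Rightarrow> root list \<Rightarrow> gr_elem ring" where
  "gr_ring n S =
    (let G = sum_group (gr_index S) (gr_piece n S) in
     \<lparr>carrier = carrier G,
      mult = (\<lambda>g h. \<lambda>w\<in>gr_index S.
        finprod (gr_piece n S w)
          (\<lambda>(u, v). rcoset_mult (grass_ring n) (filt_gt n S w) (g u) (h v))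
          {(u, v). u \<in> gr_index S \<and> v \<in> gr_index S \<and> u + v = w \<and>
             g u \<noteq> \<one>\<^bsub>gr_piece n S u\<^esub> \<and> h v \<noteq> \<one>\<^bsub>gr_piece n S v\<^esub>}),
      one = gr_class n S 0 \<one>\<^bsub>grass_ring n\<^esub>,
      zero = \<one>\<^bsub>G\<^esub>,
      add = monoid.mult G\<rparr>)"

definition gr_const :: "nat \<Rightarrow> root list \<Rightarrow> complex \<Rightarrow> gr_elem" where
  "gr_const n S c = gr_class n S 0 (quot_const n (plucker_ideal n) c)"

definition gr_component :: "nat \<Rightarrow> root list \<Rightarrow> nat \<Rightarrow> gr_elem set" where
  "gr_component n S r =
    {g \<in> carrier (gr_ring n S). \<forall>u\<in>gr_index S. fst u \<noteq> r \<longrightarrow> g u = \<one>\<^bsub>gr_piece n S u\<^esub>}"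

definition plucker_khovanskii_basis :: "nat \<Rightarrow> root list \<Rightarrow> bool" where
  "plucker_khovanskii_basis n S \<longleftrightarrow>
    generated_subalgebra (gr_ring n S) (gr_const n S)
      ((\<lambda>p. gr_class n S (1, val n S (pbar n p)) (pbar n p)) ` pairs n) = carrier (gr_ring n S)"


section \<open>The tropical Grassmannian\<close>

text \<open>
  A weight vector is a function vanishing outside \<open>pairs n\<close>.  These functions form a
  finite-dimensional closed subspace of all functions, so affine hull, closure and relative
  interior, taken for the pointwise vector space structure and the product topology, are the
  Euclidean ones.
\<close>

instantiation "fun" :: (type, real_vector) real_vector
begin

definition scaleR_fun :: "real \<Rightarrow> ('a \<Rightarrow> 'b) \<Rightarrow> 'a \<Rightarrow> 'b" where
  "scaleR_fun c f = (\<lambda>x. c *\<^sub>R f x)"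

instance
  by standard (auto simp: scaleR_fun_def fun_eq_iff scaleR_add_right scaleR_add_left)

end

type_synonym weight = "nat \<times> nat \<Rightarrow> real"

definition weights :: "nat \<Rightarrow> weight set" where
  "weights n = {w. \<forall>p. p \<notin> pairs n \<longrightarrow> w p = 0}"

definition monomial_weight :: "weight \<Rightarrow> (nat \<times> nat) monomial \<Rightarrow> real" where
  "monomial_weight w m = (\<Sum>p\<in>Poly_Mapping.keys m. w p * real (Poly_Mapping.lookup m p))"

definition initial_form :: "weight \<Rightarrow> (nat \<times> nat) mpoly \<Rightarrow> (nat \<times> nat) mpoly" where
  "initial_form w F =
    (\<Sum>m\<in>{m \<in> Poly_Mapping.keys F.
          \<forall>m'\<in>Poly_Mapping.keys F. monomial_weight w m \<le> monomial_weight w m'}.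
       Poly_Mapping.single m (Poly_Mapping.lookup F m))"

definition initial_ideal ::
  "nat \<Rightarrow> weight \<Rightarrow> (nat \<times> nat) mpoly set \<Rightarrow> (nat \<times> nat) mpoly set" where
  "initial_ideal n w I = Idl\<^bsub>pring n\<^esub> (initial_form w ` I)"

definition trop_grass :: "nat \<Rightarrow> weight set" where
  "trop_grass n =
    {w \<in> weights n. \<nexists>m. Poly_Mapping.single m 1 \<in> initial_ideal n w (plucker_ideal n)}"

definition groebner_cone :: "nat \<Rightarrow> weight \<Rightarrow> weight set" where
  "groebner_cone n w = closure
    {w' \<in> weights n. initial_ideal n w' (plucker_ideal n) = initial_ideal n w (plucker_ideal n)}"

definition trop_fan :: "nat \<Rightarrow> weight set set" where
  "trop_fan n = groebner_cone n ` trop_grass n"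

text \<open>
  A Groebner cone has as relative interior exactly the weights with one common initial ideal,
  so the choice of \<open>w\<close> is immaterial.
\<close>

definition cone_initial_ideal :: "nat \<Rightarrow> weight set \<Rightarrow> (nat \<times> nat) mpoly set" where
  "cone_initial_ideal n C = initial_ideal n (SOME w. w \<in> rel_interior C) (plucker_ideal n)"

definition maximal_cone :: "nat \<Rightarrow> weight set \<Rightarrow> bool" where
  "maximal_cone n C \<longleftrightarrow> C \<in> trop_fan n \<and> (\<forall>D\<in>trop_fan n. C \<subseteq> D \<longrightarrow> D = C)"

definition maximal_prime_cone :: "nat \<Rightarrow> weight set \<Rightarrow> bool" where
  "maximal_prime_cone n C \<longleftrightarrow>
    maximal_cone n C \<and> primeideal (cone_initial_ideal n C) (pring n)"

definition degenerations_isomorphic :: "nat \<Rightarrow> root list \<Rightarrow> weight set \<Rightarrow> bool" where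
  "degenerations_isomorphic n S C \<longleftrightarrow>
    graded_alg_isomorphic
      (gr_ring n S) (gr_const n S) (gr_component n S)
      (pring n Quot cone_initial_ideal n C)
      (quot_const n (cone_initial_ideal n C))
      (quot_component n (cone_initial_ideal n C))"

end

theory Submission
  imports Defs
begin

text \<open>
  An iterated sequence \<open>S\<close> builds \<open>n\<close> vectors in the plane: \<open>U\<^sub>1\<close> and \<open>U\<^sub>2\<close> are the standard basis
  and \<open>U\<^sub>k = y\<^sub>k U\<^bsub>i k\<^esub> + z\<^sub>k U\<^bsub>j k\<^esub>\<close> for \<open>k \<ge> 3\<close>, where \<open>y\<^sub>k\<close> and \<open>z\<^sub>k\<close> are the two variables of
  step \<open>k\<close>.  The polynomial \<open>P\<^sub>a\<^sub>b\<close> is the determinant of \<open>U\<^sub>a\<close> and \<open>U\<^sub>b\<close>.  All its monomials have the same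
  \<open>\<Psi>\<close>-weight \<open>a + b - 3\<close>, so the term order on it is the lexicographic one, and the leading term of
  \<open>P\<^sub>a\<^sub>k\<close>, for \<open>a < k\<close>, is \<open>y\<^sub>k\<close> times that of \<open>P\<^bsub>a (i k)\<^esub>\<close>, or \<open>z\<^sub>k\<close> times that of
  \<open>P\<^bsub>(j k) (i k)\<^esub>\<close> when \<open>a = i k\<close> (lemma \<open>good_P\<close>).  These exponents are governed by the trivalent tree
  that arises by attaching, for \<open>k = 3, \<dots>, n\<close>, the leaf \<open>k\<close> next to the leaf \<open>i k\<close>.

  A trivalent tree is used only through its quartets: it splits any four leaves into two pairs
  \<open>ab|cd\<close>, and then the exponents of \<open>p\<^sub>a\<^sub>c p\<^sub>b\<^sub>d\<close> and \<open>p\<^sub>a\<^sub>d p\<^sub>b\<^sub>c\<close> agree while that of \<open>p\<^sub>a\<^sub>b p\<^sub>c\<^sub>d\<close> is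
  later.  The combinatorial core is \<open>moves_of_eq_vh\<close>: two monomials in the Pluecker coordinates
  with equal degree and exponent are connected by exchanges \<open>p\<^sub>a\<^sub>c p\<^sub>b\<^sub>d \<leftrightarrow> p\<^sub>a\<^sub>d p\<^sub>b\<^sub>c\<close> at quartets.
  In other words, the toric ideal \<open>J\<close> of the exponents is generated by the leading binomials of the
  Pluecker relations.

  This makes the Pluecker coordinates a Khovanskii basis.  Choose one standard monomial for each
  exponent.  A three-term relation replaces an exchange by a monomial of strictly larger weight,
  for any weight \<open>w\<close> that is strict on the quartets; there are finitely many monomials of a given
  degree, so every polynomial reduces to standard monomials (\<open>standard_reduction\<close>).  The standard
  monomials have distinct leading exponents, so they are independent after substitution
  (\<open>standard_independent\<close>).  Hence values are exponents of monomials, which is the first claim; each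
  graded piece of \<open>gr\<^sub>S\<close> is at most one-dimensional, and \<open>gr\<^sub>S\<close> is the semigroup algebra of the exponents
  (\<open>Phi_iso\<close>).  Comparing coefficients of minimal weight in a reduction of an element of the
  Pluecker ideal also gives \<open>in\<^sub>w(I) = J\<close> (\<open>initial_ideal_eq_J\<close>), so the quotient by \<open>in\<^sub>w(I)\<close> is the
  same semigroup algebra (\<open>quotient_isomorphic\<close>).  This proves the second claim, once the weights
  that are strict on the quartets are recognised as the relative interior of a maximal cone.

  For the third claim, the absence of monomials in \<open>in\<^sub>w(I)\<close> forces the four-point condition on \<open>w\<close>.  A pair
  of leaves that is as close as possible, seen from a fixed third leaf, is a cherry; removing its
  leaves one after the other yields an order of the labels in which \<open>w\<close> lies in the closed cone of an
  iterated tree (\<open>tree_exists\<close>).  So each maximal cone is a tree cone for a tree that is iterated up to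
  a permutation \<open>\<sigma>\<close> of the labels.  Permuting labels does not change the semigroup generated by the
  exponents, and so not the algebra either.
\<close>

abbreviation lookup :: "('a \<Rightarrow>\<^sub>0 'b::zero) \<Rightarrow> 'a \<Rightarrow> 'b" where
  "lookup \<equiv> Poly_Mapping.lookup"
abbreviation keys :: "('a \<Rightarrow>\<^sub>0 'b::zero) \<Rightarrow> 'a set" where
  "keys \<equiv> Poly_Mapping.keys"
abbreviation single :: "'a \<Rightarrow> 'b \<Rightarrow> ('a \<Rightarrow>\<^sub>0 'b::zero)" where
  "single \<equiv> Poly_Mapping.single"

section \<open>Polynomials and substitution\<close>

lemma poly_mapping_sum_single:
  fixes F :: "'a \<Rightarrow>\<^sub>0 'b::comm_monoid_add"
  shows "F = (\<Sum>m\<in>keys F. single m (lookup F m))"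
  by (rule poly_mapping_eqI)
     (auto simp: lookup_sum lookup_single when_def sum.delta' in_keys_iff)

lemma poly_mapping_single_induct [case_names zero add]:
  fixes F :: "'a \<Rightarrow>\<^sub>0 'b::comm_monoid_add"
  assumes "P 0" and "\<And>m c G. m \<in> keys F \<Longrightarrow> P G \<Longrightarrow> P (single m c + G)"
  shows "P F"
proof -
  have "P (\<Sum>m\<in>A. single m (lookup F m))" if "finite A" "A \<subseteq> keys F" for A
    using that by (induction A rule: finite_induct) (auto intro: assms)
  from this[of "keys F"] show ?thesis
    using poly_mapping_sum_single[of F] by simp
qed

definition mon_eval :: "('v \<Rightarrow> 'c::comm_monoid_mult) \<Rightarrow> 'v monomial \<Rightarrow> 'c" where
  "mon_eval \<sigma> m = (\<Prod>v\<in>keys m. \<sigma> v ^ lookup m v)"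

lemma mon_eval_superset:
  assumes "finite A" "keys m \<subseteq> A"
  shows "mon_eval \<sigma> m = (\<Prod>v\<in>A. \<sigma> v ^ lookup m v)"
  unfolding mon_eval_def using assms
  by (intro prod.mono_neutral_left) (auto simp: in_keys_iff)

lemma mon_eval_add: "mon_eval \<sigma> (m + m') = mon_eval \<sigma> m * mon_eval \<sigma> m'"
proof -
  let ?A = "keys m \<union> keys m'"
  have "keys (m + m') \<subseteq> ?A" by (rule Poly_Mapping.keys_add)
  then show ?thesis
    by (simp add: mon_eval_superset[of ?A] lookup_add power_add prod.distrib)
qed

lemma mon_eval_0 [simp]: "mon_eval \<sigma> 0 = 1"
  by (simp add: mon_eval_def)

lemma mon_eval_single: "mon_eval \<sigma> (single v k) = \<sigma> v ^ k"
  by (cases "k = 0") (auto simp: mon_eval_def)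

lemma Const_add: "Const (c + d) = Const c + Const d"
  by (simp add: Const_def single_add)
lemma Const_mult: "Const (c * d) = Const c * Const d"
  by (simp add: Const_def mult_single)
lemma Const_0 [simp]: "Const 0 = 0"
  by (simp add: Const_def)
lemma Const_1 [simp]: "Const 1 = 1"
  by (simp add: Const_def)
lemma Const_times_single: "Const c * single m d = single m (c * d)"
  by (simp add: Const_def mult_single)

lemma poly_subst_superset:
  assumes "finite A" "keys F \<subseteq> A"
  shows "poly_subst \<sigma> F = (\<Sum>m\<in>A. Const (lookup F m) * mon_eval \<sigma> m)"
  unfolding poly_subst_def mon_eval_def using assms
  by (intro sum.mono_neutral_left) (auto simp: in_keys_iff)

lemma poly_subst_add: "poly_subst \<sigma> (F + G) = poly_subst \<sigma> F + poly_subst \<sigma> G"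
proof -
  let ?A = "keys F \<union> keys G"
  have "keys (F + G) \<subseteq> ?A" by (rule Poly_Mapping.keys_add)
  then show ?thesis
    by (simp add: poly_subst_superset[of ?A] lookup_add Const_add distrib_right sum.distrib)
qed

lemma poly_subst_0 [simp]: "poly_subst \<sigma> 0 = 0"
  by (simp add: poly_subst_def)

lemma poly_subst_single: "poly_subst \<sigma> (single m c) = Const c * mon_eval \<sigma> m"
  by (cases "c = 0") (auto simp: poly_subst_def mon_eval_def)

lemma poly_subst_1 [simp]: "poly_subst \<sigma> 1 = 1"
  using poly_subst_single[of \<sigma> 0 1] by simp

lemma poly_subst_Const [simp]: "poly_subst \<sigma> (Const c) = Const c"
  by (subst (1) Const_def) (simp add: poly_subst_single)

lemma poly_subst_Var [simp]: "poly_subst \<sigma> (Var v) = \<sigma> v"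
  by (simp add: Var_def poly_subst_single mon_eval_single)

lemma poly_subst_sum: "poly_subst \<sigma> (sum f A) = (\<Sum>a\<in>A. poly_subst \<sigma> (f a))"
  by (induction A rule: infinite_finite_induct) (auto simp: poly_subst_add)

lemma poly_subst_uminus: "poly_subst \<sigma> (- F) = - poly_subst \<sigma> F"
  using poly_subst_add[of \<sigma> F "- F"] by (simp add: eq_neg_iff_add_eq_0 add.commute)

lemma poly_subst_minus: "poly_subst \<sigma> (F - G) = poly_subst \<sigma> F - poly_subst \<sigma> G"
  using poly_subst_add[of \<sigma> F "- G"] by (simp add: poly_subst_uminus)

lemma poly_subst_mult_single:
  "poly_subst \<sigma> (single m c * G) = poly_subst \<sigma> (single m c) * poly_subst \<sigma> G"
proof (induction G rule: poly_mapping_single_induct)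
  case zero
  then show ?case by simp
next
  case (add m' c' G)
  then show ?case
    by (simp add: distrib_left poly_subst_add mult_single poly_subst_single mon_eval_add Const_mult
        algebra_simps)
qed

lemma poly_subst_mult: "poly_subst \<sigma> (F * G) = poly_subst \<sigma> F * poly_subst \<sigma> G"
  by (induction F rule: poly_mapping_single_induct)
     (auto simp: distrib_right poly_subst_add poly_subst_mult_single)

definition scale :: "nat \<Rightarrow> 'u monomial \<Rightarrow> 'u monomial" where
  "scale k p = Poly_Mapping.map ((*) k) p"

lemma lookup_scale [simp]: "lookup (scale k p) l = k * lookup p l"
  by (simp add: scale_def Poly_Mapping.map.rep_eq when_def)

definition mon_sum :: "('v \<Rightarrow> 'u monomial) \<Rightarrow> 'v monomial \<Rightarrow> 'u monomial" where
  "mon_sum h m = (\<Sum>v\<in>keys m. scale (lookup m v) (h v))"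

lemma mon_sum_add: "mon_sum h (m + m') = mon_sum h m + mon_sum h m'"
  unfolding mon_sum_def
  by (rule setsum_keys_plus_distrib)
     (auto intro!: poly_mapping_eqI simp: lookup_scale lookup_add distrib_right)

lemma mon_sum_0 [simp]: "mon_sum h 0 = 0"
  by (simp add: mon_sum_def)

lemma mon_sum_single: "mon_sum h (single v k) = scale k (h v)"
  by (cases "k = 0") (auto intro!: poly_mapping_eqI simp: mon_sum_def lookup_scale)

lemma mon_sum_single_1 [simp]: "mon_sum h (single v (Suc 0)) = h v"
  by (auto intro!: poly_mapping_eqI simp: mon_sum_single lookup_scale)

lemma lookup_mon_sum: "lookup (mon_sum h m) l = (\<Sum>v\<in>keys m. lookup m v * lookup (h v) l)"
  by (simp add: mon_sum_def lookup_sum lookup_scale)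

lemma monomial_induct [case_names zero add]:
  fixes m :: "'v monomial"
  assumes "P 0" and "\<And>v m'. v \<in> keys m \<Longrightarrow> keys m' \<subseteq> keys m \<Longrightarrow> P m' \<Longrightarrow> P (single v 1 + m')"
  shows "P m"
proof -
  have step: "P (single v k + m')" if "v \<in> keys m" "keys m' \<subseteq> keys m" "P m'" for v k m'
  proof (induction k)
    case 0
    then show ?case using that by simp
  next
    case (Suc k)
    have "single v (Suc k) + m' = single v 1 + (single v k + m')"
      by (simp add: single_add[symmetric] add.assoc[symmetric])
    moreover have "keys (single v k + m') \<subseteq> keys m"
      using Poly_Mapping.keys_add[of "single v k" m'] that by (auto split: if_splits)
    ultimately show ?case using assms(2)[OF that(1) _ Suc] by simp
  qed
  have "P (\<Sum>v\<in>A. single v (lookup m v)) \<and> keys (\<Sum>v\<in>A. single v (lookup m v)) \<subseteq> keys m"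
    if "finite A" "A \<subseteq> keys m" for A
    using that
  proof (induction A rule: finite_induct)
    case empty
    then show ?case using assms(1) by simp
  next
    case (insert v A)
    have "keys (single v (lookup m v) + (\<Sum>v\<in>A. single v (lookup m v))) \<subseteq> keys m"
      using Poly_Mapping.keys_add[of "single v (lookup m v)" "\<Sum>v\<in>A. single v (lookup m v)"] insert
      by (auto split: if_splits)
    then show ?case using insert step by simp
  qed
  from this[of "keys m"] show ?thesis
    using poly_mapping_sum_single[of m] by simp
qed

text \<open>
  A substitution of scaled monomials is controlled by the exponent map and by a scalar; this is
  how initial degenerations become maps of monomials.
\<close>

lemma mon_eval_single_monomial:
  fixes h :: "'v \<Rightarrow> 'u monomial" and c :: "'v \<Rightarrow> complex"
  shows "mon_eval (\<lambda>v. single (h v) (c v)) m = single (mon_sum h m) (mon_eval c m)"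
proof -
  have "single a c ^ k = single (scale k a) (c ^ k)" for a :: "'u monomial" and c :: complex and k
  proof (induction k)
    case 0
    have "scale 0 a = 0" by (rule poly_mapping_eqI) (simp add: lookup_scale)
    then show ?case by simp
  next
    case (Suc k)
    have "a + scale k a = scale (Suc k) a"
      by (rule poly_mapping_eqI) (simp add: lookup_scale lookup_add)
    then show ?case by (simp add: Suc mult_single del: One_nat_def)
  qed
  then have "mon_eval (\<lambda>v. single (h v) (c v)) m
      = (\<Prod>v\<in>keys m. single (scale (lookup m v) (h v)) (c v ^ lookup m v))"
    by (simp add: mon_eval_def)
  also have "\<dots> = single (mon_sum h m) (mon_eval c m)"
  proof -
    have "(\<Prod>v\<in>A. single (f v) (g v)) = single (\<Sum>v\<in>A. f v) (\<Prod>v\<in>A. g v)"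
      for A :: "'v set" and f :: "'v \<Rightarrow> 'u monomial" and g :: "'v \<Rightarrow> complex"
      by (induction A rule: infinite_finite_induct) (auto simp: mult_single)
    then show ?thesis unfolding mon_sum_def mon_eval_def .
  qed
  finally show ?thesis .
qed

lemma monomial_weight_add: "monomial_weight w (m + m') = monomial_weight w m + monomial_weight w m'"
  unfolding monomial_weight_def
  by (rule setsum_keys_plus_distrib) (auto simp: distrib_left)

lemma monomial_weight_single: "monomial_weight w (single p k) = w p * real k"
  by (cases "k = 0") (auto simp: monomial_weight_def)

lemma total_degree_add: "total_degree (m + m') = total_degree m + total_degree m'"
  unfolding total_degree_def by (rule setsum_keys_plus_distrib) auto

lemma total_degree_single [simp]: "total_degree (single p k) = k"
  by (cases "k = 0") (auto simp: total_degree_def)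

lemma total_degree_0 [simp]: "total_degree 0 = 0"
  by (simp add: total_degree_def)

section \<open>Leading terms\<close>

text \<open>
  Leading terms are minimal terms, because the valuation takes minimal exponents.
\<close>

locale exponent_order =
  fixes lt :: "'e::cancel_comm_monoid_add \<Rightarrow> 'e \<Rightarrow> bool"
  assumes lt_irrefl: "\<not> lt a a"
    and lt_trans: "lt a b \<Longrightarrow> lt b c \<Longrightarrow> lt a c"
    and lt_total: "a \<noteq> b \<Longrightarrow> lt a b \<or> lt b a"
    and lt_add: "lt a b \<Longrightarrow> lt (a + c) (b + c)"
begin

definition above :: "'e \<Rightarrow> ('e \<Rightarrow>\<^sub>0 complex) \<Rightarrow> bool" where
  "above m G \<longleftrightarrow> (\<forall>k\<in>keys G. lt m k)"

text \<open>
  Writing the leading term through the remainder \<open>G - single m c\<close> makes products and sums of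
  leading terms follow from closure properties of \<open>above\<close>.
\<close>

definition lead :: "('e \<Rightarrow>\<^sub>0 complex) \<Rightarrow> 'e \<Rightarrow> complex \<Rightarrow> bool" where
  "lead G m c \<longleftrightarrow> c \<noteq> 0 \<and> above m (G - single m c)"

lemma above_0 [simp]: "above m 0"
  by (simp add: above_def)

lemma above_lookup: "above m G \<Longrightarrow> lookup G m = 0"
  using lt_irrefl unfolding above_def by (meson in_keys_iff)

lemma above_add: "above m G \<Longrightarrow> above m H \<Longrightarrow> above m (G + H)"
  using Poly_Mapping.keys_add[of G H] by (auto simp: above_def)

lemma above_sum: "(\<And>i. i \<in> A \<Longrightarrow> above m (f i)) \<Longrightarrow> above m (sum f A)"
  by (induction A rule: infinite_finite_induct) (auto intro: above_add)

lemma lt_add_both: "lt a b \<Longrightarrow> lt c d \<Longrightarrow> lt (a + c) (b + d)"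
  using lt_add[of a b c] lt_add[of c d b] lt_trans by (metis add.commute)

lemma above_mult: "above m G \<Longrightarrow> above m' H \<Longrightarrow> above (m + m') (G * H)"
  using keys_mult[of G H] lt_add_both by (fastforce simp: above_def)

lemma above_mult_single: "above m G \<Longrightarrow> above (m + k) (G * single k c)"
  using keys_mult[of G "single k c"] lt_add by (fastforce simp: above_def split: if_splits)

lemma lead_lookup: "lead G m c \<Longrightarrow> lookup G m = c"
  using above_lookup[of m "G - single m c"] by (auto simp: lead_def lookup_minus)

lemma lead_in_keys: "lead G m c \<Longrightarrow> m \<in> keys G"
  using lead_lookup by (auto simp: in_keys_iff lead_def)

lemma lead_nonzero: "lead G m c \<Longrightarrow> G \<noteq> 0"
  using lead_in_keys by fastforce

lemma lead_lt: assumes "lead G m c" "k \<in> keys G" "k \<noteq> m" shows "lt m k"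
proof -
  have "k \<in> keys (G - single m c)"
    using assms by (simp add: in_keys_iff lookup_minus lookup_single when_def)
  then show ?thesis using assms by (auto simp: lead_def above_def)
qed

lemma leadI:
  assumes "m \<in> keys G" "\<And>k. k \<in> keys G \<Longrightarrow> k \<noteq> m \<Longrightarrow> lt m k"
  shows "lead G m (lookup G m)"
proof -
  have "k \<in> keys G \<and> k \<noteq> m" if "k \<in> keys (G - single m (lookup G m))" for k
    using that by (auto simp: in_keys_iff lookup_minus lookup_single when_def split: if_splits)
  then show ?thesis using assms by (auto simp: lead_def above_def in_keys_iff)
qed

lemma lead_exists: assumes "G \<noteq> 0" shows "\<exists>m c. lead G m c"
proof -
  have "\<exists>m\<in>A. \<forall>k\<in>A. k \<noteq> m \<longrightarrow> lt m k" if "finite A" "A \<noteq> {}" for A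
    using that
  proof (induction A rule: finite_ne_induct)
    case (insert x A)
    then obtain m where m: "m \<in> A" "\<forall>k\<in>A. k \<noteq> m \<longrightarrow> lt m k" by blast
    show ?case
    proof (cases "lt m x")
      case True then show ?thesis using m by auto
    next
      case False
      then have "lt x m" using lt_total[of x m] m insert by auto
      then have "\<forall>k\<in>A. lt x k" using m lt_trans by metis
      then show ?thesis using m by auto
    qed
  qed auto
  moreover have "keys G \<noteq> {}" using assms by simp
  ultimately show ?thesis using leadI finite_keys by meson
qed

lemma lead_unique: "lead G m c \<Longrightarrow> lead G m' c' \<Longrightarrow> m = m' \<and> c = c'"
  by (metis lead_in_keys lead_lt lead_lookup lt_irrefl lt_trans)

lemma lead_single: "c \<noteq> 0 \<Longrightarrow> lead (single m c) m c"
  by (simp add: lead_def)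

lemma lead_add_above: "lead G m c \<Longrightarrow> above m H \<Longrightarrow> lead (G + H) m c"
  using above_add[of m "G - single m c" H] by (simp add: lead_def algebra_simps)

lemma lead_mult: assumes "lead G m c" "lead H m' c'" shows "lead (G * H) (m + m') (c * c')"
proof -
  define G' H' where "G' = G - single m c" and "H' = H - single m' c'"
  have ab: "above m G'" "above m' H'" using assms by (auto simp: lead_def G'_def H'_def)
  have eq: "G * H - single (m + m') (c * c') = G' * H' + (G' * single m' c' + H' * single m c)"
    by (simp add: G'_def H'_def mult_single[symmetric] algebra_simps)
  have "above (m' + m) (H' * single m c)" by (rule above_mult_single[OF ab(2)])
  then have "above (m + m') (G * H - single (m + m') (c * c'))"
    unfolding eq using above_mult[OF ab] above_mult_single[OF ab(1), of m' c']
    by (intro above_add) (auto simp: add.commute)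
  then show ?thesis using assms by (simp add: lead_def)
qed

lemma lead_uminus: "lead G m c \<Longrightarrow> lead (- G) m (- c)"
  using lead_mult[of G m c "single 0 (-1)" 0 "-1"] lead_single[of "-1" 0]
  by (simp add: single_uminus)

end

section \<open>The ring of polynomials in the Pluecker coordinates\<close>

lemma pring_simps [simp]:
  "F \<otimes>\<^bsub>pring n\<^esub> G = F * G" "\<one>\<^bsub>pring n\<^esub> = 1" "\<zero>\<^bsub>pring n\<^esub> = 0" "F \<oplus>\<^bsub>pring n\<^esub> G = F + G"
  by (simp_all add: pring_def)

abbreviation monomials :: "nat \<Rightarrow> (nat \<times> nat) monomial set" where
  "monomials n \<equiv> {m. keys m \<subseteq> pairs n}"

lemma in_pring_iff: "F \<in> carrier (pring n) \<longleftrightarrow> keys F \<subseteq> monomials n"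
  by (auto simp: pring_def)

lemma pring_add [intro]: "F \<in> carrier (pring n) \<Longrightarrow> G \<in> carrier (pring n) \<Longrightarrow> F + G \<in> carrier (pring n)"
  using Poly_Mapping.keys_add[of F G] unfolding in_pring_iff by blast

lemma monomials_add: "m \<in> monomials n \<Longrightarrow> m' \<in> monomials n \<Longrightarrow> m + m' \<in> monomials n"
  using Poly_Mapping.keys_add[of m m'] by blast

lemma pring_mult [intro]: "F \<in> carrier (pring n) \<Longrightarrow> G \<in> carrier (pring n) \<Longrightarrow> F * G \<in> carrier (pring n)"
  unfolding in_pring_iff
proof
  fix m assume *: "keys F \<subseteq> monomials n" "keys G \<subseteq> monomials n" and "m \<in> keys (F * G)"
  then obtain a b where "m = a + b" "a \<in> keys F" "b \<in> keys G" using keys_mult[of F G] by blast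
  then show "m \<in> monomials n" using monomials_add[of a n b] * by blast
qed

lemma pring_uminus [intro]: "F \<in> carrier (pring n) \<Longrightarrow> - F \<in> carrier (pring n)"
  by (simp add: in_pring_iff in_keys_iff subset_iff)

lemma pring_diff [intro]: "F \<in> carrier (pring n) \<Longrightarrow> G \<in> carrier (pring n) \<Longrightarrow> F - G \<in> carrier (pring n)"
  using pring_add[of F n "- G"] by auto

lemma pring_0 [simp, intro]: "0 \<in> carrier (pring n)"
  by (simp add: in_pring_iff)

lemma pring_single: "m \<in> monomials n \<Longrightarrow> single m c \<in> carrier (pring n)"
  by (simp add: in_pring_iff)

lemma pring_1 [simp, intro]: "1 \<in> carrier (pring n)"
  by (simp add: in_pring_iff)

lemma pring_Const [simp, intro]: "Const c \<in> carrier (pring n)"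
  by (simp add: Const_def pring_single)

lemma cring_pring: "cring (pring n)"
proof (rule cringI)
  show "abelian_group (pring n)"
  proof (rule abelian_groupI)
    fix F assume "F \<in> carrier (pring n)"
    then show "\<exists>G\<in>carrier (pring n). G \<oplus>\<^bsub>pring n\<^esub> F = \<zero>\<^bsub>pring n\<^esub>"
      by (intro bexI[of _ "- F"]) auto
  qed (auto simp: algebra_simps)
  show "comm_monoid (pring n)"
    by (rule comm_monoidI) (auto simp: algebra_simps)
qed (auto simp: algebra_simps)

interpretation pring: cring "pring n" for n
  by (rule cring_pring)

lemma pring_a_inv: "F \<in> carrier (pring n) \<Longrightarrow> \<ominus>\<^bsub>pring n\<^esub> F = - F"
  by (rule pring.sum_zero_eq_neg[symmetric]) auto

lemma ideal_pring_add: "ideal I (pring n) \<Longrightarrow> F \<in> I \<Longrightarrow> G \<in> I \<Longrightarrow> F + G \<in> I"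
  using additive_subgroup.a_closed[OF ideal.axioms(1)] by fastforce

lemma ideal_pring_0: "ideal I (pring n) \<Longrightarrow> 0 \<in> I"
  using additive_subgroup.zero_closed[OF ideal.axioms(1)] by fastforce

lemma ideal_pring_mult: "ideal I (pring n) \<Longrightarrow> F \<in> I \<Longrightarrow> G \<in> carrier (pring n) \<Longrightarrow> G * F \<in> I"
  using ideal.I_l_closed[of I "pring n" F G] by simp

lemma ideal_pring_carrier: "ideal I (pring n) \<Longrightarrow> F \<in> I \<Longrightarrow> F \<in> carrier (pring n)"
  using additive_subgroup.a_Hcarr[OF ideal.axioms(1)] by fastforce

lemma ideal_pring_uminus: "ideal I (pring n) \<Longrightarrow> F \<in> I \<Longrightarrow> - F \<in> I"
  using ideal_pring_mult[of I n F "- 1"] by (auto intro: pring_uminus)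

lemma ideal_pring_diff: "ideal I (pring n) \<Longrightarrow> F \<in> I \<Longrightarrow> G \<in> I \<Longrightarrow> F - G \<in> I"
  using ideal_pring_add[of I n F "- G"] ideal_pring_uminus by fastforce

lemma ideal_pring_sum: "ideal I (pring n) \<Longrightarrow> (\<And>i. i \<in> A \<Longrightarrow> f i \<in> I) \<Longrightarrow> sum f A \<in> I"
  by (induction A rule: infinite_finite_induct) (auto intro: ideal_pring_add ideal_pring_0)

lemma ideal_pringI:
  assumes "I \<subseteq> carrier (pring n)" "0 \<in> I" "\<And>F G. F \<in> I \<Longrightarrow> G \<in> I \<Longrightarrow> F + G \<in> I"
    "\<And>F G. F \<in> I \<Longrightarrow> G \<in> carrier (pring n) \<Longrightarrow> G * F \<in> I"
  shows "ideal I (pring n)"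
proof (rule idealI)
  show "ring (pring n)" by (rule pring.ring_axioms)
  have "- F \<in> I" if "F \<in> I" for F using assms(4)[OF that, of "- 1"] by auto
  then show "subgroup I (add_monoid (pring n))"
    by (intro group.subgroupI[OF pring.add.is_group])
       (use assms pring_a_inv[unfolded a_inv_def] in \<open>auto simp: subset_iff\<close>)
qed (use assms in \<open>auto simp: mult.commute\<close>)

lemma coset_pring:
  assumes "ideal I (pring n)" "F \<in> carrier (pring n)"
  shows "I +>\<^bsub>pring n\<^esub> F = {G. G - F \<in> I}"
  by (force simp: a_r_coset_def r_coset_def pring_def intro: exI[of _ "_ - F"] diff_add_cancel[symmetric])

lemma coset_pring_eq_iff:
  assumes "ideal I (pring n)" "F \<in> carrier (pring n)" "G \<in> carrier (pring n)"
  shows "I +>\<^bsub>pring n\<^esub> F = I +>\<^bsub>pring n\<^esub> G \<longleftrightarrow> F - G \<in> I"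
proof
  assume "I +>\<^bsub>pring n\<^esub> F = I +>\<^bsub>pring n\<^esub> G"
  moreover have "F \<in> I +>\<^bsub>pring n\<^esub> F" using coset_pring assms ideal_pring_0 by auto
  ultimately show "F - G \<in> I" using coset_pring assms by auto
next
  assume *: "F - G \<in> I"
  have "H - F \<in> I \<longleftrightarrow> H - G \<in> I" for H
    using ideal_pring_add[OF assms(1) *, of "H - F"] ideal_pring_diff[OF assms(1) _ *, of "H - G"]
    by (auto simp: algebra_simps)
  then show "I +>\<^bsub>pring n\<^esub> F = I +>\<^bsub>pring n\<^esub> G" using coset_pring assms by auto
qed

section \<open>Iterated trees and their quartets\<close>

lemma keys_add_nat: "keys (m + m' :: 'a monomial) = keys m \<union> keys m'"
  by (auto simp: in_keys_iff lookup_add)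

text \<open>
  The monomial of the coordinate with unordered index pair \<open>a, b\<close>.  Monomials are thus
  multigraphs on the leaves.
\<close>

definition edge :: "nat \<Rightarrow> nat \<Rightarrow> (nat \<times> nat) monomial" where
  "edge a b = single (min a b, max a b) 1"

lemma edge_commute: "edge a b = edge b a"
  by (simp add: edge_def min.commute max.commute)

lemma edge_eq_iff: "edge a b = edge c d \<longleftrightarrow> (a = c \<and> b = d) \<or> (a = d \<and> b = c)"
proof -
  have "edge a b = edge c d \<longleftrightarrow> min a b = min c d \<and> max a b = max c d"
    unfolding edge_def
    by (metis keys_single prod.inject singleton_inject zero_neq_one)
  then show ?thesis by (auto simp: min_def max_def split: if_splits)
qed

lemma edge_lt: "a < b \<Longrightarrow> edge a b = single (a, b) 1"
  by (simp add: edge_def)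

lemma edge_in_monomials: "a \<noteq> b \<Longrightarrow> a \<in> {1..n} \<Longrightarrow> b \<in> {1..n} \<Longrightarrow> edge a b \<in> monomials n"
  by (auto simp: edge_def pairs_def min_def max_def)

lemma single_le_split:
  fixes m :: "'a monomial"
  assumes "p \<in> keys m"
  shows "\<exists>m'. m = m' + single p 1"
proof -
  have "m = (m - single p 1) + single p 1"
    using assms by (intro poly_mapping_eqI) (auto simp: lookup_add lookup_minus lookup_single when_def in_keys_iff)
  then show ?thesis by blast
qed

lemma add_single_eq_cases:
  fixes m m' :: "'a monomial"
  assumes "m + single p 1 = m' + single q 1"
  shows "(p = q \<and> m = m') \<or> (\<exists>\<mu>. m = \<mu> + single q 1 \<and> m' = \<mu> + single p 1)"
proof (cases "p = q")
  case True
  then show ?thesis using assms by simp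
next
  case False
  have "q \<in> keys (m' + single q 1)" by (simp add: keys_add_nat)
  then have "q \<in> keys m \<union> keys (single p (1::nat))" using assms keys_add_nat by metis
  then have "q \<in> keys m" using False by simp
  from single_le_split[OF this] obtain \<mu> where \<mu>: "m = \<mu> + single q 1" ..
  have "(\<mu> + single p 1) + single q 1 = m + single p 1"
    unfolding \<mu> by (simp only: ac_simps)
  also note assms
  finally have "m' + single q 1 = (\<mu> + single p 1) + single q 1" by (rule sym)
  then have "m' = \<mu> + single p 1" by (simp del: One_nat_def)
  then show ?thesis using \<mu> by blast
qed

lemma add_edge_eq_cases:
  assumes "m + edge a b = m' + edge c d"
  shows "(edge a b = edge c d \<and> m = m') \<or> (\<exists>\<mu>. m = \<mu> + edge c d \<and> m' = \<mu> + edge a b)"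
  using add_single_eq_cases[of m _ m'] assms unfolding edge_def by (metis (no_types))

text \<open>
  Step \<open>k\<close> attaches the leaf \<open>k\<close> next to the leaf \<open>i k\<close>.  The leaf \<open>j k\<close> only
  affects the exponents.
\<close>

locale iterated =
  fixes n :: nat and i j :: "nat \<Rightarrow> nat"
  assumes i_less: "k \<in> {3..n} \<Longrightarrow> i k \<in> {1..<k}"
    and j_less: "k \<in> {3..n} \<Longrightarrow> j k \<in> {1..<k}"
    and i_neq_j: "k \<in> {3..n} \<Longrightarrow> i k \<noteq> j k"
begin

text \<open>
  The tree separates \<open>a, b\<close> from \<open>c, d\<close>.  The leaves \<open>k\<close> and \<open>i k\<close> form a
  cherry at the time \<open>k\<close> is attached, and otherwise \<open>k\<close> behaves like \<open>i k\<close>.  Properties of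
  the tree are proved by induction over these rules.
\<close>

inductive qt :: "nat \<Rightarrow> nat \<Rightarrow> nat \<Rightarrow> nat \<Rightarrow> bool" where
  cherry: "k \<in> {3..n} \<Longrightarrow> a \<in> {1..<k} \<Longrightarrow> b \<in> {1..<k} \<Longrightarrow> a \<noteq> i k \<Longrightarrow> b \<noteq> i k \<Longrightarrow> a \<noteq> b \<Longrightarrow>
    qt k (i k) a b"
| lift: "k \<in> {3..n} \<Longrightarrow> a \<in> {1..<k} \<Longrightarrow> b \<in> {1..<k} \<Longrightarrow> c \<in> {1..<k} \<Longrightarrow> qt (i k) a b c \<Longrightarrow> qt k a b c"
| swap: "qt a b c d \<Longrightarrow> qt b a c d"
| flip: "qt a b c d \<Longrightarrow> qt c d a b"

lemma swap': "qt a b c d \<Longrightarrow> qt a b d c"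
  using swap flip by blast

lemma qt_distinct:
  "qt a b c d \<Longrightarrow> distinct [a, b, c, d] \<and> {a, b, c, d} \<subseteq> {1..n}"
proof (induction rule: qt.induct)
  case (cherry k a b)
  then show ?case using i_less[of k] by auto
qed (auto dest: i_less)

text \<open>
  Any function that agrees on \<open>k\<close> and \<open>i k\<close> up to a constant \<open>\<delta> k\<close> is additive on
  quartets.  The exponents, the tree weight and every tropical weight of the tree are of this kind.
\<close>

lemma qt_additive:
  fixes F :: "nat \<Rightarrow> nat \<Rightarrow> 'x::cancel_comm_monoid_add"
  assumes sym: "\<And>a b. F a b = F b a"
    and F: "\<And>k a. k \<in> {3..n} \<Longrightarrow> a \<in> {1..<k} \<Longrightarrow> a \<noteq> i k \<Longrightarrow> F k a = F (i k) a + \<delta> k"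
    and "qt a b c d"
  shows "F a c + F b d = F a d + F b c"
  using assms(3)
proof (induction rule: qt.induct)
  case (cherry k a b)
  then show ?case using F by (simp add: ac_simps)
next
  case (lift k a b c)
  have "F (i k) b + F a c + \<delta> k = F (i k) c + F a b + \<delta> k" using lift by simp
  then show ?case using F lift qt_distinct[OF lift(5)] by (simp add: ac_simps)
next
  case (swap a b c d)
  then show ?case by (simp add: add.commute)
next
  case (flip a b c d)
  then show ?case by (metis sym add.commute)
qed

text \<open>
  The third matching of a quartet only has to be compared at cherries, because in a lifted
  quartet all three matchings change by the same \<open>\<delta> k\<close>.
\<close>

lemma qt_related:
  fixes F :: "nat \<Rightarrow> nat \<Rightarrow> 'x::cancel_comm_monoid_add"
  assumes sym: "\<And>a b. F a b = F b a"
    and F: "\<And>k a. k \<in> {3..n} \<Longrightarrow> a \<in> {1..<k} \<Longrightarrow> a \<noteq> i k \<Longrightarrow> F k a = F (i k) a + \<delta> k"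
    and R: "\<And>x y z. R x y \<Longrightarrow> R (x + z) (y + z)"
    and base: "\<And>k a b. k \<in> {3..n} \<Longrightarrow> a \<in> {1..<k} \<Longrightarrow> b \<in> {1..<k} \<Longrightarrow> a \<noteq> i k \<Longrightarrow> b \<noteq> i k \<Longrightarrow> a \<noteq> b \<Longrightarrow>
      R (F k a + F (i k) b) (F k (i k) + F a b)"
    and "qt a b c d"
  shows "R (F a c + F b d) (F a b + F c d)"
  using assms(5)
proof (induction rule: qt.induct)
  case (cherry k a b)
  then show ?case using base by blast
next
  case (lift k a b c)
  have "R (F (i k) b + F a c + \<delta> k) (F (i k) a + F b c + \<delta> k)" using lift R by blast
  then show ?case using F lift qt_distinct[OF lift(5)] by (simp add: ac_simps)
next
  case (swap a b c d)
  have "F a c + F b d = F a d + F b c"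
    by (rule qt_additive[where F = F and \<delta> = \<delta>, OF sym F swap(1)])
  then show ?case using swap sym by (metis add.commute)
next
  case (flip a b c d)
  then show ?case by (metis sym add.commute)
qed

definition resolved :: "nat \<Rightarrow> nat \<Rightarrow> nat \<Rightarrow> nat \<Rightarrow> bool" where
  "resolved a b c d \<longleftrightarrow> qt a b c d \<or> qt a c b d \<or> qt a d b c"

lemma resolved_sym: "resolved a b c d \<Longrightarrow> resolved b a c d \<and> resolved a c b d \<and> resolved a b d c"
  unfolding resolved_def using swap swap' flip by blast

text \<open>
  The largest of four leaves is either in a cherry with one of the others, or it may be replaced
  by its neighbour, which lowers the sum of the leaves.
\<close>

lemma resolvedI:
  "distinct [a, b, c, d] \<Longrightarrow> {a, b, c, d} \<subseteq> {1..n} \<Longrightarrow> resolved a b c d"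
proof (induction "a + b + c + d" arbitrary: a b c d rule: less_induct)
  case less
  have main: "resolved k x y z"
    if d: "distinct [k, x, y, z]" "{k, x, y, z} \<subseteq> {1..n}" "x < k" "y < k" "z < k" "k + x + y + z = a + b + c + d"
    for k x y z
  proof -
    have k: "k \<in> {3..n}" using that by auto
    have xyz: "x \<in> {1..<k}" "y \<in> {1..<k}" "z \<in> {1..<k}" using that by auto
    show ?thesis
    proof (cases "i k \<in> {x, y, z}")
      case True
      then have "qt k x y z \<or> qt k y x z \<or> qt k z x y"
        using cherry[OF k] xyz d by auto
      then show ?thesis by (auto simp: resolved_def intro: swap')
    next
      case False
      have "i k \<in> {1..<k}" by (rule i_less[OF k])
      then have "resolved (i k) x y z" using False d by (intro less.hyps) auto
      then show ?thesis using lift[OF k] xyz by (auto simp: resolved_def)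
    qed
  qed
  consider "b < a" "c < a" "d < a" | "a < b" "c < b" "d < b" | "a < c" "b < c" "d < c" | "a < d" "b < d" "c < d"
    using less.prems by fastforce
  then show ?case
  proof cases
    case 1 then show ?thesis using main[of a b c d] less.prems by auto
  next
    case 2 then have "resolved b a c d" using main[of b a c d] less.prems by auto
    then show ?thesis using resolved_sym by blast
  next
    case 3 then have "resolved c a b d" using main[of c a b d] less.prems by auto
    then show ?thesis using resolved_sym by blast
  next
    case 4 then have "resolved d a b c" using main[of d a b c] less.prems by auto
    then show ?thesis using resolved_sym by blast
  qed
qed

text \<open>
  A weight that is strict on the quartets.  The pair merged at step \<open>k\<close> gets the weight \<open>3 ^ k\<close>, which
  exceeds twice any earlier weight, and \<open>k\<close> inherits all its other weights from \<open>i k\<close>.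
\<close>

function tree_weight_ordered :: "nat \<Rightarrow> nat \<Rightarrow> real" where
  "tree_weight_ordered a b =
    (if a < b \<and> b \<in> {3..n} then
       (if a = i b then 3 ^ b else tree_weight_ordered (min a (i b)) (max a (i b)))
     else 0)"
  by pat_completeness auto
termination
  by (relation "Wellfounded.measure (\<lambda>(a, b). a + b)") (use i_less in \<open>force+\<close>)

declare tree_weight_ordered.simps [simp del]

definition tree_weight :: "nat \<Rightarrow> nat \<Rightarrow> real" where
  "tree_weight a b = tree_weight_ordered (min a b) (max a b)"

lemma tree_weight_sym: "tree_weight a b = tree_weight b a"
  by (simp add: tree_weight_def min.commute max.commute)

lemma tree_weight_step:
  assumes "k \<in> {3..n}" "a \<in> {1..<k}" "a \<noteq> i k"
  shows "tree_weight k a = tree_weight (i k) a + 0"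
proof -
  have "min k a = a" "max k a = k" using assms by auto
  then show ?thesis using assms
    by (simp add: tree_weight_def tree_weight_ordered.simps[of a k] min.commute max.commute)
qed

lemma tree_weight_cherry: assumes "k \<in> {3..n}" shows "tree_weight k (i k) = 3 ^ k"
proof -
  have "min k (i k) = i k" "max k (i k) = k" using i_less[OF assms] by auto
  then show ?thesis using assms i_less[OF assms]
    by (simp add: tree_weight_def tree_weight_ordered.simps[of "i k" k])
qed

lemma tree_weight_ordered_bounds: "0 \<le> tree_weight_ordered a b \<and> tree_weight_ordered a b \<le> 3 ^ max a b"
proof (induction a b rule: tree_weight_ordered.induct)
  case (1 a b)
  show ?case
  proof (cases "a < b \<and> b \<in> {3..n} \<and> a \<noteq> i b")
    case True
    then have "i b < b" using i_less[of b] by auto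
    then have pow: "(3::real) ^ max a (i b) \<le> 3 ^ b"
      using True by (intro power_increasing) auto
    have eq: "tree_weight_ordered a b = tree_weight_ordered (min a (i b)) (max a (i b))" "max a b = b"
      using True by (auto simp add: tree_weight_ordered.simps[of a b])
    have "0 \<le> tree_weight_ordered (min a (i b)) (max a (i b)) \<and>
        tree_weight_ordered (min a (i b)) (max a (i b)) \<le> 3 ^ max a (i b)"
      using "1.IH" True by (auto simp: max.absorb2)
    then show ?thesis unfolding eq using pow by linarith
  next
    case False
    then show ?thesis by (auto simp add: tree_weight_ordered.simps[of a b])
  qed
qed

lemma tree_weight_bounds: "0 \<le> tree_weight a b \<and> tree_weight a b \<le> 3 ^ max a b"
  using tree_weight_ordered_bounds[of "min a b" "max a b"] by (simp add: tree_weight_def max.absorb2)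

text \<open>
  At a cherry \<open>k\<close>, the two smaller leaves contribute at most \<open>2 * 3 ^ (k - 1)\<close>, which is less
  than the weight \<open>3 ^ k\<close> of the cherry.
\<close>

lemma tree_weight_strict:
  assumes "qt a b c d"
  shows "tree_weight a c + tree_weight b d < tree_weight a b + tree_weight c d"
proof (rule qt_related[where R = "(<)" and F = tree_weight, OF tree_weight_sym tree_weight_step _ _ assms])
  fix k a b assume k: "k \<in> {3..n}" and ab: "a \<in> {1..<k}" "b \<in> {1..<k}" "a \<noteq> i k" "b \<noteq> i k" "a \<noteq> b"
  have "i k < k" using i_less[OF k] by auto
  have le: "tree_weight (i k) x \<le> 3 ^ (k - 1)" if "x \<in> {1..<k}" for x
  proof -
    have "tree_weight (i k) x \<le> 3 ^ max (i k) x" using tree_weight_bounds by blast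
    also have "\<dots> \<le> 3 ^ (k - 1)" using \<open>i k < k\<close> that by (intro power_increasing) auto
    finally show ?thesis .
  qed
  have "(3::real) ^ k = 3 * 3 ^ (k - 1)" using k by (simp add: power_eq_if)
  then have "tree_weight (i k) a + tree_weight (i k) b < 3 ^ k"
    using le[OF ab(1)] le[OF ab(2)] by (smt (verit) zero_less_power)
  then show "tree_weight k a + tree_weight (i k) b < tree_weight k (i k) + tree_weight a b"
    using tree_weight_step[OF k ab(1,3)] tree_weight_cherry[OF k] tree_weight_bounds[of a b] by linarith
qed auto

lemma tree_weight_additive:
  "qt a b c d \<Longrightarrow> tree_weight a c + tree_weight b d = tree_weight a d + tree_weight b c"
  by (rule qt_additive[where F = tree_weight, OF tree_weight_sym tree_weight_step]) auto

lemma qt_unique: "qt a b c d \<Longrightarrow> \<not> qt a c b d"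
  using tree_weight_strict[of a b c d] tree_weight_strict[of a c b d] tree_weight_sym[of c b] by auto

text \<open>
  The leading exponent of \<open>P\<^sub>a\<^sub>b\<close> for \<open>a < b\<close>.  The variables of step \<open>b\<close> have the
  indices \<open>2 * (n - b) + 1\<close> and \<open>2 * (n - b) + 2\<close>, because a sequence lists its roots from step \<open>n\<close>
  downwards.
\<close>

function texp_ordered :: "nat \<Rightarrow> nat \<Rightarrow> nat monomial" where
  "texp_ordered a b =
    (if a < b \<and> b \<in> {3..n} then
       (if a = i b
        then texp_ordered (min (i b) (j b)) (max (i b) (j b)) + single (2 * (n - b) + 2) 1
        else texp_ordered (min a (i b)) (max a (i b)) + single (2 * (n - b) + 1) 1)
     else 0)"
  by pat_completeness auto
termination
proof (relation "Wellfounded.measure (\<lambda>(a, b). a + b)", goal_cases)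
  case (2 a b) then show ?case using j_less[of b] by auto
next
  case (3 a b) then show ?case using i_less[of b] by auto
qed auto

declare texp_ordered.simps [simp del]

definition texp :: "nat \<Rightarrow> nat \<Rightarrow> nat monomial" where
  "texp a b = texp_ordered (min a b) (max a b)"

lemma texp_sym: "texp a b = texp b a"
  by (simp add: texp_def min.commute max.commute)

lemma texp_step:
  assumes "k \<in> {3..n}" "a \<in> {1..<k}" "a \<noteq> i k"
  shows "texp k a = texp (i k) a + single (2 * (n - k) + 1) 1"
proof -
  have "min k a = a" "max k a = k" using assms by auto
  then show ?thesis using assms
    by (simp add: texp_def texp_ordered.simps[of a k] min.commute max.commute)
qed

lemma texp_cherry:
  assumes "k \<in> {3..n}" shows "texp k (i k) = texp (i k) (j k) + single (2 * (n - k) + 2) 1"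
proof -
  have "min k (i k) = i k" "max k (i k) = k" using i_less[OF assms] by auto
  then show ?thesis using assms i_less[OF assms]
    by (simp add: texp_def texp_ordered.simps[of "i k" k])
qed

lemma texp_ordered_index_bound:
  "l \<in> keys (texp_ordered a b) \<Longrightarrow> 2 * (n - max a b) < l \<and> l \<le> 2 * (n - 2)"
proof (induction a b rule: texp_ordered.induct)
  case (1 a b)
  show ?case
  proof (cases "a < b \<and> b \<in> {3..n}")
    case True
    then have less: "i b < b" "j b < b" using i_less[of b] j_less[of b] by auto
    show ?thesis
    proof (cases "a = i b")
      case ab: True
      with "1.prems" True have "l \<in> keys (texp_ordered (min (i b) (j b)) (max (i b) (j b))) \<or> l = 2 * (n - b) + 2"
        by (auto simp: keys_add_nat texp_ordered.simps[of "i b" b])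
      then show ?thesis using "1.IH"(1) True ab less by auto
    next
      case ab: False
      with "1.prems" True have "l \<in> keys (texp_ordered (min a (i b)) (max a (i b))) \<or> l = 2 * (n - b) + 1"
        by (auto simp: keys_add_nat texp_ordered.simps[of a b])
      then show ?thesis using "1.IH"(2) True ab less by auto
    qed
  next
    case False
    with "1.prems" show ?thesis by (auto simp: texp_ordered.simps[of a b])
  qed
qed

lemma texp_index_bound:
  "l \<in> keys (texp a b) \<Longrightarrow> 2 * (n - max a b) < l \<and> l \<le> 2 * (n - 2)"
  using texp_ordered_index_bound[of l "min a b" "max a b"] by (simp add: texp_def max.absorb2)

lemma texp_lookup_low: "a < k \<Longrightarrow> b < k \<Longrightarrow> l \<le> 2 * (n - k) + 2 \<Longrightarrow> k \<le> n \<Longrightarrow> lookup (texp a b) l = 0"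
  using texp_index_bound[of l a b] by (cases "l \<in> keys (texp a b)") (auto simp: max_def in_keys_iff split: if_splits)

lemma texp_lookup_0: "lookup (texp a b) 0 = 0"
  using texp_index_bound[of 0 a b] by (auto simp: in_keys_iff)

lemma texp_additive: "qt a b c d \<Longrightarrow> texp a c + texp b d = texp a d + texp b c"
  by (rule qt_additive[where F = texp, OF texp_sym texp_step]) auto

text \<open>
  At a cherry, only the matching that contains the pair \<open>k, i k\<close> involves the second variable of
  step \<open>k\<close>.
\<close>

lemma texp_strict: assumes "qt a b c d" shows "texp a c + texp b d \<noteq> texp a b + texp c d"
proof (rule qt_related[where R = "(\<noteq>)" and F = texp, OF texp_sym texp_step _ _ assms])
  fix k a b assume k: "k \<in> {3..n}" and ab: "a \<in> {1..<k}" "b \<in> {1..<k}" "a \<noteq> i k" "b \<noteq> i k" "a \<noteq> b"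
  have "i k < k" "j k < k" using i_less[OF k] j_less[OF k] by auto
  then have "lookup (texp k a + texp (i k) b) (2 * (n - k) + 2) \<noteq> lookup (texp k (i k) + texp a b) (2 * (n - k) + 2)"
    using k ab by (simp add: texp_step texp_cherry lookup_add texp_lookup_low lookup_single when_def)
  then show "texp k a + texp (i k) b \<noteq> texp k (i k) + texp a b" by metis
qed auto

section \<open>Monomials with equal exponents are connected by quartet moves\<close>

text \<open>
  The bound \<open>k\<close> on the leaves is what makes the induction over the tree work: among
  \<open>1, \<dots>, k\<close>, the leaves \<open>k\<close> and \<open>i k\<close> form a cherry, but leaves attached later may separate them.
\<close>

inductive move :: "nat \<Rightarrow> (nat \<times> nat) monomial \<Rightarrow> (nat \<times> nat) monomial \<Rightarrow> bool" for k where
  move: "qt a b c d \<Longrightarrow> {a, b, c, d} \<subseteq> {1..k} \<Longrightarrow>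
    move k (m + edge b d + edge a c) (m + edge b c + edge a d)"

text \<open>
  A move among the edges at \<open>i k\<close> can be copied when one of these edges is redirected to \<open>k\<close>, as
  the two leaves have the same quartets with all others.
\<close>

lemma move_core:
  assumes k: "k \<in> {3..n}" and a: "a \<in> {1..<k}"
    and q: "qt (i k) y a w" and yw: "{y, w} \<subseteq> {1..k}"
  shows "\<exists>m2 c. \<mu> + edge (i k) w + edge y a = m2 + edge c (i k) \<and> c \<noteq> i k \<and> c \<in> {1..<k} \<and>
    (move k)\<^sup>*\<^sup>* (\<mu> + edge y w + edge a k) (m2 + edge c k)"
proof -
  have dist: "distinct [i k, y, a, w]" using qt_distinct[OF q] by auto
  have ik: "i k \<in> {1..<k}" by (rule i_less[OF k])
  (* k cannot be on the far side of the quartet, because k and i k form a cherry. *)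
  have wk: "w \<noteq> k"
  proof
    assume w: "w = k"
    then have "qt k (i k) a y" using dist yw a k by (intro cherry) auto
    then have "qt (i k) k a y" by (rule swap)
    moreover have "qt (i k) y k a" using q w swap' by blast
    ultimately show False using qt_unique swap' by blast
  qed
  have w: "w \<in> {1..<k}" "w \<noteq> i k" using wk yw dist by auto
  have eq: "\<mu> + edge (i k) w + edge y a = (\<mu> + edge y a) + edge w (i k)"
    by (simp add: ac_simps edge_commute)
  have "(move k)\<^sup>*\<^sup>* (\<mu> + edge y w + edge a k) (\<mu> + edge y a + edge w k)"
  proof (cases "y = k")
    case True
    then show ?thesis by (simp add: ac_simps edge_commute)
  next
    case False
    then have "qt k y a w" using yw a w qt_distinct[OF q] by (intro lift[OF k _ _ _ q]) auto
    from move[OF this, of k \<mu>] have "move k (\<mu> + edge y w + edge k a) (\<mu> + edge y a + edge k w)"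
      using yw a k by auto
    then show ?thesis by (simp add: edge_commute)
  qed
  with eq w show ?thesis by blast
qed

lemma move_lift:
  assumes k: "k \<in> {3..n}" and a: "a \<in> {1..<k}" "a \<noteq> i k"
    and mv: "move k M M''" and M: "M = m1 + edge a (i k)"
  shows "\<exists>m2 c. M'' = m2 + edge c (i k) \<and> c \<noteq> i k \<and> c \<in> {1..<k} \<and>
    (move k)\<^sup>*\<^sup>* (m1 + edge a k) (m2 + edge c k)"
  using mv
proof cases
  case (move x y z w \<mu>)
  note q = move(3)
  have eqM: "m1 + edge a (i k) = \<mu> + edge y w + edge x z" using M move by simp
  have eqM': "m1 + edge a (i k) = \<mu> + edge x z + edge y w" using eqM by (simp add: ac_simps)
  have rng: "{x, y, z, w} \<subseteq> {1..k}" using move by auto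
  have xz: ?thesis if e: "edge a (i k) = edge x z"
  proof -
    have m1: "m1 = \<mu> + edge y w" using eqM e by simp
    from e consider "x = i k" "z = a" | "x = a" "z = i k" by (auto simp: edge_eq_iff)
    then show ?thesis
    proof cases
      case 1
      then show ?thesis using move_core[OF k a(1), of y w \<mu>] q rng unfolding move(2) m1
        by (simp add: ac_simps)
    next
      case 2
      then have "qt (i k) w a y" using q flip by blast
      then show ?thesis using move_core[OF k a(1), of w y \<mu>] 2 rng unfolding move(2) m1
        by (simp add: ac_simps edge_commute)
    qed
  qed
  have yw: ?thesis if e: "edge a (i k) = edge y w"
  proof -
    have m1: "m1 = \<mu> + edge x z" using eqM' e by simp
    from e consider "y = i k" "w = a" | "y = a" "w = i k" by (auto simp: edge_eq_iff)
    then show ?thesis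
    proof cases
      case 1
      then have "qt (i k) x a z" using q swap swap' by blast
      then show ?thesis using move_core[OF k a(1), of x z \<mu>] 1 rng unfolding move(2) m1
        by (simp add: ac_simps edge_commute)
    next
      case 2
      then have "qt (i k) z a x" using q swap swap' flip by blast
      then show ?thesis using move_core[OF k a(1), of z x \<mu>] 2 rng unfolding move(2) m1
        by (simp add: ac_simps edge_commute)
    qed
  qed
  consider "edge a (i k) = edge x z" | "edge a (i k) = edge y w" | \<mu>' where
      "\<mu> = \<mu>' + edge a (i k)" "m1 = \<mu>' + edge y w + edge x z"
  proof -
    assume A: "edge a (i k) = edge x z \<Longrightarrow> thesis" "edge a (i k) = edge y w \<Longrightarrow> thesis"
      "\<And>\<mu>'. \<mu> = \<mu>' + edge a (i k) \<Longrightarrow> m1 = \<mu>' + edge y w + edge x z \<Longrightarrow> thesis"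
    from add_edge_eq_cases[OF eqM] show thesis
    proof
      assume "\<exists>\<nu>. m1 = \<nu> + edge x z \<and> \<mu> + edge y w = \<nu> + edge a (i k)"
      then obtain \<nu> where \<nu>: "m1 = \<nu> + edge x z" "\<mu> + edge y w = \<nu> + edge a (i k)" by blast
      from add_edge_eq_cases[OF \<nu>(2)] show thesis
      proof
        assume "edge y w = edge a (i k) \<and> \<mu> = \<nu>"
        then show thesis using A(2) by metis
      next
        assume "\<exists>\<mu>'. \<mu> = \<mu>' + edge a (i k) \<and> \<nu> = \<mu>' + edge y w"
        then show thesis using A(3) \<nu>(1) by metis
      qed
    qed (use A in blast)
  qed
  then show ?thesis
  proof cases
    case (3 \<mu>')
    have "move k (\<mu>' + edge a k + edge y w + edge x z) (\<mu>' + edge a k + edge y z + edge x w)"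
      by (rule move.intros[OF q rng])
    then have "move k (m1 + edge a k) (\<mu>' + edge y z + edge x w + edge a k)"
      using 3 by (simp add: ac_simps)
    moreover have "M'' = (\<mu>' + edge y z + edge x w) + edge a (i k)"
      unfolding move(2) 3(1) by (simp only: ac_simps)
    ultimately show ?thesis using a by blast
  qed (use xz yw in auto)
qed

text \<open>
  Along a path of moves, one edge at \<open>i k\<close> is followed and redirected to \<open>k\<close>.  It may get
  a different second end point, hence the existential quantifier.
\<close>

lemma moves_lift:
  assumes k: "k \<in> {3..n}" and a: "a \<in> {1..<k}" "a \<noteq> i k"
    and "(move k)\<^sup>*\<^sup>* (m1 + edge a (i k)) M'"
  shows "\<exists>m2 c. M' = m2 + edge c (i k) \<and> c \<noteq> i k \<and> c \<in> {1..<k} \<and>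
    (move k)\<^sup>*\<^sup>* (m1 + edge a k) (m2 + edge c k)"
  using assms(4)
proof (induction rule: rtranclp_induct)
  case base
  then show ?case using a by blast
next
  case (step M M')
  then obtain m2 c where mc: "M = m2 + edge c (i k)" "c \<noteq> i k" "c \<in> {1..<k}"
    "(move k)\<^sup>*\<^sup>* (m1 + edge a k) (m2 + edge c k)" by blast
  from move_lift[OF k mc(3,2) step(2) mc(1)] obtain m3 c' where "M' = m3 + edge c' (i k)" "c' \<noteq> i k"
    "c' \<in> {1..<k}" "(move k)\<^sup>*\<^sup>* (m2 + edge c k) (m3 + edge c' k)" by blast
  moreover from this(4) mc(4) have "(move k)\<^sup>*\<^sup>* (m1 + edge a k) (m3 + edge c' k)" by simp
  ultimately show ?case by blast
qed

text \<open>
  It does not matter which edge at \<open>i k\<close> is redirected to \<open>k\<close>: exchanging two of them is a move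
  at the cherry.
\<close>

lemma moves_relabel:
  assumes k: "k \<in> {3..n}" and a: "a \<in> {1..<k}" "a \<noteq> i k" and b: "b \<in> {1..<k}" "b \<noteq> i k"
    and mv: "(move k)\<^sup>*\<^sup>* (m + edge a (i k)) (m' + edge b (i k))"
  shows "(move k)\<^sup>*\<^sup>* (m + edge a k) (m' + edge b k)"
proof -
  obtain m2 c where mc: "m' + edge b (i k) = m2 + edge c (i k)" "c \<noteq> i k" "c \<in> {1..<k}"
    "(move k)\<^sup>*\<^sup>* (m + edge a k) (m2 + edge c k)" using moves_lift[OF k a mv] by blast
  have "(move k)\<^sup>*\<^sup>* (m2 + edge c k) (m' + edge b k)"
  proof (cases "b = c")
    case True
    then show ?thesis using mc(1) by simp
  next
    case False
    then have "edge b (i k) \<noteq> edge c (i k)" by (auto simp: edge_eq_iff)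
    then obtain \<mu> where \<mu>: "m' = \<mu> + edge c (i k)" "m2 = \<mu> + edge b (i k)"
      using add_edge_eq_cases[OF mc(1)] by blast
    have "qt k (i k) c b" using k b mc False by (intro cherry) auto
    from move[OF this, of k \<mu>] have "move k (m2 + edge c k) (m' + edge b k)"
      using i_less[OF k] mc b k unfolding \<mu> by (auto simp: edge_commute)
    then show ?thesis by blast
  qed
  then show ?thesis using mc(4) by simp
qed

lemma move_mono: assumes "move k m m'" "k \<le> k'" shows "move k' m m'"
  using assms(1)
proof cases
  case (move a b c d m)
  from move(4) assms(2) have "{a, b, c, d} \<subseteq> {1..k'}" by auto
  from move.intros[OF move(3) this] show ?thesis unfolding move(1,2) .
qed

lemma moves_mono: "k \<le> k' \<Longrightarrow> (move k)\<^sup>*\<^sup>* m m' \<Longrightarrow> (move k')\<^sup>*\<^sup>* m m'"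
  using mono_rtranclp[of "move k" "move k'"] move_mono by blast

text \<open>
  Index \<open>0\<close> records the degree.  Without it, \<open>hexp\<close> would vanish on the pair \<open>1, 2\<close>.
\<close>

definition hexp :: "nat \<times> nat \<Rightarrow> nat monomial" where
  "hexp p = single 0 1 + texp (fst p) (snd p)"

abbreviation vh :: "(nat \<times> nat) monomial \<Rightarrow> nat monomial" where
  "vh \<equiv> mon_sum hexp"

lemma vh_edge: "vh (edge a b) = single 0 1 + texp a b"
  by (simp add: edge_def hexp_def min_def max_def texp_sym)

lemma lookup_vh_0: "lookup (vh m) 0 = total_degree m"
  by (simp add: lookup_mon_sum total_degree_def hexp_def lookup_add texp_lookup_0)

text \<open>
  The two variables of step \<open>k\<close> count the edges at \<open>k\<close>: the second one those to
  \<open>i k\<close>, the first one the others.  So both counts can be read off from the exponent.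
\<close>

lemma vh_lookup_cherry:
  assumes k: "k \<in> {3..n}" and m: "m \<in> monomials k"
  shows "lookup (vh m) (2 * (n - k) + 2) = lookup m (i k, k)"
proof -
  have hl: "lookup (hexp p) (2 * (n - k) + 2) = (if p = (i k, k) then 1 else 0)" if p: "p \<in> pairs k" for p
  proof -
    obtain a b where ab: "p = (a, b)" "1 \<le> a" "a < b" "b \<le> k" using p by (auto simp: pairs_def)
    have ik: "i k < k" "j k < k" using i_less[OF k] j_less[OF k] by auto
    show ?thesis
    proof (cases "b = k")
      case True
      have "texp a b = texp k a" using texp_sym True by simp
      then show ?thesis using ab True k ik texp_step[OF k, of a] texp_cherry[OF k]
        by (auto simp: hexp_def lookup_add lookup_single texp_lookup_low)
    next
      case False
      then have "lookup (texp a b) l = 0" if "l \<le> 2 * (n - k) + 2" for l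
        using ab k that by (intro texp_lookup_low[of a k b l]) auto
      then show ?thesis using ab False by (auto simp: hexp_def lookup_add lookup_single)
    qed
  qed
  have "lookup (vh m) (2 * (n - k) + 2) = (\<Sum>p\<in>keys m. if p = (i k, k) then lookup m p else 0)"
    unfolding lookup_mon_sum
  proof (rule sum.cong[OF refl])
    fix p assume "p \<in> keys m"
    then have "p \<in> pairs k" using m by auto
    from hl[OF this] show "lookup m p * lookup (hexp p) (2 * (n - k) + 2) = (if p = (i k, k) then lookup m p else 0)"
      by simp
  qed
  then show ?thesis by (auto simp: sum.delta in_keys_iff)
qed

lemma vh_lookup_step_pos:
  assumes k: "k \<in> {3..n}" and m: "m \<in> monomials k"
  shows "lookup (vh m) (2 * (n - k) + 1) > 0 \<longleftrightarrow> (\<exists>a. a \<noteq> i k \<and> (a, k) \<in> keys m)"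
proof -
  have hl: "lookup (hexp p) (2 * (n - k) + 1) = (if snd p = k \<and> fst p \<noteq> i k then 1 else 0)" if p: "p \<in> pairs k" for p
  proof -
    obtain a b where ab: "p = (a, b)" "1 \<le> a" "a < b" "b \<le> k" using p by (auto simp: pairs_def)
    have ik: "i k < k" "j k < k" using i_less[OF k] j_less[OF k] by auto
    show ?thesis
    proof (cases "b = k")
      case True
      have "texp a b = texp k a" using texp_sym True by simp
      then show ?thesis using ab True k ik texp_step[OF k, of a] texp_cherry[OF k]
        by (auto simp: hexp_def lookup_add lookup_single texp_lookup_low)
    next
      case False
      then have "lookup (texp a b) l = 0" if "l \<le> 2 * (n - k) + 2" for l
        using ab k that by (intro texp_lookup_low[of a k b l]) auto
      then show ?thesis using ab False by (auto simp: hexp_def lookup_add lookup_single)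
    qed
  qed
  have "lookup (vh m) (2 * (n - k) + 1) = (\<Sum>p\<in>keys m. if snd p = k \<and> fst p \<noteq> i k then lookup m p else 0)"
    unfolding lookup_mon_sum
  proof (rule sum.cong[OF refl])
    fix p assume "p \<in> keys m"
    then have "p \<in> pairs k" using m by auto
    from hl[OF this] show "lookup m p * lookup (hexp p) (2 * (n - k) + 1) = (if snd p = k \<and> fst p \<noteq> i k then lookup m p else 0)"
      by simp
  qed
  also have "\<dots> > 0 \<longleftrightarrow> (\<exists>p\<in>keys m. snd p = k \<and> fst p \<noteq> i k)"
    by (auto simp: in_keys_iff neq0_conv[symmetric] simp del: neq0_conv split: if_splits)
  finally show ?thesis by force
qed

text \<open>
  Induction on \<open>k\<close>, and inside on the number of edges at \<open>k\<close>.  A common edge between \<open>k\<close>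
  and \<open>i k\<close> is cancelled; any other edge at \<open>k\<close> is redirected to \<open>i k\<close>, which changes both
  exponents in the same way, and the resulting path is lifted back.
\<close>

lemma moves_of_eq_vh_aux:
  assumes "2 \<le> k" "k \<le> n" "m \<in> monomials k" "m' \<in> monomials k" "vh m = vh m'"
  shows "(move k)\<^sup>*\<^sup>* m m'"
  using assms
proof (induction k arbitrary: m m' rule: dec_induct)
  case base
  have p2: "pairs 2 = {(1, 2)}" by (auto simp: pairs_def)
  have "m = single (1, 2) (total_degree m)" if "m \<in> monomials 2" for m :: "(nat \<times> nat) monomial"
  proof -
    have "m = single (1, 2) (lookup m (1, 2))"
      using that unfolding p2
      by (intro poly_mapping_eqI) (auto simp: lookup_single when_def in_keys_iff subset_iff)
    then show ?thesis by (metis total_degree_single)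
  qed
  then have "m = m'" using base lookup_vh_0 by metis
  then show ?case by simp
next
  case (step k0)
  define k where "k = Suc k0"
  have k: "k \<in> {3..n}" using step by (auto simp: k_def)
  have ik: "i k \<in> {1..<k}" by (rule i_less[OF k])
  have main: "(move k)\<^sup>*\<^sup>* m m'" if "m \<in> monomials k" "m' \<in> monomials k" "vh m = vh m'" for m m'
    using that
  proof (induction "lookup (vh m) (2 * (n - k) + 1) + lookup (vh m) (2 * (n - k) + 2)" arbitrary: m m' rule: less_induct)
    case less
    note m = less.prems(1) and m' = less.prems(2) and eq = less.prems(3)
    show ?case
    proof (cases "lookup (vh m) (2 * (n - k) + 2) > 0")
      case True
      then have "lookup m (i k, k) \<noteq> 0" "lookup m' (i k, k) \<noteq> 0"
        using vh_lookup_cherry[OF k m] vh_lookup_cherry[OF k m'] eq by simp_all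
      then have "(i k, k) \<in> keys m" "(i k, k) \<in> keys m'"
        by (simp_all add: in_keys_iff)
      then obtain m1 m1' where m1: "m = m1 + single (i k, k) 1" "m' = m1' + single (i k, k) 1"
        using single_le_split by meson
      have sub: "m1 \<in> monomials k" "m1' \<in> monomials k" using m m' m1 by (auto simp: keys_add_nat)
      have "vh m1 = vh m1'" using eq unfolding m1 by (simp add: mon_sum_add del: One_nat_def)
      moreover have "lookup (vh m1) (2 * (n - k) + 2) < lookup (vh m) (2 * (n - k) + 2)"
        using vh_lookup_cherry[OF k] sub m unfolding m1 by (simp add: lookup_add)
      moreover have "lookup (vh m1) (2 * (n - k) + 1) \<le> lookup (vh m) (2 * (n - k) + 1)"
        unfolding m1 by (simp add: mon_sum_add lookup_add)
      ultimately have "(move k)\<^sup>*\<^sup>* m1 m1'" using less.hyps[of m1 m1'] sub by simp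
      then show ?thesis unfolding m1
      proof (induction rule: rtranclp_induct)
        case (step M M')
        from step(2) have "move k (M + single (i k, k) 1) (M' + single (i k, k) 1)"
        proof cases
          case (move a b c d m)
          from move.intros[OF move(3,4), of "m + single (i k, k) 1"] show ?thesis
            unfolding move(1,2) by (simp add: ac_simps)
        qed
        then show ?case using step(3) by simp
      qed simp
    next
      case noZ: False
      show ?thesis
      proof (cases "lookup (vh m) (2 * (n - k) + 1) > 0")
        case True
        then obtain a b where ab: "a \<noteq> i k" "(a, k) \<in> keys m" "b \<noteq> i k" "(b, k) \<in> keys m'"
          using vh_lookup_step_pos[OF k] m m' eq by metis
        then obtain m1 m1' where m1: "m = m1 + single (a, k) 1" "m' = m1' + single (b, k) 1"
          using single_le_split by meson
        have lt: "a \<in> {1..<k}" "b \<in> {1..<k}" using ab m m' by (auto simp: pairs_def)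
        have e: "m = m1 + edge a k" "m' = m1' + edge b k" using m1 lt by (auto simp: edge_lt)
        have sub: "m1 \<in> monomials k" "m1' \<in> monomials k" using m m' m1 by (auto simp: keys_add_nat)
        have sub2: "m1 + edge a (i k) \<in> monomials k" "m1' + edge b (i k) \<in> monomials k"
          using sub edge_in_monomials[of a "i k" k] edge_in_monomials[of b "i k" k] ab lt ik
          by (simp_all add: keys_add_nat)
        have v: "vh (m0 + edge c k) = vh (m0 + edge c (i k)) + single (2 * (n - k) + 1) 1"
          if "c \<in> {1..<k}" "c \<noteq> i k" for m0 c
          using texp_step[OF k that] by (simp add: mon_sum_add vh_edge texp_sym[of c] ac_simps)
        have "vh (m1 + edge a (i k)) = vh (m1' + edge b (i k))"
          using eq v[OF lt(1) ab(1)] v[OF lt(2) ab(3)] unfolding e by simp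
        moreover have "lookup (vh m) (2 * (n - k) + 1) = lookup (vh (m1 + edge a (i k))) (2 * (n - k) + 1) + 1"
          "lookup (vh m) (2 * (n - k) + 2) = lookup (vh (m1 + edge a (i k))) (2 * (n - k) + 2)"
          using v[OF lt(1) ab(1), of m1] unfolding e by (simp_all add: lookup_add lookup_single)
        ultimately have "(move k)\<^sup>*\<^sup>* (m1 + edge a (i k)) (m1' + edge b (i k))"
          using less.hyps[of "m1 + edge a (i k)" "m1' + edge b (i k)"] sub2 by simp
        then show ?thesis unfolding e using moves_relabel[OF k lt(1) ab(1) lt(2) ab(3)] by blast
      next
        case False
        (* No edge at k is left, so the hypothesis for the smaller tree applies. *)
        have "M \<in> monomials k0" if M: "M \<in> monomials k" "vh M = vh m" for M
        proof -
          have "(a, k) \<notin> keys M" for a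
            using vh_lookup_step_pos[OF k M(1)] vh_lookup_cherry[OF k M(1)] False noZ M(2)
            by (cases "a = i k") (auto simp: in_keys_iff)
          then show ?thesis using M by (fastforce simp: pairs_def k_def le_Suc_eq)
        qed
        then have "(move k0)\<^sup>*\<^sup>* m m'" using m m' eq step by (intro step.IH) auto
        then show ?thesis using moves_mono[of k0 k] by (simp add: k_def)
      qed
    qed
  qed
  show ?case using main step.prems unfolding k_def by blast
qed

lemma moves_of_eq_vh:
  assumes "2 \<le> n" "m \<in> monomials n" "m' \<in> monomials n" "vh m = vh m'"
  shows "(move n)\<^sup>*\<^sup>* m m'"
  using moves_of_eq_vh_aux[OF assms(1) order_refl] assms by blast

end

section \<open>Pluecker relations\<close>

definition sgn_pair :: "nat \<Rightarrow> nat \<Rightarrow> complex" where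
  "sgn_pair a b = (if a < b then 1 else - 1)"

lemma sgn_pair_nonzero [simp]: "sgn_pair a b \<noteq> 0"
  by (simp add: sgn_pair_def)

lemma sgn_pair_flip: "a \<noteq> b \<Longrightarrow> sgn_pair b a = - sgn_pair a b"
  by (auto simp: sgn_pair_def)

text \<open>
  The coordinate with antisymmetric indices.  It lets the Pluecker relations be stated for four
  leaves in any order, as the quartets require.
\<close>

definition pvar :: "nat \<Rightarrow> nat \<Rightarrow> (nat \<times> nat) mpoly" where
  "pvar a b = single (edge a b) (sgn_pair a b)"

lemma pvar_flip: "a \<noteq> b \<Longrightarrow> pvar b a = - pvar a b"
  by (simp add: pvar_def sgn_pair_flip[of a b] edge_commute[of b a] single_uminus)

lemma pvar_less: "a < b \<Longrightarrow> pvar a b = Var (a, b)"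
  by (simp add: pvar_def sgn_pair_def Var_def edge_lt)

definition plucker_rel :: "nat \<Rightarrow> nat \<Rightarrow> nat \<Rightarrow> nat \<Rightarrow> (nat \<times> nat) mpoly" where
  "plucker_rel a b c d = pvar a b * pvar c d - pvar a c * pvar b d + pvar a d * pvar b c"

lemma plucker_rel_swaps:
  assumes "distinct [a, b, c, d]"
  shows "plucker_rel b a c d = - plucker_rel a b c d"
    and "plucker_rel a c b d = - plucker_rel a b c d"
    and "plucker_rel a b d c = - plucker_rel a b c d"
  using assms pvar_flip[of a b] pvar_flip[of b c] pvar_flip[of c d]
  by (simp_all add: plucker_rel_def algebra_simps)

lemma plucker_generators_carrier:
  "{Var (i, j) * Var (k, l) - Var (i, k) * Var (j, l) + Var (i, l) * Var (j, k) | i j k l.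
     1 \<le> i \<and> i < j \<and> j < k \<and> k < l \<and> l \<le> n} \<subseteq> carrier (pring n)"
proof clarify
  fix a b c d assume "1 \<le> (a::nat)" "a < b" "b < c" "c < d" "d \<le> n"
  then have "Var p \<in> carrier (pring n)" if "p \<in> {(a,b),(c,d),(a,c),(b,d),(a,d),(b,c)}" for p
    using that unfolding Var_def by (intro pring_single) (auto simp: pairs_def)
  then show "Var (a, b) * Var (c, d) - Var (a, c) * Var (b, d) + Var (a, d) * Var (b, c) \<in> carrier (pring n)"
    by (intro pring_add pring_diff pring_mult) auto
qed

lemma ideal_plucker: "ideal (plucker_ideal n) (pring n)"
  unfolding plucker_ideal_def by (rule pring.genideal_ideal) (rule plucker_generators_carrier)

lemma ideal_kernel: "ideal {F \<in> carrier (pring n). poly_subst \<sigma> F = 0} (pring n)"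
  by (rule ideal_pringI) (auto simp: poly_subst_add poly_subst_mult)

lemma plucker_ideal_vanishes:
  assumes \<sigma>: "\<And>a b c d. \<sigma> (a, b) * \<sigma> (c, d) - \<sigma> (a, c) * \<sigma> (b, d) + \<sigma> (a, d) * \<sigma> (b, c) = 0"
    and F: "F \<in> plucker_ideal n"
  shows "poly_subst \<sigma> F = 0"
proof -
  have "plucker_ideal n \<subseteq> {F \<in> carrier (pring n). poly_subst \<sigma> F = 0}"
    unfolding plucker_ideal_def
  proof (rule pring.genideal_minimal[OF ideal_kernel], rule subsetI)
    fix F assume F: "F \<in> {Var (i, j) * Var (k, l) - Var (i, k) * Var (j, l) + Var (i, l) * Var (j, k) | i j k l.
       1 \<le> i \<and> i < j \<and> j < k \<and> k < l \<and> l \<le> n}"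
    then obtain a b c d where "F = Var (a, b) * Var (c, d) - Var (a, c) * Var (b, d) + Var (a, d) * Var (b, c)" by blast
    then have "poly_subst \<sigma> F = 0"
      by (simp add: poly_subst_add poly_subst_minus poly_subst_mult \<sigma>)
    then show "F \<in> {F \<in> carrier (pring n). poly_subst \<sigma> F = 0}"
      using subsetD[OF plucker_generators_carrier F] by simp
  qed
  then show ?thesis using F by blast
qed

text \<open>
  The relation changes its sign under each exchange of neighbouring indices, and sorting the
  indices leads to a generator of the ideal.
\<close>

lemma plucker_rel_in_ideal:
  assumes "distinct [a, b, c, d]" "{a, b, c, d} \<subseteq> {1..n}"
  shows "plucker_rel a b c d \<in> plucker_ideal n"
proof -
  define P where "P a b c d \<longleftrightarrow> (distinct [a, b, c, d] \<and> {a, b, c, d} \<subseteq> {1..n} \<longrightarrow> plucker_rel a b c d \<in> plucker_ideal n)" for a b c d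
  have sorted: "P a b c d" if "a < b" "b < c" "c < d" for a b c d
  proof -
    have "plucker_rel a b c d \<in> plucker_ideal n" if "1 \<le> a" "d \<le> n"
    proof -
      let ?G = "{Var (i, j) * Var (k, l) - Var (i, k) * Var (j, l) + Var (i, l) * Var (j, k) | i j k l.
        1 \<le> i \<and> i < j \<and> j < k \<and> k < l \<and> l \<le> n}"
      have eq: "plucker_rel a b c d = Var (a, b) * Var (c, d) - Var (a, c) * Var (b, d) + Var (a, d) * Var (b, c)"
        using \<open>a < b\<close> \<open>b < c\<close> \<open>c < d\<close> by (simp add: plucker_rel_def pvar_less)
      then have "plucker_rel a b c d \<in> ?G" using that \<open>a < b\<close> \<open>b < c\<close> \<open>c < d\<close> by blast
      moreover have "?G \<subseteq> plucker_ideal n"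
        unfolding plucker_ideal_def by (rule pring.genideal_self) (rule plucker_generators_carrier)
      ultimately show ?thesis by blast
    qed
    then show ?thesis by (auto simp: P_def)
  qed
  have s: "P a b c d \<Longrightarrow> P b a c d" "P a b c d \<Longrightarrow> P a c b d" "P a b c d \<Longrightarrow> P a b d c" for a b c d
    unfolding P_def using plucker_rel_swaps[of a b c d] ideal_pring_uminus[OF ideal_plucker] by auto
  have 1: "P a b c d" if "a < b" "b < c" for a b c d
  proof -
    consider "c < d" | "d < c" "b < d" | "d < b" "a < d" | "d < a" | "d \<in> {a, b, c}" by force
    then show ?thesis
    proof cases
      case 1 then show ?thesis using sorted that by blast
    next
      case 2 then show ?thesis using s(3)[of a b d c] sorted[of a b d c] that by blast
    next
      case 3 then show ?thesis using s(3)[of a b d c] s(2)[of a d b c] sorted[of a d b c] that by blast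
    next
      case 4 then show ?thesis
        using s(3)[of a b d c] s(2)[of a d b c] s(1)[of d a b c] sorted[of d a b c] that by blast
    next
      case 5 then show ?thesis by (auto simp: P_def)
    qed
  qed
  have 2: "P a b c d" if "a < b" for a b c d
  proof -
    consider "b < c" | "c < b" "a < c" | "c < a" | "c \<in> {a, b}" by force
    then show ?thesis
    proof cases
      case b: 1 then show ?thesis using 1 that by blast
    next
      case 2 then show ?thesis using s(2)[of a c b d] 1[of a c b d] that by blast
    next
      case 3 then show ?thesis using s(2)[of a c b d] s(1)[of c a b d] 1[of c a b d] that by blast
    next
      case 4 then show ?thesis by (auto simp: P_def)
    qed
  qed
  have "P a b c d"
  proof (cases a b rule: linorder_cases)
    case less then show ?thesis by (rule 2)
  next
    case equal then show ?thesis by (simp add: P_def)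
  next
    case greater then show ?thesis using s(1)[OF 2[of b a c d]] by blast
  qed
  then show ?thesis using assms by (simp add: P_def)
qed

lemma plucker_rel_expand:
  "plucker_rel a b c d =
    single (edge a b + edge c d) (sgn_pair a b * sgn_pair c d)
    + single (edge a c + edge b d) (- (sgn_pair a c * sgn_pair b d))
    + single (edge a d + edge b c) (sgn_pair a d * sgn_pair b c)"
  by (simp add: plucker_rel_def pvar_def mult_single single_uminus)

lemma edge_sum_cases:
  assumes "edge a b + M = edge x y + edge z w"
  shows "edge a b = edge x y \<or> edge a b = edge z w"
proof -
  have "keys (edge a b) \<subseteq> keys (edge x y + edge z w)"
    unfolding assms[symmetric] keys_add_nat by blast
  then have "keys (edge a b) = keys (edge x y) \<or> keys (edge a b) = keys (edge z w)"
    unfolding keys_add_nat by (auto simp: edge_def)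
  then show ?thesis by (auto simp: edge_def)
qed

lemma matchings_distinct:
  assumes "distinct [a, b, c, d]"
  shows "edge a b + edge c d \<noteq> edge a c + edge b d"
    and "edge a b + edge c d \<noteq> edge a d + edge b c"
    and "edge a c + edge b d \<noteq> edge a d + edge b c"
  using assms edge_sum_cases[of a b "edge c d" a c b d] edge_sum_cases[of a b "edge c d" a d b c]
    edge_sum_cases[of a c "edge b d" a d b c]
  by (auto simp only: edge_eq_iff distinct.simps list.set insert_iff)

lemma finite_pairs [simp]: "finite (pairs n)"
  by (rule finite_subset[of _ "{1..n} \<times> {1..n}"]) (auto simp: pairs_def)

text \<open>
  This is what makes reduction towards larger weights terminate.
\<close>

lemma finite_monomials_degree: "finite {m \<in> monomials n. total_degree m = r}"
proof -
  let ?F = "{f. \<forall>x. (x \<in> pairs n \<longrightarrow> f x \<in> {..r}) \<and> (x \<notin> pairs n \<longrightarrow> f x = (0::nat))}"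
  have "finite ?F" by (rule finite_set_of_finite_funs) auto
  moreover have "lookup ` {m \<in> monomials n. total_degree m = r} \<subseteq> ?F"
  proof (rule image_subsetI)
    fix m :: "(nat \<times> nat) monomial"
    assume m: "m \<in> {m \<in> monomials n. total_degree m = r}"
    have le: "lookup m p \<le> r" for p
    proof (cases "p \<in> keys m")
      case True
      then have "lookup m p \<le> (\<Sum>v\<in>keys m. lookup m v)" by (intro member_le_sum) auto
      then show ?thesis using m by (simp add: total_degree_def)
    qed (simp add: in_keys_iff)
    have "lookup m p = 0" if "p \<notin> pairs n" for p
      using m that in_keys_iff[of p m] by blast
    then show "lookup m \<in> ?F" using le by simp
  qed
  ultimately have "finite (lookup ` {m \<in> monomials n. total_degree m = r})" by (rule finite_subset[rotated])
  moreover have "inj_on lookup {m \<in> monomials n. total_degree m = r}"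
    by (rule inj_onI) (simp only: poly_mapping_eq_iff)
  ultimately show ?thesis by (rule finite_imageD)
qed

section \<open>Initial forms\<close>

lemma lookup_initial_form:
  "lookup (initial_form w F) m =
    (if m \<in> keys F \<and> (\<forall>m'\<in>keys F. monomial_weight w m \<le> monomial_weight w m') then lookup F m else 0)"
proof -
  let ?A = "{m \<in> keys F. \<forall>m'\<in>keys F. monomial_weight w m \<le> monomial_weight w m'}"
  have "lookup (initial_form w F) m = (\<Sum>k\<in>?A. if k = m then lookup F k else 0)"
    by (simp add: initial_form_def lookup_sum lookup_single when_def)
  also have "\<dots> = (if m \<in> ?A then lookup F m else 0)" by (subst sum.delta) auto
  finally show ?thesis by simp
qed

lemma keys_initial_form:
  "keys (initial_form w F) = {m \<in> keys F. \<forall>m'\<in>keys F. monomial_weight w m \<le> monomial_weight w m'}"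
  by (auto simp: in_keys_iff[of _ "initial_form w F"] lookup_initial_form split: if_splits)

lemma initial_form_in_pring: "F \<in> carrier (pring n) \<Longrightarrow> initial_form w F \<in> carrier (pring n)"
  by (auto simp: in_pring_iff keys_initial_form)

lemma ideal_initial_ideal: "I \<subseteq> carrier (pring n) \<Longrightarrow> ideal (initial_ideal n w I) (pring n)"
  unfolding initial_ideal_def by (rule pring.genideal_ideal) (use initial_form_in_pring in blast)

lemma initial_form_in_initial_ideal:
  "I \<subseteq> carrier (pring n) \<Longrightarrow> F \<in> I \<Longrightarrow> initial_form w F \<in> initial_ideal n w I"
  unfolding initial_ideal_def
  using pring.genideal_self[of "initial_form w ` I" n] initial_form_in_pring by blast

lemma initial_ideal_least:
  "ideal J (pring n) \<Longrightarrow> initial_form w ` I \<subseteq> J \<Longrightarrow> initial_ideal n w I \<subseteq> J"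
  unfolding initial_ideal_def by (rule pring.genideal_minimal)

lemma plucker_ideal_carrier: "plucker_ideal n \<subseteq> carrier (pring n)"
  using ideal_pring_carrier[OF ideal_plucker] by blast

definition edge_weight :: "weight \<Rightarrow> nat \<Rightarrow> nat \<Rightarrow> real" where
  "edge_weight w a b = w (min a b, max a b)"

lemma monomial_weight_edge: "monomial_weight w (edge a b) = edge_weight w a b"
  by (simp add: edge_def edge_weight_def monomial_weight_single)

lemma edge_weight_sym: "edge_weight w a b = edge_weight w b a"
  by (simp add: edge_weight_def min.commute max.commute)

section \<open>Reduction to standard monomials\<close>

lemma lookup_Const_times: "lookup (Const c * F) m = c * lookup F m"
proof (induction F rule: poly_mapping_single_induct)
  case (add m' c' G)
  then show ?case by (simp add: distrib_left lookup_add Const_times_single lookup_single when_def)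
qed simp

lemma keys_Const_times: "keys (Const c * F) \<subseteq> keys F"
  by (auto simp: in_keys_iff lookup_Const_times)

lemma ideal_Const_times: "ideal I (pring n) \<Longrightarrow> F \<in> I \<Longrightarrow> Const c * F \<in> I"
  by (rule ideal_pring_mult) auto

lemma sum_single_Const:
  fixes F :: "'v mpoly"
  shows "(\<Sum>m\<in>keys F. Const (lookup F m) * single m 1) = F"
  by (subst (3) poly_mapping_sum_single[of F]) (simp add: Const_times_single)

text \<open>
  What the initial ideals need to know about a labelled tree: antisymmetric values \<open>Q\<close> of the
  coordinates that satisfy the Pluecker relations, their leading exponents \<open>V\<close>, the quartets, a
  weight \<open>W\<close> that is strict on them, and the connectedness of monomials with equal exponents, stated
  as an induction principle.  Relabelling the leaves of an iterated tree leads to further instances.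
\<close>

locale plucker_model = exponent_order lt for lt :: "nat monomial \<Rightarrow> nat monomial \<Rightarrow> bool" +
  fixes n :: nat
    and V :: "nat \<Rightarrow> nat \<Rightarrow> nat monomial"
    and Q :: "nat \<Rightarrow> nat \<Rightarrow> nat mpoly"
    and e :: "nat \<Rightarrow> nat \<Rightarrow> complex"
    and qt :: "nat \<Rightarrow> nat \<Rightarrow> nat \<Rightarrow> nat \<Rightarrow> bool"
    and W :: "nat \<Rightarrow> nat \<Rightarrow> real"
  assumes Q_flip: "Q b a = - Q a b"
    and Q_plucker: "Q a b * Q c d - Q a c * Q b d + Q a d * Q b c = 0"
    and Q_lead: "a \<noteq> b \<Longrightarrow> {a, b} \<subseteq> {1..n} \<Longrightarrow> lead (Q a b) (V a b) (e a b)"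
    and V_sym: "V a b = V b a"
    and V_0: "lookup (V a b) 0 = 0"
    and V_additive: "qt a b c d \<Longrightarrow> V a c + V b d = V a d + V b c"
    and V_strict: "qt a b c d \<Longrightarrow> V a c + V b d \<noteq> V a b + V c d"
    and qt_distinct: "qt a b c d \<Longrightarrow> distinct [a, b, c, d] \<and> {a, b, c, d} \<subseteq> {1..n}"
    and qt_resolves: "distinct [a, b, c, d] \<Longrightarrow> {a, b, c, d} \<subseteq> {1..n} \<Longrightarrow> qt a b c d \<or> qt a c b d \<or> qt a d b c"
    and W_sym: "W a b = W b a"
    and W_additive: "qt a b c d \<Longrightarrow> W a c + W b d = W a d + W b c"
    and W_strict: "qt a b c d \<Longrightarrow> W a c + W b d < W a b + W c d"
    and connected: "\<lbrakk>m \<in> monomials n; m' \<in> monomials n;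
      mon_sum (\<lambda>p. single 0 1 + V (fst p) (snd p)) m = mon_sum (\<lambda>p. single 0 1 + V (fst p) (snd p)) m';
      \<And>\<mu> a b c d. qt a b c d \<Longrightarrow> P (\<mu> + edge b d + edge a c) \<Longrightarrow> P (\<mu> + edge b c + edge a d); P m\<rbrakk> \<Longrightarrow> P m'"
begin

definition hV :: "nat \<times> nat \<Rightarrow> nat monomial" where
  "hV p = single 0 1 + V (fst p) (snd p)"

abbreviation vh :: "(nat \<times> nat) monomial \<Rightarrow> nat monomial" where
  "vh \<equiv> mon_sum hV"

definition eps :: "(nat \<times> nat) monomial \<Rightarrow> complex" where
  "eps = mon_eval (\<lambda>p. e (fst p) (snd p))"

text \<open>
  The factor \<open>Var 0\<close> records the degree, so that one polynomial ring in \<open>x\<^sub>0, \<dots>, x\<^sub>d\<close>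
  serves all degrees at once.
\<close>

definition phi :: "(nat \<times> nat) mpoly \<Rightarrow> nat mpoly" where
  "phi = poly_subst (\<lambda>p. Var 0 * Q (fst p) (snd p))"

definition psi :: "(nat \<times> nat) mpoly \<Rightarrow> nat mpoly" where
  "psi = poly_subst (\<lambda>p. single (hV p) (e (fst p) (snd p)))"

definition J :: "(nat \<times> nat) mpoly set" where
  "J = {F \<in> carrier (pring n). psi F = 0}"

text \<open>
  The weights for which the leading binomial of each Pluecker relation is the one that the
  quartet prescribes.
\<close>

definition open_cone :: "weight set" where
  "open_cone = {w \<in> weights n. \<forall>a b c d. qt a b c d \<longrightarrow>
    edge_weight w a c + edge_weight w b d = edge_weight w a d + edge_weight w b c \<and>
    edge_weight w a c + edge_weight w b d < edge_weight w a b + edge_weight w c d}"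

lemma vh_connected:
  assumes "m \<in> monomials n" "m' \<in> monomials n" "vh m = vh m'"
    and "\<And>\<mu> a b c d. qt a b c d \<Longrightarrow> P (\<mu> + edge b d + edge a c) \<Longrightarrow> P (\<mu> + edge b c + edge a d)"
    and "P m"
  shows "P m'"
  using connected[of m m' P] assms unfolding hV_def[abs_def] by blast

lemma e_nonzero: "a \<noteq> b \<Longrightarrow> {a, b} \<subseteq> {1..n} \<Longrightarrow> e a b \<noteq> 0"
  using Q_lead by (auto simp: lead_def)

lemma e_flip: assumes "a \<noteq> b" "{a, b} \<subseteq> {1..n}" shows "e b a = - e a b"
proof -
  have "lead (Q b a) (V a b) (- e a b)"
    using lead_uminus[OF Q_lead[OF assms]] Q_flip[of b a] by simp
  moreover have "lead (Q b a) (V b a) (e b a)" using Q_lead[of b a] assms by auto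
  ultimately show ?thesis using lead_unique V_sym by metis
qed

lemma eps_add: "eps (m + m') = eps m * eps m'"
  by (simp add: eps_def mon_eval_add)

lemma eps_edge: assumes "a \<noteq> b" "{a, b} \<subseteq> {1..n}" shows "eps (edge a b) = sgn_pair a b * e a b"
  using e_flip[OF assms] assms
  by (auto simp: eps_def edge_def mon_eval_single sgn_pair_def min_def max_def)

lemma eps_nonzero: "m \<in> monomials n \<Longrightarrow> eps m \<noteq> 0"
  using e_nonzero by (auto simp: eps_def mon_eval_def pairs_def)

lemma vh_edge: "vh (edge a b) = single 0 1 + V a b"
  using V_sym[of a b] by (auto simp: edge_def hV_def min_def max_def)

lemma vh_image_closed: "0 \<in> vh ` monomials n" "a \<in> vh ` monomials n \<Longrightarrow> b \<in> vh ` monomials n \<Longrightarrow> a + b \<in> vh ` monomials n"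
proof -
  show "0 \<in> vh ` monomials n" by (rule image_eqI[of _ _ 0]) simp_all
  assume "a \<in> vh ` monomials n" "b \<in> vh ` monomials n"
  then obtain m m' where "a = vh m" "b = vh m'" "m \<in> monomials n" "m' \<in> monomials n" by blast
  then have "a + b = vh (m + m')" "m + m' \<in> monomials n" using monomials_add[of m n m'] by (simp_all add: mon_sum_add)
  then show "a + b \<in> vh ` monomials n" by (rule image_eqI)
qed

lemma lookup_vh_0: "lookup (vh m) 0 = total_degree m"
  by (simp add: lookup_mon_sum total_degree_def hV_def lookup_add V_0)

text \<open>
  The three products of a Pluecker relation sum to zero, so the smallest of their leading
  exponents occurs at least twice and the leading coefficients there cancel.
\<close>

lemma qt_leading:
  assumes q: "qt a b c d"
  shows "lt (V a c + V b d) (V a b + V c d)" "e a c * e b d = e a d * e b c"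
proof -
  have d: "distinct [a, b, c, d]" "{a, b, c, d} \<subseteq> {1..n}" using qt_distinct[OF q] by auto
  let ?X = "Q a b * Q c d" and ?Y = "- (Q a c * Q b d)" and ?Z = "Q a d * Q b c"
  have X: "lead ?X (V a b + V c d) (e a b * e c d)"
    and Y: "lead ?Y (V a c + V b d) (- (e a c * e b d))"
    and Z': "lead ?Z (V a d + V b c) (e a d * e b c)"
    using d by (auto intro!: lead_mult lead_uminus Q_lead)
  have Z: "lead ?Z (V a c + V b d) (e a d * e b c)" using Z' V_additive[OF q] by simp
  have eq: "?X + (?Y + ?Z) = 0" using Q_plucker[of a b c d] by (simp add: algebra_simps)
  have above_if: "above m G" if "lt m k" "lead G k c" for m k G c
    unfolding above_def using that lead_lt lt_trans by metis
  show lt: "lt (V a c + V b d) (V a b + V c d)"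
  proof (rule ccontr)
    assume "\<not> ?thesis"
    then have l: "lt (V a b + V c d) (V a c + V b d)" using V_strict[OF q] lt_total by metis
    have "lead (?X + (?Y + ?Z)) (V a b + V c d) (e a b * e c d)"
      using above_add[OF above_if[OF l Y] above_if[OF l Z]] by (rule lead_add_above[OF X])
    then show False using eq lead_nonzero by metis
  qed
  have "lookup (?X + (?Y + ?Z)) (V a c + V b d) = - (e a c * e b d) + e a d * e b c"
    using above_lookup[OF above_if[OF lt X]] lead_lookup[OF Y] lead_lookup[OF Z]
    by (simp add: lookup_add lookup_minus)
  then show "e a c * e b d = e a d * e b c" unfolding eq by simp
qed

lemma vh_matchings:
  assumes q: "qt a b c d"
  shows "vh (edge a c + edge b d) = vh (edge a d + edge b c)"
    and "vh (edge a b + edge c d) \<noteq> vh (edge a c + edge b d)"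
proof -
  have *: "vh (edge x y + edge z w) = (single 0 1 + single 0 1) + (V x y + V z w)" for x y z w
    by (simp only: mon_sum_add vh_edge ac_simps)
  show "vh (edge a c + edge b d) = vh (edge a d + edge b c)"
    unfolding * V_additive[OF q] ..
  show "vh (edge a b + edge c d) \<noteq> vh (edge a c + edge b d)"
    unfolding * add_left_cancel using V_strict[OF q] by metis
qed

lemma psi_single: "psi (single m c) = single (vh m) (c * eps m)"
  by (simp add: psi_def poly_subst_single mon_eval_single_monomial Const_times_single eps_def)

lemma lookup_psi: "lookup (psi F) \<gamma> = (\<Sum>m\<in>keys F. (lookup F m * eps m) when (vh m = \<gamma>))"
proof -
  have "psi F = psi (\<Sum>m\<in>keys F. single m (lookup F m))" by (simp flip: poly_mapping_sum_single)
  also have "\<dots> = (\<Sum>m\<in>keys F. psi (single m (lookup F m)))" by (simp add: psi_def poly_subst_sum)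
  finally show ?thesis by (simp add: lookup_sum psi_single lookup_single)
qed

lemma ideal_J: "ideal J (pring n)"
  unfolding J_def psi_def by (rule ideal_kernel)

lemma phi_plucker_ideal: assumes "F \<in> plucker_ideal n" shows "phi F = 0"
  unfolding phi_def
proof (rule plucker_ideal_vanishes[OF _ assms])
  fix a b c d
  have "Var 0 * Q a b * (Var 0 * Q c d) - Var 0 * Q a c * (Var 0 * Q b d) + Var 0 * Q a d * (Var 0 * Q b c)
      = Var 0 * Var 0 * (Q a b * Q c d - Q a c * Q b d + Q a d * Q b c)"
    by (simp add: algebra_simps)
  then show "Var 0 * Q (fst (a, b)) (snd (a, b)) * (Var 0 * Q (fst (c, d)) (snd (c, d))) -
      Var 0 * Q (fst (a, c)) (snd (a, c)) * (Var 0 * Q (fst (b, d)) (snd (b, d))) +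
      Var 0 * Q (fst (a, d)) (snd (a, d)) * (Var 0 * Q (fst (b, c)) (snd (b, c))) = 0"
    by (simp add: Q_plucker)
qed

lemma lead_phi_monomial:
  assumes "m \<in> monomials n" "c \<noteq> 0" shows "lead (phi (single m c)) (vh m) (c * eps m)"
proof -
  have var: "lead (Var 0 * Q (fst p) (snd p)) (hV p) (e (fst p) (snd p))" if "p \<in> pairs n" for p
  proof -
    have "lead (Var 0) (single (0::nat) 1) (1::complex)" unfolding Var_def by (rule lead_single) simp
    moreover have "lead (Q (fst p) (snd p)) (V (fst p) (snd p)) (e (fst p) (snd p))"
      using that by (intro Q_lead) (auto simp: pairs_def)
    ultimately show ?thesis using lead_mult by (fastforce simp: hV_def)
  qed
  have "lead (mon_eval (\<lambda>p. Var 0 * Q (fst p) (snd p)) m) (vh m) (eps m)"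
  proof (induction m rule: monomial_induct)
    case zero
    then show ?case using lead_single[of 1 0] by (simp add: eps_def)
  next
    case (add p m')
    then have "p \<in> pairs n" using assms(1) by blast
    from lead_mult[OF var[OF this] add(3)] show ?case
      by (simp add: mon_eval_add mon_eval_single mon_sum_add eps_def)
  qed
  then show ?thesis
    using lead_mult[of "Const c" 0 c] lead_single[OF assms(2)]
    by (simp add: phi_def poly_subst_single Const_def)
qed

text \<open>The choice of a representative in each exponent class is arbitrary.\<close>

definition nf :: "(nat \<times> nat) monomial \<Rightarrow> (nat \<times> nat) monomial" where
  "nf m = (SOME m'. m' \<in> monomials n \<and> vh m' = vh m)"

lemma nf: assumes "m \<in> monomials n" shows "nf m \<in> monomials n" "vh (nf m) = vh m"
  using someI[of "\<lambda>m'. m' \<in> monomials n \<and> vh m' = vh m" m] assms unfolding nf_def by auto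

lemma nf_eq_iff:
  assumes "m \<in> monomials n" "m' \<in> monomials n" shows "nf m = nf m' \<longleftrightarrow> vh m = vh m'"
proof
  assume "nf m = nf m'"
  then have "vh (nf m) = vh (nf m')" by (rule arg_cong)
  then show "vh m = vh m'" unfolding nf(2)[OF assms(1)] nf(2)[OF assms(2)] .
next
  assume "vh m = vh m'"
  then show "nf m = nf m'" by (simp only: nf_def)
qed

definition standard :: "(nat \<times> nat) monomial set" where
  "standard = nf ` monomials n"

lemma standard_monomials: "standard \<subseteq> monomials n"
  using nf by (auto simp: standard_def)

lemma nf_standard: "N \<in> standard \<Longrightarrow> nf N = N"
proof -
  assume "N \<in> standard"
  then obtain m where "m \<in> monomials n" "N = nf m" unfolding standard_def by blast
  then show ?thesis using nf_eq_iff[of "nf m" m] nf[of m] by blast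
qed

text \<open>
  Distinct standard monomials have distinct leading exponents, so the smallest of them survives.
\<close>

lemma standard_independent:
  assumes "keys R \<subseteq> standard" "R \<noteq> 0"
  shows "\<exists>N\<in>keys R. \<exists>c. lead (phi R) (vh N) c"
proof -
  have std: "N \<in> monomials n" if "N \<in> keys R" for N using assms standard_monomials that by blast
  have inj: "vh N = vh N' \<longleftrightarrow> N = N'" if "N \<in> keys R" "N' \<in> keys R" for N N'
  proof -
    have "nf N = N" "nf N' = N'" using nf_standard assms(1) that by blast+
    then show ?thesis using nf_eq_iff[OF std[OF that(1)] std[OF that(2)]] by simp
  qed
  have look: "lookup (psi R) (vh N) = lookup R N * eps N" if "N \<in> keys R" for N
  proof -
    have "lookup (psi R) (vh N) = (\<Sum>m\<in>keys R. if m = N then lookup R m * eps m else 0)"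
      unfolding lookup_psi by (rule sum.cong) (auto simp: when_def inj that)
    then show ?thesis using that by simp
  qed
  have key: "\<exists>N\<in>keys R. \<gamma> = vh N" if "\<gamma> \<in> keys (psi R)" for \<gamma>
  proof (rule ccontr)
    assume "\<not> ?thesis"
    then have "lookup (psi R) \<gamma> = 0" unfolding lookup_psi by (intro sum.neutral) (auto simp: when_def)
    then show False using that by (simp add: in_keys_iff)
  qed
  obtain N1 where N1: "N1 \<in> keys R" using assms(2) by (metis keys_eq_empty ex_in_conv)
  then have "psi R \<noteq> 0" using look[OF N1] eps_nonzero[OF std[OF N1]] by (auto simp: in_keys_iff)
  then obtain \<gamma> c where lead: "lead (psi R) \<gamma> c" using lead_exists by blast
  then obtain N0 where N0: "N0 \<in> keys R" "\<gamma> = vh N0" using key lead_in_keys by blast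
  have less: "lt (vh N0) (vh N)" if "N \<in> keys R" "N \<noteq> N0" for N
  proof -
    have "vh N \<in> keys (psi R)" using look[OF that(1)] eps_nonzero[OF std[OF that(1)]] that by (auto simp: in_keys_iff)
    moreover have "vh N \<noteq> vh N0" using inj that N0 by blast
    ultimately show ?thesis using lead_lt[OF lead] N0 by simp
  qed
  have "phi R = (\<Sum>N\<in>keys R. phi (single N (lookup R N)))"
    by (subst (1) poly_mapping_sum_single) (simp add: phi_def poly_subst_sum)
  also have "\<dots> = phi (single N0 (lookup R N0)) + (\<Sum>N\<in>keys R - {N0}. phi (single N (lookup R N)))"
    using N0 by (simp add: sum.remove)
  finally have "phi R = \<dots>" .
  moreover have "above (vh N0) (\<Sum>N\<in>keys R - {N0}. phi (single N (lookup R N)))"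
  proof (rule above_sum)
    fix N assume N: "N \<in> keys R - {N0}"
    then have "lead (phi (single N (lookup R N))) (vh N) (lookup R N * eps N)"
      using std by (intro lead_phi_monomial) (auto simp: in_keys_iff)
    then show "above (vh N0) (phi (single N (lookup R N)))"
      unfolding above_def using less[of N] N lead_lt lt_trans by blast
  qed
  moreover have "lead (phi (single N0 (lookup R N0))) (vh N0) (lookup R N0 * eps N0)"
    using std N0 by (intro lead_phi_monomial) (auto simp: in_keys_iff)
  ultimately have "lead (phi R) (vh N0) (lookup R N0 * eps N0)" using lead_add_above by simp
  then show ?thesis using N0 by blast
qed

text \<open>
  The rescaling makes the substituted monomial have leading coefficient \<open>1\<close>, so that differences of
  monomials with equal exponents have vanishing leading terms, whatever the signs in the relations.
\<close>

definition unit_mon :: "(nat \<times> nat) monomial \<Rightarrow> (nat \<times> nat) mpoly" where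
  "unit_mon m = single m (1 / eps m)"

text \<open>
  The leading binomial of a Pluecker relation is a multiple of the difference of two rescaled
  monomials; the coefficients match by the second part of \<open>qt_leading\<close>.
\<close>

lemma move_binomial:
  assumes q: "qt a b c d" and \<mu>: "\<mu> \<in> monomials n"
  defines "E \<equiv> e a c * e b d * eps \<mu>"
  shows "single \<mu> (- 1 / E) * (single (edge a c + edge b d) (- (sgn_pair a c * sgn_pair b d)) +
      single (edge a d + edge b c) (sgn_pair a d * sgn_pair b c))
    = unit_mon (\<mu> + edge b d + edge a c) - unit_mon (\<mu> + edge b c + edge a d)"
proof -
  have d: "distinct [a, b, c, d]" "{a, b, c, d} \<subseteq> {1..n}" using qt_distinct[OF q] by auto
  have nz: "e a c \<noteq> 0" "e b d \<noteq> 0" "e a d \<noteq> 0" "e b c \<noteq> 0" "eps \<mu> \<noteq> 0"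
    using d e_nonzero eps_nonzero[OF \<mu>] by auto
  have inv: "x / y = 1 / (x * y)" if "x = 1 \<or> x = - 1" for x y :: complex using that by auto
  have s: "sgn_pair x y = 1 \<or> sgn_pair x y = - 1" for x y by (simp add: sgn_pair_def)
  have "sgn_pair a c * sgn_pair b d / E = 1 / eps (\<mu> + edge b d + edge a c)"
    using d s[of a c] s[of b d] unfolding E_def
    by (subst inv) (auto simp: eps_add eps_edge ac_simps)
  moreover have "sgn_pair a d * sgn_pair b c / E = 1 / eps (\<mu> + edge b c + edge a d)"
    using d s[of a d] s[of b c] qt_leading(2)[OF q] unfolding E_def
    by (subst inv) (auto simp: eps_add eps_edge ac_simps)
  ultimately show ?thesis
    by (simp add: unit_mon_def distrib_left mult_single single_uminus[symmetric] ac_simps)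
qed

lemma move_carrier:
  assumes "\<mu> + edge b d + edge a c \<in> monomials n" "qt a b c d"
  shows "\<mu> \<in> monomials n" "\<mu> + edge b c + edge a d \<in> monomials n" "\<mu> + edge a b + edge c d \<in> monomials n"
proof -
  have d: "distinct [a, b, c, d]" "{a, b, c, d} \<subseteq> {1..n}" using qt_distinct[OF assms(2)] by auto
  have "edge x y \<in> monomials n" if "x \<in> {a, b, c, d}" "y \<in> {a, b, c, d}" "x \<noteq> y" for x y
    using that d by (intro edge_in_monomials) auto
  then show "\<mu> \<in> monomials n" "\<mu> + edge b c + edge a d \<in> monomials n" "\<mu> + edge a b + edge c d \<in> monomials n"
    using assms(1) d by (auto simp: keys_add_nat)
qed

lemma plucker_rel_mod:
  assumes q: "qt a b c d" and m: "\<mu> + edge b d + edge a c \<in> monomials n"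
  shows "\<exists>\<kappa>. unit_mon (\<mu> + edge b d + edge a c) - unit_mon (\<mu> + edge b c + edge a d)
    - single (\<mu> + edge a b + edge c d) \<kappa> \<in> plucker_ideal n"
proof -
  define E where "E = e a c * e b d * eps \<mu>"
  have "single \<mu> (- 1 / E) * plucker_rel a b c d \<in> plucker_ideal n"
    using plucker_rel_in_ideal qt_distinct[OF q] move_carrier[OF m q]
    by (intro ideal_pring_mult[OF ideal_plucker] pring_single) auto
  also have "single \<mu> (- 1 / E) * plucker_rel a b c d =
    unit_mon (\<mu> + edge b d + edge a c) - unit_mon (\<mu> + edge b c + edge a d)
    - single (\<mu> + edge a b + edge c d) (sgn_pair a b * sgn_pair c d / E)"
    unfolding move_binomial[OF q move_carrier(1)[OF m q], folded E_def, symmetric] plucker_rel_expand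
    by (simp add: distrib_left mult_single single_uminus algebra_simps)
  finally show ?thesis by blast
qed

context
  fixes w assumes w: "w \<in> open_cone"
begin

text \<open>
  Each move costs one monomial of strictly larger weight, coming from the third term of the
  Pluecker relation, while the weight of the moved monomial does not change.
\<close>

lemma path_reduction:
  assumes m: "m \<in> monomials n" "m' \<in> monomials n" "vh m = vh m'"
  shows "m' \<in> monomials n \<and> total_degree m' = total_degree m \<and> monomial_weight w m' = monomial_weight w m \<and>
    (\<exists>H. unit_mon m - unit_mon m' - H \<in> plucker_ideal n \<and>
      keys H \<subseteq> {k \<in> monomials n. total_degree k = total_degree m \<and> monomial_weight w m < monomial_weight w k})"
    (is "?P m'")
proof (rule vh_connected[OF m, where P = ?P])
  fix \<mu> a b c d assume q: "qt a b c d" and P: "?P (\<mu> + edge b d + edge a c)"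
  let ?m1 = "\<mu> + edge b d + edge a c" and ?m2 = "\<mu> + edge b c + edge a d" and ?m3 = "\<mu> + edge a b + edge c d"
  note mc = move_carrier[OF _ q, of \<mu>]
  from P obtain H where H: "unit_mon m - unit_mon ?m1 - H \<in> plucker_ideal n"
    "keys H \<subseteq> {k \<in> monomials n. total_degree k = total_degree m \<and> monomial_weight w m < monomial_weight w k}" by blast
  obtain \<kappa> where k: "unit_mon ?m1 - unit_mon ?m2 - single ?m3 \<kappa> \<in> plucker_ideal n"
    using plucker_rel_mod[OF q] P by blast
  have wt: "edge_weight w a c + edge_weight w b d = edge_weight w a d + edge_weight w b c"
    "edge_weight w a c + edge_weight w b d < edge_weight w a b + edge_weight w c d"
    using w q by (auto simp: open_cone_def)
  have deg: "total_degree ?m2 = total_degree ?m1" "total_degree ?m3 = total_degree ?m1"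
    by (auto simp: total_degree_add edge_def)
  have "unit_mon m - unit_mon ?m2 - (H + single ?m3 \<kappa>) \<in> plucker_ideal n"
    using ideal_pring_add[OF ideal_plucker H(1) k] by (simp add: algebra_simps)
  moreover have "keys (H + single ?m3 \<kappa>) \<subseteq>
      {k \<in> monomials n. total_degree k = total_degree m \<and> monomial_weight w m < monomial_weight w k}"
  proof -
    have "monomial_weight w m < monomial_weight w ?m3"
      using P wt by (simp add: monomial_weight_add monomial_weight_edge)
    then have "?m3 \<in> {k \<in> monomials n. total_degree k = total_degree m \<and> monomial_weight w m < monomial_weight w k}"
      using mc P deg by simp
    moreover have "keys (H + single ?m3 \<kappa>) \<subseteq> keys H \<union> {?m3}"
      using Poly_Mapping.keys_add[of H "single ?m3 \<kappa>"] by (auto split: if_splits)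
    ultimately show ?thesis using H(2) by blast
  qed
  moreover have "monomial_weight w ?m2 = monomial_weight w ?m1"
    using wt by (simp add: monomial_weight_add monomial_weight_edge)
  moreover have "?m2 \<in> monomials n" "total_degree ?m1 = total_degree m" "monomial_weight w ?m1 = monomial_weight w m"
    using P mc(2) by blast+
  ultimately show "?P ?m2" using deg(1) by (simp only:) blast
next
  show "?P m" using m ideal_pring_0[OF ideal_plucker] by (auto intro!: exI[of _ 0])
qed

lemma nf_weight: "m \<in> monomials n \<Longrightarrow> monomial_weight w (nf m) = monomial_weight w m"
  using path_reduction[of m "nf m"] nf[of m] by simp

lemma standard_reduction:
  assumes "m \<in> monomials n"
  shows "\<exists>R. unit_mon m - unit_mon (nf m) - R \<in> plucker_ideal n \<and>
    keys R \<subseteq> {N \<in> standard. monomial_weight w m < monomial_weight w N}"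
  using assms
proof (induction "card {k \<in> monomials n. total_degree k = total_degree m \<and> monomial_weight w m < monomial_weight w k}"
    arbitrary: m rule: less_induct)
  case less
  let ?D = "\<lambda>m. {k \<in> monomials n. total_degree k = total_degree m \<and> monomial_weight w m < monomial_weight w k}"
  obtain H where H: "unit_mon m - unit_mon (nf m) - H \<in> plucker_ideal n" "keys H \<subseteq> ?D m"
    using path_reduction[OF less.prems nf(1)[OF less.prems]] nf(2)[OF less.prems] by auto
  have "\<exists>R. unit_mon k - unit_mon (nf k) - R \<in> plucker_ideal n \<and>
    keys R \<subseteq> {N \<in> standard. monomial_weight w k < monomial_weight w N}" if "k \<in> keys H" for k
  proof (rule less.hyps)
    have k: "k \<in> ?D m" using that H by blast
    then have "?D k \<subset> ?D m" by auto
    moreover have "finite (?D m)"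
      by (rule finite_subset[OF _ finite_monomials_degree[of n "total_degree m"]]) auto
    ultimately show "card (?D k) < card (?D m)" by (rule psubset_card_mono[rotated])
    show "k \<in> monomials n" using k by simp
  qed
  then have "\<forall>k\<in>keys H. \<exists>R. unit_mon k - unit_mon (nf k) - R \<in> plucker_ideal n \<and>
    keys R \<subseteq> {N \<in> standard. monomial_weight w k < monomial_weight w N}" by blast
  from bchoice[OF this] obtain R where
    R: "\<And>k. k \<in> keys H \<Longrightarrow> unit_mon k - unit_mon (nf k) - R k \<in> plucker_ideal n"
      "\<And>k. k \<in> keys H \<Longrightarrow> keys (R k) \<subseteq> {N \<in> standard. monomial_weight w k < monomial_weight w N}"
    by blast
  define c :: "(nat \<times> nat) monomial \<Rightarrow> (nat \<times> nat) mpoly"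
    where "c k = Const (lookup H k * eps k)" for k
  define T where "T = (\<Sum>k\<in>keys H. c k * (unit_mon (nf k) + R k))"
  have Heq: "H = (\<Sum>k\<in>keys H. c k * unit_mon k)"
  proof -
    have "c k * unit_mon k = single k (lookup H k)" if "k \<in> keys H" for k
      using eps_nonzero[of k] that H(2) by (auto simp: c_def unit_mon_def Const_times_single)
    then show ?thesis using poly_mapping_sum_single[of H] by simp
  qed
  have "H - T = (\<Sum>k\<in>keys H. c k * (unit_mon k - unit_mon (nf k) - R k))"
    by (subst (1) Heq) (simp add: T_def sum_subtractf[symmetric] algebra_simps)
  also have "\<dots> \<in> plucker_ideal n"
    unfolding c_def using R(1) by (intro ideal_pring_sum[OF ideal_plucker] ideal_Const_times[OF ideal_plucker])
  finally have HT: "H - T \<in> plucker_ideal n" .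
  have "unit_mon m - unit_mon (nf m) - T \<in> plucker_ideal n"
    using ideal_pring_add[OF ideal_plucker H(1) HT] by (simp add: algebra_simps)
  moreover have "keys T \<subseteq> {N \<in> standard. monomial_weight w m < monomial_weight w N}"
  proof -
    have "keys (c k * (unit_mon (nf k) + R k)) \<subseteq> {N \<in> standard. monomial_weight w m < monomial_weight w N}"
      if k: "k \<in> keys H" for k
    proof -
      have kD: "k \<in> ?D m" using k H by blast
      have "keys (c k * (unit_mon (nf k) + R k)) \<subseteq> insert (nf k) (keys (R k))"
        using keys_Const_times[of "lookup H k * eps k" "unit_mon (nf k) + R k"] Poly_Mapping.keys_add[of "unit_mon (nf k)" "R k"]
        by (auto simp: unit_mon_def c_def split: if_splits)
      moreover have "nf k \<in> standard" "monomial_weight w (nf k) = monomial_weight w k"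
        using kD nf_weight[of k] by (auto simp: standard_def)
      ultimately show ?thesis using R(2)[OF k] kD by fastforce
    qed
    then show ?thesis unfolding T_def using Poly_Mapping.keys_sum[of "\<lambda>k. c k * (unit_mon (nf k) + R k)" "keys H"] by blast
  qed
  ultimately show ?case by blast
qed

end

lemma tree_in_open_cone: "(\<lambda>p. if p \<in> pairs n then W (fst p) (snd p) else 0) \<in> open_cone"
proof -
  have "edge_weight (\<lambda>p. if p \<in> pairs n then W (fst p) (snd p) else 0) a b = W a b"
    if "a \<noteq> b" "{a, b} \<subseteq> {1..n}" for a b
    using that W_sym[of a b] by (auto simp: edge_weight_def pairs_def min_def max_def)
  then show ?thesis
    using qt_distinct W_additive W_strict by (auto simp: open_cone_def weights_def)
qed

end

section \<open>Weight components of initial ideals\<close>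

definition weight_part :: "weight \<Rightarrow> real \<Rightarrow> (nat \<times> nat) mpoly \<Rightarrow> (nat \<times> nat) mpoly" where
  "weight_part w \<mu> F = (\<Sum>m\<in>{m \<in> keys F. monomial_weight w m = \<mu>}. single m (lookup F m))"

lemma lookup_weight_part: "lookup (weight_part w \<mu> F) m = (if monomial_weight w m = \<mu> then lookup F m else 0)"
proof -
  let ?A = "{m \<in> keys F. monomial_weight w m = \<mu>}"
  have "lookup (weight_part w \<mu> F) m = (\<Sum>k\<in>?A. if k = m then lookup F k else 0)"
    by (simp add: weight_part_def lookup_sum lookup_single when_def)
  also have "\<dots> = (if m \<in> ?A then lookup F m else 0)" by (subst sum.delta) auto
  finally show ?thesis by (simp add: in_keys_iff)
qed

lemma weight_part_add: "weight_part w \<mu> (F + G) = weight_part w \<mu> F + weight_part w \<mu> G"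
  by (rule poly_mapping_eqI) (simp add: lookup_weight_part lookup_add)

lemma weight_part_0 [simp]: "weight_part w \<mu> 0 = 0"
  by (simp add: weight_part_def)

lemma weight_part_single: "weight_part w \<mu> (single m c) = (if monomial_weight w m = \<mu> then single m c else 0)"
  by (rule poly_mapping_eqI) (simp add: lookup_weight_part lookup_single when_def)

lemma weight_part_mult_single:
  "weight_part w \<mu> (single k c * F) = single k c * weight_part w (\<mu> - monomial_weight w k) F"
proof (induction F rule: poly_mapping_single_induct)
  case zero
  then show ?case by simp
next
  case (add m d G)
  have "weight_part w \<mu> (single k c * single m d) = single k c * weight_part w (\<mu> - monomial_weight w k) (single m d)"
    by (auto simp: mult_single weight_part_single monomial_weight_add)
  then show ?case using add by (simp only: distrib_left weight_part_add)
qed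

lemma weight_part_initial_form: "weight_part w \<mu> (initial_form w F) \<in> {0, initial_form w F}"
proof (cases "\<exists>m\<in>keys (initial_form w F). monomial_weight w m = \<mu>")
  case True
  then obtain m where m: "m \<in> keys (initial_form w F)" "monomial_weight w m = \<mu>" by blast
  have "monomial_weight w k = \<mu>" if "k \<in> keys (initial_form w F)" for k
    using m that unfolding keys_initial_form by (auto intro: order_antisym)
  then have "weight_part w \<mu> (initial_form w F) = initial_form w F"
    by (intro poly_mapping_eqI) (metis lookup_weight_part in_keys_iff)
  then show ?thesis by simp
next
  case False
  then have "{m \<in> keys (initial_form w F). monomial_weight w m = \<mu>} = {}" by blast
  then have "weight_part w \<mu> (initial_form w F) = 0" unfolding weight_part_def by (simp only: sum.empty)
  then show ?thesis by simp
qed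

text \<open>
  An ideal generated by forms that are homogeneous for a weight contains the weight components
  of its elements.
\<close>

lemma weight_part_initial_ideal:
  assumes I: "I \<subseteq> carrier (pring n)" and F: "F \<in> initial_ideal n w I"
  shows "weight_part w \<mu> F \<in> initial_ideal n w I"
proof -
  let ?K = "initial_ideal n w I"
  let ?K' = "{F \<in> ?K. \<forall>\<mu>. weight_part w \<mu> F \<in> ?K}"
  have K: "ideal ?K (pring n)" by (rule ideal_initial_ideal[OF I])
  have sing: "single m c * F \<in> ?K'" if "F \<in> ?K'" "m \<in> monomials n" for m c F
    using that ideal_pring_mult[OF K] pring_single[of m n c] by (auto simp: weight_part_mult_single)
  have add: "F + G \<in> ?K'" if "F \<in> ?K'" "G \<in> ?K'" for F G
    using that ideal_pring_add[OF K] by (auto simp: weight_part_add)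
  have zero: "0 \<in> ?K'" using ideal_pring_0[OF K] by simp
  have "ideal ?K' (pring n)"
  proof (rule ideal_pringI)
    show "?K' \<subseteq> carrier (pring n)" using ideal_pring_carrier[OF K] by blast
    fix F G assume F: "F \<in> ?K'" and G: "G \<in> carrier (pring n)"
    show "G * F \<in> ?K'"
    proof (induction G rule: poly_mapping_single_induct)
      case zero
      show ?case using \<open>0 \<in> ?K'\<close> by simp
    next
      case (add m c H)
      have "m \<in> monomials n" using add(1) G unfolding in_pring_iff by blast
      then show ?case unfolding distrib_right using sing[OF F] add(2) \<open>\<And>F G. F \<in> ?K' \<Longrightarrow> G \<in> ?K' \<Longrightarrow> F + G \<in> ?K'\<close> by blast
    qed
  qed (use zero add in blast)+
  moreover have "initial_form w ` I \<subseteq> ?K'"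
  proof (rule image_subsetI)
    fix F assume "F \<in> I"
    then have "initial_form w F \<in> ?K" using initial_form_in_initial_ideal[OF I] by blast
    moreover have "weight_part w \<mu> (initial_form w F) \<in> ?K" for \<mu>
      using weight_part_initial_form[of w \<mu> F] ideal_pring_0[OF K] calculation by (elim insertE) simp_all
    ultimately show "initial_form w F \<in> ?K'" by blast
  qed
  ultimately show ?thesis using initial_ideal_least F by blast
qed

text \<open>
  The criterion by which monomials are found in initial ideals.
\<close>

lemma isolated_monomial:
  assumes I: "I \<subseteq> carrier (pring n)" and F: "F \<in> initial_ideal n w I"
    and m: "m \<in> keys F" and iso: "\<And>k. k \<in> keys F \<Longrightarrow> monomial_weight w k = monomial_weight w m \<Longrightarrow> k = m"
  shows "single m 1 \<in> initial_ideal n w I"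
proof -
  have "weight_part w (monomial_weight w m) F = single m (lookup F m)"
    using iso by (intro poly_mapping_eqI) (auto simp: lookup_weight_part lookup_single when_def in_keys_iff)
  then have "single m (lookup F m) \<in> initial_ideal n w I" using weight_part_initial_ideal[OF I F] by metis
  from ideal_Const_times[OF ideal_initial_ideal[OF I] this, of "1 / lookup F m"] show ?thesis
    using m by (simp add: Const_times_single in_keys_iff)
qed

section \<open>Initial ideals of strict weights are toric\<close>

lemma keys_plucker_rel:
  assumes "distinct [a, b, c, d]"
  shows "keys (plucker_rel a b c d) = {edge a b + edge c d, edge a c + edge b d, edge a d + edge b c}"
  using matchings_distinct[OF assms] unfolding plucker_rel_expand
  by (auto simp: in_keys_iff lookup_add lookup_single when_def split: if_splits)

context plucker_model
begin

lemma reduction: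
  assumes "F \<in> carrier (pring n)"
  shows "\<exists>R. keys R \<subseteq> standard \<and> F - R \<in> plucker_ideal n"
proof (induction F rule: poly_mapping_single_induct)
  case zero
  then show ?case using ideal_pring_0[OF ideal_plucker] by (auto intro!: exI[of _ 0])
next
  case (add m c G)
  have m: "m \<in> monomials n" using add(1) assms unfolding in_pring_iff by blast
  obtain R where R: "keys R \<subseteq> standard" "G - R \<in> plucker_ideal n" using add by blast
  obtain T where T: "unit_mon m - unit_mon (nf m) - T \<in> plucker_ideal n" "keys T \<subseteq> standard"
    using standard_reduction[OF tree_in_open_cone m] by blast
  let ?c = "Const (c * eps m)"
  have "single m c = ?c * unit_mon m"
    using eps_nonzero[OF m] by (simp add: unit_mon_def Const_times_single)
  then have "single m c + G - (?c * (unit_mon (nf m) + T) + R)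
      = ?c * (unit_mon m - unit_mon (nf m) - T) + (G - R)"
    by (simp add: algebra_simps)
  also have "\<dots> \<in> plucker_ideal n"
    by (intro ideal_pring_add[OF ideal_plucker] ideal_Const_times[OF ideal_plucker] T R)
  finally have "single m c + G - (?c * (unit_mon (nf m) + T) + R) \<in> plucker_ideal n" .
  moreover have "keys (?c * (unit_mon (nf m) + T) + R) \<subseteq> standard"
  proof -
    have "keys (unit_mon (nf m) + T) \<subseteq> standard"
      using Poly_Mapping.keys_add[of "unit_mon (nf m)" T] T m by (auto simp: unit_mon_def standard_def split: if_splits)
    then show ?thesis
      using Poly_Mapping.keys_add[of "?c * (unit_mon (nf m) + T)" R] keys_Const_times[of "c * eps m" "unit_mon (nf m) + T"] R
      by blast
  qed
  ultimately show ?case by blast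
qed

lemma lead_phi:
  assumes "F \<in> carrier (pring n)" "F \<notin> plucker_ideal n"
  shows "\<exists>m\<in>monomials n. \<exists>c. lead (phi F) (vh m) c"
proof -
  obtain R where R: "keys R \<subseteq> standard" "F - R \<in> plucker_ideal n" using reduction[OF assms(1)] by blast
  then have "R \<noteq> 0" using assms(2) by auto
  moreover have "phi F = phi R"
    using phi_plucker_ideal[OF R(2)] by (simp add: phi_def poly_subst_minus)
  ultimately show ?thesis using standard_independent[OF R(1)] R(1) standard_monomials by fastforce
qed

lemma plucker_ideal_iff: "F \<in> carrier (pring n) \<Longrightarrow> F \<in> plucker_ideal n \<longleftrightarrow> phi F = 0"
  using lead_phi[of F] phi_plucker_ideal[of F] lead_nonzero by blast

text \<open>
  An element of the Pluecker ideal reduces to zero.  Its minimal weight part reduces to standard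
  monomials of the same weight, and everything else to standard monomials of larger weight; so the
  coefficients of the minimal part have to cancel within each exponent, and that is membership in \<open>J\<close>.
\<close>

lemma initial_form_in_J:
  assumes w: "w \<in> open_cone" and F: "F \<in> plucker_ideal n"
  shows "initial_form w F \<in> J"
proof -
  have Fc: "F \<in> carrier (pring n)" using F plucker_ideal_carrier by blast
  have km: "m \<in> monomials n" if "m \<in> keys F" for m using Fc that unfolding in_pring_iff by blast
  have "\<forall>m\<in>keys F. \<exists>R. unit_mon m - unit_mon (nf m) - R \<in> plucker_ideal n \<and>
    keys R \<subseteq> {N \<in> standard. monomial_weight w m < monomial_weight w N}"
    using standard_reduction[OF w] km by blast
  from bchoice[OF this] obtain R where
    R: "\<And>m. m \<in> keys F \<Longrightarrow> unit_mon m - unit_mon (nf m) - R m \<in> plucker_ideal n"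
      "\<And>m. m \<in> keys F \<Longrightarrow> keys (R m) \<subseteq> {N \<in> standard. monomial_weight w m < monomial_weight w N}"
    by blast
  define c where "c m = lookup F m * eps m" for m
  define T where "T = (\<Sum>m\<in>keys F. Const (c m) * (unit_mon (nf m) + R m))"
  have Feq: "F = (\<Sum>m\<in>keys F. Const (c m) * unit_mon m)"
  proof -
    have "Const (c m) * unit_mon m = single m (lookup F m)" if "m \<in> keys F" for m
      using eps_nonzero[OF km[OF that]] by (simp add: c_def unit_mon_def Const_times_single)
    then show ?thesis using poly_mapping_sum_single[of F] by simp
  qed
  have "F - T = (\<Sum>m\<in>keys F. Const (c m) * (unit_mon m - unit_mon (nf m) - R m))"
    by (subst (1) Feq) (simp add: T_def sum_subtractf[symmetric] algebra_simps)
  also have "\<dots> \<in> plucker_ideal n"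
    using R(1) by (intro ideal_pring_sum[OF ideal_plucker] ideal_Const_times[OF ideal_plucker])
  finally have "F - (F - T) \<in> plucker_ideal n" using ideal_pring_diff[OF ideal_plucker F] by blast
  then have TI: "T \<in> plucker_ideal n" by simp
  have "keys T \<subseteq> standard"
  proof -
    have "keys (Const (c m) * (unit_mon (nf m) + R m)) \<subseteq> standard" if "m \<in> keys F" for m
    proof -
      have "nf m \<in> standard" using km[OF that] by (simp add: standard_def)
      then have "keys (unit_mon (nf m) + R m) \<subseteq> standard"
        using Poly_Mapping.keys_add[of "unit_mon (nf m)" "R m"] R(2)[OF that] by (auto simp: unit_mon_def split: if_splits)
      then show ?thesis using keys_Const_times by blast
    qed
    then show ?thesis unfolding T_def
      using Poly_Mapping.keys_sum[of "\<lambda>m. Const (c m) * (unit_mon (nf m) + R m)" "keys F"] by blast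
  qed
  then have T0: "T = 0" using standard_independent[of T] phi_plucker_ideal[OF TI] lead_nonzero by blast
  have "lookup (psi (initial_form w F)) \<gamma> = 0" for \<gamma>
  proof (cases "\<exists>m\<in>keys (initial_form w F). vh m = \<gamma>")
    case False
    then show ?thesis unfolding lookup_psi by (intro sum.neutral) (auto simp: when_def)
  next
    case True
    then obtain m0 where m0: "m0 \<in> keys F" "\<And>m. m \<in> keys F \<Longrightarrow> monomial_weight w m0 \<le> monomial_weight w m"
      "vh m0 = \<gamma>" by (auto simp: keys_initial_form)
    let ?N = "nf m0"
    have wN: "monomial_weight w ?N = monomial_weight w m0" using nf_weight[OF w km[OF m0(1)]] .
    have same: "nf m = ?N \<longleftrightarrow> vh m = \<gamma>" if "m \<in> keys F" for m
      using nf_eq_iff[OF km[OF that] km[OF m0(1)]] m0(3) by simp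
    have wt: "monomial_weight w m = monomial_weight w m0" if "m \<in> keys F" "vh m = \<gamma>" for m
      using nf_weight[OF w km[OF that(1)]] same[OF that(1)] that(2) wN by simp
    have "lookup (Const (c m) * (unit_mon (nf m) + R m)) ?N = (if vh m = \<gamma> then c m / eps ?N else 0)"
      if m: "m \<in> keys F" for m
    proof -
      (* The remainders have strictly larger weight than the standard monomial N in question. *)
      have "?N \<notin> keys (R m)" using R(2)[OF m] m0(2)[OF m] wN by auto
      then show ?thesis using same[OF m]
        by (auto simp: lookup_Const_times lookup_add unit_mon_def lookup_single when_def in_keys_iff)
    qed
    then have "lookup T ?N = (\<Sum>m\<in>keys F. if vh m = \<gamma> then c m / eps ?N else 0)"
      by (simp add: T_def lookup_sum)
    also have "\<dots> = (\<Sum>m\<in>keys F. if vh m = \<gamma> then c m else 0) / eps ?N"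
      by (simp add: sum_divide_distrib if_distrib[of "\<lambda>x. x / eps ?N"] cong: if_cong)
    finally have "(\<Sum>m\<in>keys F. if vh m = \<gamma> then c m else 0) = 0"
      using T0 eps_nonzero[OF nf(1)[OF km[OF m0(1)]]] by simp
    moreover have "(\<Sum>m\<in>keys F. if vh m = \<gamma> then c m else 0) = lookup (psi (initial_form w F)) \<gamma>"
      unfolding lookup_psi
    proof (rule sum.mono_neutral_cong_right)
      show "keys (initial_form w F) \<subseteq> keys F" by (auto simp: keys_initial_form)
      show "\<forall>m\<in>keys F - keys (initial_form w F). (if vh m = \<gamma> then c m else 0) = 0"
      proof
        fix m assume m: "m \<in> keys F - keys (initial_form w F)"
        have "vh m \<noteq> \<gamma>"
        proof
          assume "vh m = \<gamma>"
          then have "m \<in> keys (initial_form w F)" using wt[of m] m m0(2) by (auto simp: keys_initial_form)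
          then show False using m by blast
        qed
        then show "(if vh m = \<gamma> then c m else 0) = 0" by simp
      qed
      show "(if vh m = \<gamma> then c m else 0) = (lookup (initial_form w F) m * eps m when vh m = \<gamma>)"
        if "m \<in> keys (initial_form w F)" for m
        using that by (auto simp: when_def c_def lookup_initial_form keys_initial_form)
    qed simp
    ultimately show ?thesis by simp
  qed
  then have "psi (initial_form w F) = 0" by (intro poly_mapping_eqI) simp
  then show ?thesis using initial_form_in_pring[OF Fc] by (simp add: J_def)
qed

lemma initial_form_plucker_rel:
  assumes w: "w \<in> open_cone" and q: "qt a b c d"
  shows "initial_form w (plucker_rel a b c d) =
    single (edge a c + edge b d) (- (sgn_pair a c * sgn_pair b d)) +
    single (edge a d + edge b c) (sgn_pair a d * sgn_pair b c)"
proof -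
  note md = matchings_distinct[of a b c d]
  have d: "distinct [a, b, c, d]" using qt_distinct[OF q] by auto
  have wt: "edge_weight w a c + edge_weight w b d = edge_weight w a d + edge_weight w b c"
    "edge_weight w a c + edge_weight w b d < edge_weight w a b + edge_weight w c d"
    using w q by (auto simp: open_cone_def)
  note keys = keys_plucker_rel[OF d]
  show ?thesis
    using md[OF d] wt
    by (intro poly_mapping_eqI, unfold lookup_initial_form keys)
       (auto simp: plucker_rel_expand lookup_add lookup_single when_def monomial_weight_add monomial_weight_edge)
qed

text \<open>
  For the second inclusion, an element of \<open>J\<close> is a combination of differences of rescaled
  monomials with equal exponents, and along a path of moves each such difference is a sum of
  multiples of initial forms of Pluecker relations.
\<close>

lemma initial_ideal_eq_J:
  assumes w: "w \<in> open_cone"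
  shows "initial_ideal n w (plucker_ideal n) = J"
proof
  show "initial_ideal n w (plucker_ideal n) \<subseteq> J"
    using initial_form_in_J[OF w] by (intro initial_ideal_least[OF ideal_J]) blast
next
  let ?K = "initial_ideal n w (plucker_ideal n)"
  have K: "ideal ?K (pring n)" by (rule ideal_initial_ideal[OF plucker_ideal_carrier])
  show "J \<subseteq> ?K"
  proof
    fix F assume F: "F \<in> J"
    then have Fc: "F \<in> carrier (pring n)" and psi: "psi F = 0" by (auto simp: J_def)
    have km: "m \<in> monomials n" if "m \<in> keys F" for m using Fc that unfolding in_pring_iff by blast
    have diff: "unit_mon m - unit_mon m' \<in> ?K" if m: "m \<in> monomials n" "m' \<in> monomials n" "vh m = vh m'" for m m'
    proof -
      have "m' \<in> monomials n \<and> unit_mon m - unit_mon m' \<in> ?K"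
      proof (rule vh_connected[OF m, where P = "\<lambda>m'. m' \<in> monomials n \<and> unit_mon m - unit_mon m' \<in> ?K"])
        fix \<mu> a b c d
        assume q: "qt a b c d" and IH: "\<mu> + edge b d + edge a c \<in> monomials n \<and> unit_mon m - unit_mon (\<mu> + edge b d + edge a c) \<in> ?K"
        note mc = move_carrier[OF IH[THEN conjunct1] q]
        have "initial_form w (plucker_rel a b c d) \<in> ?K"
          using plucker_rel_in_ideal qt_distinct[OF q] by (intro initial_form_in_initial_ideal plucker_ideal_carrier) auto
        then have "unit_mon (\<mu> + edge b d + edge a c) - unit_mon (\<mu> + edge b c + edge a d) \<in> ?K"
          unfolding move_binomial[OF q mc(1), symmetric] initial_form_plucker_rel[OF w q, symmetric]
          by (rule ideal_pring_mult[OF K _ pring_single[OF mc(1)]])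
        from ideal_pring_add[OF K IH[THEN conjunct2] this]
        show "\<mu> + edge b c + edge a d \<in> monomials n \<and> unit_mon m - unit_mon (\<mu> + edge b c + edge a d) \<in> ?K"
          using mc(2) by simp
      next
        show "m \<in> monomials n \<and> unit_mon m - unit_mon m \<in> ?K" using m ideal_pring_0[OF K] by simp
      qed
      then show ?thesis by blast
    qed
    define c where "c m = lookup F m * eps m" for m
    have cm: "Const (c m) * unit_mon m = single m (lookup F m)" if "m \<in> keys F" for m
      using eps_nonzero[OF km[OF that]] by (simp add: c_def unit_mon_def Const_times_single)
    have zero: "(\<Sum>m\<in>keys F. Const (c m) * unit_mon (nf m)) = 0"
    proof (rule poly_mapping_eqI)
      fix N
      have *: "lookup (\<Sum>m\<in>keys F. Const (c m) * unit_mon (nf m)) N = (\<Sum>m\<in>keys F. if nf m = N then c m / eps N else 0)"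
        unfolding lookup_sum by (rule sum.cong) (auto simp: unit_mon_def lookup_Const_times lookup_single when_def)
      show "lookup (\<Sum>m\<in>keys F. Const (c m) * unit_mon (nf m)) N = lookup 0 N"
      proof (cases "\<exists>m0\<in>keys F. nf m0 = N")
        case False
        then show ?thesis unfolding * by (simp add: sum.neutral)
      next
        case True
        then obtain m0 where m0: "m0 \<in> keys F" "nf m0 = N" by blast
        have "(\<Sum>m\<in>keys F. if nf m = N then c m / eps N else 0) = (\<Sum>m\<in>keys F. if vh m = vh m0 then c m else 0) / eps N"
          unfolding sum_divide_distrib
          by (rule sum.cong) (use nf_eq_iff[OF km km[OF m0(1)]] m0(2) in auto)
        also have "(\<Sum>m\<in>keys F. if vh m = vh m0 then c m else 0) = lookup (psi F) (vh m0)"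
          unfolding lookup_psi by (rule sum.cong) (auto simp: when_def c_def)
        finally show ?thesis unfolding * psi by simp
      qed
    qed
    have "F = (\<Sum>m\<in>keys F. Const (c m) * unit_mon m) - (\<Sum>m\<in>keys F. Const (c m) * unit_mon (nf m))"
      unfolding zero using cm poly_mapping_sum_single[of F] by simp
    also have "\<dots> = (\<Sum>m\<in>keys F. Const (c m) * (unit_mon m - unit_mon (nf m)))"
      by (simp add: sum_subtractf[symmetric] right_diff_distrib)
    also have "\<dots> \<in> ?K"
      using diff nf km by (intro ideal_pring_sum[OF K] ideal_Const_times[OF K]) simp
    finally show "F \<in> ?K" .
  qed
qed

lemma J_no_monomial: "single m 1 \<notin> J"
proof
  assume "single m 1 \<in> J"
  then have "m \<in> monomials n" "psi (single m 1) = 0" by (auto simp: J_def in_pring_iff)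
  then show False using eps_nonzero[of m] by (simp add: psi_single) (metis keys_eq_empty keys_single insert_not_empty)
qed

lemma primeideal_J: "primeideal J (pring n)"
proof (rule primeidealI[OF ideal_J cring_pring])
  have "1 \<notin> J" by (simp add: J_def psi_def)
  then show "carrier (pring n) \<noteq> J" using pring_1 by metis
next
  fix F G assume "F \<in> carrier (pring n)" "G \<in> carrier (pring n)" "F \<otimes>\<^bsub>pring n\<^esub> G \<in> J"
  then show "F \<in> J \<or> G \<in> J" by (auto simp: J_def psi_def poly_subst_mult)
qed

text \<open>
  The ideal \<open>J\<close> is graded by exponents and contains no monomial, so the initial form of a
  Pluecker relation can only consist of the two terms whose exponents agree.
\<close>

lemma open_cone_of_initial_ideal:
  assumes w: "w \<in> weights n" and init: "initial_ideal n w (plucker_ideal n) = J"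
  shows "w \<in> open_cone"
  unfolding open_cone_def
proof (intro CollectI conjI w allI impI)
  fix a b c d assume q: "qt a b c d"
  have d: "distinct [a, b, c, d]" "{a, b, c, d} \<subseteq> {1..n}" using qt_distinct[OF q] by auto
  note md = matchings_distinct[OF d(1)]
  let ?A = "edge a b + edge c d" and ?B = "edge a c + edge b d" and ?C = "edge a d + edge b c"
  let ?P = "plucker_rel a b c d"
  note keys = keys_plucker_rel[OF d(1)]
  let ?G = "initial_form w ?P"
  have mon: "edge x y \<in> monomials n" if "x \<in> {a, b, c, d}" "y \<in> {a, b, c, d}" "x \<noteq> y" for x y
    using that d by (intro edge_in_monomials) auto
  have eps: "eps ?A \<noteq> 0" "eps ?B \<noteq> 0" "eps ?C \<noteq> 0"
    using mon[of a b] mon[of c d] mon[of a c] mon[of b d] mon[of a d] mon[of b c] d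
    by (simp_all add: eps_nonzero keys_add_nat)
  have "?G \<in> J" using plucker_rel_in_ideal[OF d] initial_form_in_initial_ideal[OF plucker_ideal_carrier] init by blast
  then have psi: "lookup (psi ?G) \<gamma> = 0" for \<gamma> by (simp add: J_def)
  have fin: "keys ?G \<subseteq> {?A, ?B, ?C}" using keys by (auto simp: keys_initial_form)
  have look: "lookup (psi ?G) \<gamma> = (\<Sum>m\<in>{?A, ?B, ?C}. (lookup ?G m * eps m) when vh m = \<gamma>)" for \<gamma>
    unfolding lookup_psi using fin by (intro sum.mono_neutral_left) (auto simp: in_keys_iff)
  note vm = vh_matchings[OF q]
  have A: "lookup ?G ?A = 0"
    using psi[of "vh ?A"] eps md vm unfolding look by (simp add: when_def)
  have BC: "lookup ?G ?B * eps ?B + lookup ?G ?C * eps ?C = 0"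
    using psi[of "vh ?B"] A md vm unfolding look by (simp add: when_def)
  have nA: "?A \<notin> keys ?G" using A by (simp add: in_keys_iff)
  have BCk: "?B \<in> keys ?G \<longleftrightarrow> ?C \<in> keys ?G" using BC eps by (auto simp: in_keys_iff)
  have wts: "monomial_weight w (edge x y + edge z u) = edge_weight w x y + edge_weight w z u" for x y z u
    by (simp add: monomial_weight_add monomial_weight_edge)
  show "edge_weight w a c + edge_weight w b d = edge_weight w a d + edge_weight w b c"
    "edge_weight w a c + edge_weight w b d < edge_weight w a b + edge_weight w c d"
    using nA BCk unfolding keys_initial_form keys by (auto simp: wts)
qed

end

section \<open>Tree cones as Groebner cones\<close>

lemma edge_weight_affine:
  "edge_weight (s *\<^sub>R u + t *\<^sub>R v) a b = s * edge_weight u a b + t * edge_weight v a b"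
  by (simp add: edge_weight_def plus_fun_def scaleR_fun_def)

lemma weights_affine: "u \<in> weights n \<Longrightarrow> v \<in> weights n \<Longrightarrow> s *\<^sub>R u + t *\<^sub>R v \<in> weights n"
  by (simp add: weights_def plus_fun_def scaleR_fun_def)

lemma continuous_weight_line: "continuous_on UNIV (\<lambda>t. (1 - t) *\<^sub>R u + t *\<^sub>R (v :: weight))"
proof (rule continuous_on_coordinatewise_then_product)
  fix p
  have "continuous_on UNIV (\<lambda>t. (1 - t) * u p + t * v p)" by (intro continuous_intros)
  then show "continuous_on UNIV (\<lambda>t. ((1 - t) *\<^sub>R u + t *\<^sub>R v) p)"
    by (simp add: plus_fun_def scaleR_fun_def)
qed

text \<open>
  Weights live in a function space with the product topology, which is not given by a norm.
  Segments are enough for all closure and interior arguments on tree cones.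
\<close>

lemma weight_line_open:
  assumes "open U" "(u :: weight) \<in> U"
  shows "\<exists>\<epsilon>>0. \<forall>t. \<bar>t\<bar> < \<epsilon> \<longrightarrow> (1 - t) *\<^sub>R u + t *\<^sub>R v \<in> U"
proof -
  let ?f = "\<lambda>t. (1 - t) *\<^sub>R u + t *\<^sub>R v"
  have "open (?f -` U)" using open_vimage[OF assms(1) continuous_weight_line] .
  moreover have "0 \<in> ?f -` U" using assms(2) by (simp add: plus_fun_def scaleR_fun_def)
  ultimately obtain \<epsilon> where "\<epsilon> > 0" "ball 0 \<epsilon> \<subseteq> ?f -` U" by (meson open_contains_ball)
  then show ?thesis by (intro exI[of _ \<epsilon>]) (auto simp: subset_iff dist_real_def)
qed

lemma continuous_edge_weight: "continuous_on UNIV (\<lambda>w. edge_weight w a b)"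
  unfolding edge_weight_def by (rule continuous_on_product_coordinates)

lemma closed_weights: "closed (weights n)"
proof -
  have "weights n = (\<Inter>p\<in>- pairs n. {w. w p = 0})" by (auto simp: weights_def)
  moreover have "closed {w :: weight. w p = 0}" for p
    by (rule closed_Collect_eq[OF continuous_on_product_coordinates continuous_on_const])
  ultimately show ?thesis by auto
qed

definition equal_matchings :: "weight \<Rightarrow> nat \<Rightarrow> nat \<Rightarrow> nat \<Rightarrow> nat \<Rightarrow> bool" where
  "equal_matchings w a b c d \<longleftrightarrow> edge_weight w a c + edge_weight w b d = edge_weight w a d + edge_weight w b c"

definition matching_gap :: "weight \<Rightarrow> nat \<Rightarrow> nat \<Rightarrow> nat \<Rightarrow> nat \<Rightarrow> real" where
  "matching_gap w a b c d = edge_weight w a b + edge_weight w c d - (edge_weight w a c + edge_weight w b d)"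

lemma matching_gap_affine:
  "matching_gap (s *\<^sub>R u + t *\<^sub>R v) a b c d = s * matching_gap u a b c d + t * matching_gap v a b c d"
  unfolding matching_gap_def edge_weight_affine by (simp add: algebra_simps)

lemma equal_matchings_affine:
  "equal_matchings u a b c d \<Longrightarrow> equal_matchings v a b c d \<Longrightarrow> equal_matchings (s *\<^sub>R u + t *\<^sub>R v) a b c d"
proof -
  assume "equal_matchings u a b c d" "equal_matchings v a b c d"
  then have "s * (edge_weight u a c + edge_weight u b d) + t * (edge_weight v a c + edge_weight v b d)
      = s * (edge_weight u a d + edge_weight u b c) + t * (edge_weight v a d + edge_weight v b c)"
    by (simp only: equal_matchings_def)
  then show ?thesis unfolding equal_matchings_def edge_weight_affine by (simp add: algebra_simps)
qed

context plucker_model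
begin

lemma open_cone_alt: "open_cone = {w \<in> weights n. \<forall>a b c d. qt a b c d \<longrightarrow> equal_matchings w a b c d \<and> 0 < matching_gap w a b c d}"
  by (auto simp: open_cone_def equal_matchings_def matching_gap_def)

definition closed_cone :: "weight set" where
  "closed_cone = {w \<in> weights n. \<forall>a b c d. qt a b c d \<longrightarrow> equal_matchings w a b c d \<and> 0 \<le> matching_gap w a b c d}"

lemma closed_closed_cone: "closed closed_cone"
proof -
  have "closed_cone = weights n \<inter> (\<Inter>(a, b, c, d)\<in>{(a, b, c, d). qt a b c d}.
      {w. equal_matchings w a b c d} \<inter> {w. 0 \<le> matching_gap w a b c d})"
    by (auto simp: closed_cone_def)
  moreover have "closed {w. equal_matchings w a b c d}" for a b c d
    unfolding equal_matchings_def
    by (intro closed_Collect_eq continuous_on_add continuous_edge_weight)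
  moreover have "closed {w. 0 \<le> matching_gap w a b c d}" for a b c d
    unfolding matching_gap_def
    by (intro closed_Collect_le continuous_on_add continuous_on_diff continuous_edge_weight continuous_on_const)
  ultimately show ?thesis using closed_weights by (auto intro!: closed_Int closed_INT)
qed

lemma open_subset_closed: "open_cone \<subseteq> closed_cone"
  by (auto simp: open_cone_alt closed_cone_def intro: less_imp_le)

lemma mix_in_open_cone:
  assumes "u \<in> closed_cone" "v \<in> open_cone" "0 < t" "t < 1"
  shows "(1 - t) *\<^sub>R u + t *\<^sub>R v \<in> open_cone"
  using assms weights_affine[of u n v "1 - t" t]
  by (auto simp: open_cone_alt closed_cone_def equal_matchings_affine matching_gap_affine intro!: add_nonneg_pos)

lemma closure_open_cone: "closure open_cone = closed_cone"
proof
  show "closure open_cone \<subseteq> closed_cone"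
    by (rule closure_minimal[OF open_subset_closed closed_closed_cone])
next
  obtain v where v: "v \<in> open_cone" using tree_in_open_cone by blast
  show "closed_cone \<subseteq> closure open_cone"
  proof
    fix u assume u: "u \<in> closed_cone"
    show "u \<in> closure open_cone"
      unfolding closure_iff_nhds_not_empty
    proof (intro allI impI)
      fix A U :: "weight set" assume *: "U \<subseteq> A" "open U" "u \<in> U"
      obtain \<epsilon> where \<epsilon>: "\<epsilon> > 0" "\<And>t. \<bar>t\<bar> < \<epsilon> \<Longrightarrow> (1 - t) *\<^sub>R u + t *\<^sub>R v \<in> U"
        using weight_line_open[OF *(2,3)] by blast
      define t where "t = min (\<epsilon> / 2) (1 / 2)"
      have t: "0 < t" "t < 1" "\<bar>t\<bar> < \<epsilon>" using \<epsilon>(1) by (auto simp: t_def min_def)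
      have tU: "(1 - t) *\<^sub>R u + t *\<^sub>R v \<in> U" by (rule \<epsilon>(2)[OF t(3)])
      from mix_in_open_cone[OF u v t(1,2)] tU * show "open_cone \<inter> A \<noteq> {}" by blast
    qed
  qed
qed

lemma affine_hull_closed_cone:
  "affine hull closed_cone \<subseteq> {w \<in> weights n. \<forall>a b c d. qt a b c d \<longrightarrow> equal_matchings w a b c d}"
proof (rule hull_minimal)
  show "affine {w \<in> weights n. \<forall>a b c d. qt a b c d \<longrightarrow> equal_matchings w a b c d}"
    unfolding affine_def by (auto simp: weights_affine equal_matchings_affine)
qed (auto simp: closed_cone_def)

text \<open>
  A point of the relative interior may be moved a little away from a strict weight without
  leaving the cone, so all its gaps are positive.
\<close>

lemma rel_interior_closed_cone: "rel_interior closed_cone = open_cone"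
proof
  obtain v where v: "v \<in> open_cone" using tree_in_open_cone by blast
  show "rel_interior closed_cone \<subseteq> open_cone"
  proof
    fix u assume "u \<in> rel_interior closed_cone"
    then obtain U where U: "open U" "u \<in> U" "affine hull closed_cone \<inter> U \<subseteq> closed_cone"
      and u: "u \<in> closed_cone"
      unfolding rel_interior_def openin_open by blast
    obtain \<epsilon> where \<epsilon>: "\<epsilon> > 0" "\<And>t. \<bar>t\<bar> < \<epsilon> \<Longrightarrow> (1 - t) *\<^sub>R u + t *\<^sub>R v \<in> U"
      using weight_line_open[OF U(1,2)] by blast
    define t where "t = \<epsilon> / 2"
    have t: "0 < t" "\<bar>- t\<bar> < \<epsilon>" using \<epsilon>(1) by (auto simp: t_def)
    (* The point just beyond u on the line from the strict weight v through u. *)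
    have "(1 + t) *\<^sub>R u + (- t) *\<^sub>R v \<in> affine hull closed_cone"
      using u v open_subset_closed by (intro mem_affine[OF affine_affine_hull]) (auto intro: hull_inc)
    moreover have "(1 + t) *\<^sub>R u + (- t) *\<^sub>R v \<in> U" using \<epsilon>(2)[OF t(2)] by simp
    ultimately have out: "(1 + t) *\<^sub>R u + (- t) *\<^sub>R v \<in> closed_cone" using U(3) by blast
    have "0 < matching_gap u a b c d" if q: "qt a b c d" for a b c d
    proof -
      have "0 \<le> (1 + t) * matching_gap u a b c d + (- t) * matching_gap v a b c d"
        using out q unfolding closed_cone_def matching_gap_affine[symmetric] by blast
      moreover have "0 < t * matching_gap v a b c d" using v q t by (simp add: open_cone_alt)
      ultimately have "0 < (1 + t) * matching_gap u a b c d" by linarith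
      then show ?thesis using t by (simp add: zero_less_mult_iff)
    qed
    then show "u \<in> open_cone" using u by (auto simp: open_cone_alt closed_cone_def)
  qed
  show "open_cone \<subseteq> rel_interior closed_cone"
  proof
    fix u assume u: "u \<in> open_cone"
    define QT where "QT = {(a, b, c, d). qt a b c d}"
    have fin: "finite QT"
    proof (rule finite_subset)
      show "QT \<subseteq> {1..n} \<times> {1..n} \<times> {1..n} \<times> {1..n}" unfolding QT_def using qt_distinct by fastforce
    qed simp
    define U where "U = (\<Inter>(a, b, c, d)\<in>QT. {w. 0 < matching_gap w a b c d})"
    have "open {w. 0 < matching_gap w a b c d}" for a b c d
      unfolding matching_gap_def
      by (intro open_Collect_less continuous_on_add continuous_on_diff continuous_edge_weight continuous_on_const)
    then have "open U" unfolding U_def using fin by (intro open_INT) auto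
    moreover have "u \<in> U" using u by (auto simp: U_def QT_def open_cone_alt)
    moreover have "affine hull closed_cone \<inter> U \<subseteq> closed_cone"
      using affine_hull_closed_cone by (fastforce simp: U_def QT_def closed_cone_def intro: less_imp_le)
    moreover have "u \<in> affine hull closed_cone" using u open_subset_closed by (auto intro: hull_inc)
    ultimately show "u \<in> rel_interior closed_cone" unfolding rel_interior_def openin_open by blast
  qed
qed

lemma open_cone_trop: assumes "w \<in> open_cone" shows "w \<in> trop_grass n"
proof -
  have "w \<in> weights n" using assms by (simp add: open_cone_def)
  then show ?thesis unfolding trop_grass_def using J_no_monomial initial_ideal_eq_J[OF assms] by simp
qed

lemma groebner_cone_open_cone:
  assumes "w \<in> open_cone" shows "groebner_cone n w = closed_cone"
proof -
  have "{w' \<in> weights n. initial_ideal n w' (plucker_ideal n) = initial_ideal n w (plucker_ideal n)} = open_cone"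
    unfolding initial_ideal_eq_J[OF assms]
  proof (intro equalityI subsetI)
    fix w' assume "w' \<in> {w' \<in> weights n. initial_ideal n w' (plucker_ideal n) = J}"
    then show "w' \<in> open_cone" by (intro open_cone_of_initial_ideal) blast+
  next
    fix w' assume w': "w' \<in> open_cone"
    then have "w' \<in> weights n" by (simp add: open_cone_def)
    then show "w' \<in> {w' \<in> weights n. initial_ideal n w' (plucker_ideal n) = J}"
      using initial_ideal_eq_J[OF w'] by blast
  qed
  then show ?thesis unfolding groebner_cone_def by (simp only: closure_open_cone)
qed

lemma closed_cone_in_fan: "closed_cone \<in> trop_fan n"
  unfolding trop_fan_def using tree_in_open_cone open_cone_trop groebner_cone_open_cone by blast

lemma cone_initial_ideal_closed_cone: "cone_initial_ideal n closed_cone = J"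
proof -
  have "\<exists>w. w \<in> rel_interior closed_cone" using tree_in_open_cone rel_interior_closed_cone by blast
  then have "(SOME w. w \<in> rel_interior closed_cone) \<in> open_cone"
    unfolding rel_interior_closed_cone by (rule someI_ex)
  then show ?thesis unfolding cone_initial_ideal_def by (rule initial_ideal_eq_J)
qed

text \<open>
  Two weights with the same initial ideal, one of them in the closed cone of a tree: the initial
  forms of a Pluecker relation for both of them lie in this ideal, which is graded by both weights.  As
  it contains no monomial, no term may be isolated in weight, and the second weight satisfies the
  conditions of the tree, too.
\<close>

lemma groebner_cone_subset:
  assumes trop: "w0 \<in> trop_grass n" and w0: "w0 \<in> closed_cone"
  shows "groebner_cone n w0 \<subseteq> closed_cone"
proof -
  have "w \<in> closed_cone" if w: "w \<in> weights n"
    and init: "initial_ideal n w (plucker_ideal n) = initial_ideal n w0 (plucker_ideal n)" for w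
    unfolding closed_cone_def
  proof (intro CollectI conjI w allI impI)
    fix a b c d assume q: "qt a b c d"
    have d: "distinct [a, b, c, d]" "{a, b, c, d} \<subseteq> {1..n}" using qt_distinct[OF q] by auto
    note md = matchings_distinct[OF d(1)]
    let ?A = "edge a b + edge c d" and ?B = "edge a c + edge b d" and ?C = "edge a d + edge b c"
    let ?P = "plucker_rel a b c d" and ?K = "initial_ideal n w (plucker_ideal n)"
    note keys = keys_plucker_rel[OF d(1)]
    have nomon: "single m 1 \<notin> ?K" for m using trop init by (auto simp: trop_grass_def)
    have shared: "\<exists>k\<in>keys F. k \<noteq> m \<and> monomial_weight w k = monomial_weight w m" if "F \<in> ?K" "m \<in> keys F" for F m
      using isolated_monomial[OF plucker_ideal_carrier that] nomon by blast
    have wts: "monomial_weight u (edge x y + edge z v) = edge_weight u x y + edge_weight u z v" for u x y z v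
      by (simp add: monomial_weight_add monomial_weight_edge)
    have P: "?P \<in> plucker_ideal n" by (rule plucker_rel_in_ideal[OF d])
    have in0: "initial_form w0 ?P \<in> ?K" "initial_form w ?P \<in> ?K"
      using initial_form_in_initial_ideal[OF plucker_ideal_carrier P] init by metis+
    have q0: "monomial_weight w0 ?B = monomial_weight w0 ?C" "monomial_weight w0 ?B \<le> monomial_weight w0 ?A"
      using w0 q by (auto simp: closed_cone_def equal_matchings_def matching_gap_def wts)
    have B0: "?B \<in> keys (initial_form w0 ?P)" "?C \<in> keys (initial_form w0 ?P)"
      using q0 by (auto simp: keys_initial_form keys)
    have BC: "monomial_weight w ?B = monomial_weight w ?C \<and> monomial_weight w ?B \<le> monomial_weight w ?A"
    proof (cases "?A \<in> keys (initial_form w0 ?P)")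
      case True
      then have k3: "keys (initial_form w0 ?P) = {?A, ?B, ?C}" using B0 by (auto simp: keys_initial_form keys)
      have "monomial_weight w ?B = monomial_weight w ?A \<or> monomial_weight w ?C = monomial_weight w ?A"
        using shared[OF in0(1), of ?A] unfolding k3 by blast
      moreover have "monomial_weight w ?A = monomial_weight w ?B \<or> monomial_weight w ?C = monomial_weight w ?B"
        using shared[OF in0(1), of ?B] unfolding k3 by blast
      moreover have "monomial_weight w ?A = monomial_weight w ?C \<or> monomial_weight w ?B = monomial_weight w ?C"
        using shared[OF in0(1), of ?C] unfolding k3 by blast
      ultimately show ?thesis by argo
    next
      case False
      then have k2: "keys (initial_form w0 ?P) = {?B, ?C}" using B0 by (auto simp: keys_initial_form keys)
      have eq: "monomial_weight w ?B = monomial_weight w ?C"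
        using shared[OF in0(1), of ?B] unfolding k2 by (metis insertE insertI1 singletonD)
      have "monomial_weight w ?B \<le> monomial_weight w ?A"
      proof (rule ccontr)
        assume "\<not> ?thesis"
        then have "keys (initial_form w ?P) = {?A}" using eq by (auto simp: keys_initial_form keys)
        then show False using shared[OF in0(2), of ?A] by auto
      qed
      then show ?thesis using eq by blast
    qed
    then show "equal_matchings w a b c d" "0 \<le> matching_gap w a b c d"
      by (auto simp: equal_matchings_def matching_gap_def wts)
  qed
  then show ?thesis unfolding groebner_cone_def by (intro closure_minimal closed_closed_cone) blast
qed

end

text \<open>
  Otherwise the initial form of a Pluecker relation would be a single term.
\<close>

lemma trop_four_point:
  assumes w: "w \<in> trop_grass n" and d: "distinct [a, b, c, d]" "{a, b, c, d} \<subseteq> {1..n}"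
  shows "\<not> (edge_weight w a b + edge_weight w c d < edge_weight w a c + edge_weight w b d \<and>
            edge_weight w a b + edge_weight w c d < edge_weight w a d + edge_weight w b c)"
proof
  assume *: "edge_weight w a b + edge_weight w c d < edge_weight w a c + edge_weight w b d \<and>
            edge_weight w a b + edge_weight w c d < edge_weight w a d + edge_weight w b c"
  let ?A = "edge a b + edge c d" and ?P = "plucker_rel a b c d"
  have "keys (initial_form w ?P) = {?A}"
    using * unfolding keys_initial_form keys_plucker_rel[OF d(1)]
    by (auto simp: monomial_weight_add monomial_weight_edge)
  moreover have "initial_form w ?P \<in> initial_ideal n w (plucker_ideal n)"
    by (rule initial_form_in_initial_ideal[OF plucker_ideal_carrier plucker_rel_in_ideal[OF d]])
  ultimately have "single ?A 1 \<in> initial_ideal n w (plucker_ideal n)"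
    using isolated_monomial[OF plucker_ideal_carrier] by blast
  then show False using w by (auto simp: trop_grass_def)
qed

section \<open>Leading terms of the Pluecker coordinates of an iterated sequence\<close>

definition iseq :: "nat \<Rightarrow> (nat \<Rightarrow> nat) \<Rightarrow> (nat \<Rightarrow> nat) \<Rightarrow> root list" where
  "iseq n i j = concat (map (\<lambda>k. [(i k, k), (j k, k)]) (rev [3..<Suc n]))"

lemma length_concat_pairs: "length (concat (map (\<lambda>k. [A k, B k]) ks)) = 2 * length ks"
  by (induction ks) auto

lemma nth_concat_pairs:
  "t < length ks \<Longrightarrow> concat (map (\<lambda>k. [A k, B k]) ks) ! (2 * t) = A (ks ! t) \<and>
    concat (map (\<lambda>k. [A k, B k]) ks) ! Suc (2 * t) = B (ks ! t)"
proof (induction ks arbitrary: t)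
  case (Cons k ks)
  then show ?case by (cases t) auto
qed simp

lemma length_iseq: "length (iseq n i j) = 2 * (n - 2)"
  unfolding iseq_def length_concat_pairs by (simp del: upt_Suc)

lemma nth_iseq:
  assumes "k \<in> {3..n}"
  shows "iseq n i j ! (2 * (n - k)) = (i k, k)" "iseq n i j ! Suc (2 * (n - k)) = (j k, k)"
proof -
  have len: "n - k < length [3..<Suc n]" using assms by (auto simp del: upt_Suc)
  then have "n - k < length (rev [3..<Suc n])" by (simp del: upt_Suc)
  moreover have "rev [3..<Suc n] ! (n - k) = k"
    unfolding rev_nth[OF len] using assms by (subst nth_upt) (auto simp del: upt_Suc)
  ultimately show "iseq n i j ! (2 * (n - k)) = (i k, k)" "iseq n i j ! Suc (2 * (n - k)) = (j k, k)"
    unfolding iseq_def using nth_concat_pairs[of "n - k" "rev [3..<Suc n]" "\<lambda>k. (i k, k)" "\<lambda>k. (j k, k)"] by simp_all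
qed

lemma exp_root_op_apply:
  assumes "a \<noteq> k" "2 \<le> n"
  shows "exp_root_op n x (a, k) u l = u l + (if l = k then x * u a else 0)"
proof -
  have zero: "(root_op (a, k) ^^ Suc (Suc m)) u l = 0" for m l
    using assms(1) by (induction m arbitrary: l) (auto simp: root_op_def)
  have "exp_root_op n x (a, k) u l = (\<Sum>m\<in>{0, 1}. Const (1 / fact m) * x ^ m * ((root_op (a, k) ^^ m) u) l)"
    unfolding exp_root_op_def
  proof (rule sum.mono_neutral_right)
    show "\<forall>m\<in>{..<n} - {0, 1}. Const (1 / fact m) * x ^ m * ((root_op (a, k) ^^ m) u) l = 0"
    proof
      fix m assume "m \<in> {..<n} - {0, 1}"
      then obtain m' where "m = Suc (Suc m')" by (cases m; cases "m - 1") auto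
      then show "Const (1 / fact m) * x ^ m * ((root_op (a, k) ^^ m) u) l = 0" using zero by simp
    qed
  qed (use assms in auto)
  then show ?thesis by (simp add: root_op_def)
qed

lemma foldr_pairs:
  "foldr f [1..<Suc (2 * m)] u = foldr (\<lambda>t. f (2 * t + 1) \<circ> f (2 * t + 2)) [0..<m] u"
proof (induction m arbitrary: u)
  case (Suc m)
  have "[1..<Suc (2 * Suc m)] = [1..<Suc (2 * m)] @ [2 * m + 1, 2 * m + 2]" by simp
  then show ?case using Suc by simp
qed simp

locale iterated_seq = iterated +
  assumes n_ge: "4 \<le> n"
begin

abbreviation S :: "root list" where
  "S \<equiv> iseq n i j"

definition Yvar :: "nat \<Rightarrow> nat" where "Yvar k = 2 * (n - k) + 1"
definition Zvar :: "nat \<Rightarrow> nat" where "Zvar k = 2 * (n - k) + 2"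

definition block :: "nat \<Rightarrow> (nat \<Rightarrow> nat mpoly) \<Rightarrow> (nat \<Rightarrow> nat mpoly)" where
  "block k u = exp_root_op n (Var (Yvar k)) (i k, k) (exp_root_op n (Var (Zvar k)) (j k, k) u)"

lemma block_apply:
  assumes "k \<in> {3..n}"
  shows "block k u l = u l + (if l = k then Var (Yvar k) * u (i k) + Var (Zvar k) * u (j k) else 0)"
  using i_less[OF assms] j_less[OF assms] n_ge by (simp add: block_def exp_root_op_apply)

fun partial_vec :: "nat \<Rightarrow> (nat \<Rightarrow> nat mpoly) \<Rightarrow> (nat \<Rightarrow> nat mpoly)" where
  "partial_vec 0 u = u"
| "partial_vec (Suc k) u = (if 2 \<le> k then block (Suc k) (partial_vec k u) else u)"

lemma seq_op_partial_vec: "seq_op n S u = partial_vec n u"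
proof -
  let ?f = "\<lambda>l. exp_root_op n (Var l) (S ! (l - 1))"
  have "seq_op n S u = foldr ?f [1..<Suc (2 * (n - 2))] u"
    by (simp add: seq_op_def length_iseq)
  also have "\<dots> = foldr (\<lambda>t. ?f (2 * t + 1) \<circ> ?f (2 * t + 2)) [0..<n - 2] u" by (rule foldr_pairs)
  also have "\<dots> = foldr (\<lambda>t. block (n - t)) [0..<n - 2] u"
  proof (rule foldr_cong[OF refl refl])
    fix v t assume "t \<in> set [0..<n - 2]"
    then have k: "n - t \<in> {3..n}" "n - (n - t) = t" by auto
    show "(?f (2 * t + 1) \<circ> ?f (2 * t + 2)) v = block (n - t) v"
      using nth_iseq[OF k(1), of i j, unfolded k(2)]
      by (simp add: block_def Yvar_def Zvar_def k(2))
  qed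
  also have "\<dots> = partial_vec n u"
  proof -
    have "foldr (\<lambda>t. block (n - t)) [n - k..<n - 2] u = partial_vec k u" if "2 \<le> k" "k \<le> n" for k
      using that
    proof (induction k rule: dec_induct)
      case base
      then show ?case by (simp add: numeral_2_eq_2)
    next
      case (step k)
      then have "[n - Suc k..<n - 2] = (n - Suc k) # [n - k..<n - 2]"
        by (subst upt_conv_Cons) (auto simp: Suc_diff_Suc)
      then show ?case using step by simp
    qed
    from this[of n] show ?thesis using n_ge by simp
  qed
  finally show ?thesis .
qed

lemma partial_vec_stable: "l \<le> k \<Longrightarrow> k \<le> n \<Longrightarrow> partial_vec k u l = partial_vec l u l"
proof (induction k rule: dec_induct)
  case (step k)
  have "partial_vec (Suc k) u l = partial_vec k u l"
  proof (cases "2 \<le> k")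
    case True
    then show ?thesis using step block_apply[of "Suc k"] by simp
  next
    case False
    then have "partial_vec k u = u" by (cases k) auto
    then show ?thesis using False by simp
  qed
  then show ?case using step by simp
qed simp

lemma seq_op_step:
  assumes k: "k \<in> {3..n}"
  shows "seq_op n S u k = u k + Var (Yvar k) * seq_op n S u (i k) + Var (Zvar k) * seq_op n S u (j k)"
proof -
  obtain k' where k': "k = Suc k'" "2 \<le> k'" using k by (cases k) auto
  have fixed: "partial_vec k' u k = u k"
  proof -
    have "partial_vec l u k = u k" if "l < k" for l
      using that
    proof (induction l)
      case (Suc l)
      then show ?case using block_apply[of "Suc l"] k by simp
    qed simp
    then show ?thesis using k' by simp
  qed
  have ij: "i k \<le> k'" "j k \<le> k'" using i_less[OF k] j_less[OF k] k' by auto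
  have "seq_op n S u k = partial_vec k u k"
    unfolding seq_op_partial_vec using k by (intro partial_vec_stable) auto
  also have "\<dots> = partial_vec k' u k + (Var (Yvar k) * partial_vec k' u (i k) + Var (Zvar k) * partial_vec k' u (j k))"
    using k' block_apply[OF k] by simp
  also have "partial_vec k' u (i k) = seq_op n S u (i k)"
    unfolding seq_op_partial_vec using ij k k' partial_vec_stable[of "i k" k' u] partial_vec_stable[of "i k" n u] by simp
  also have "partial_vec k' u (j k) = seq_op n S u (j k)"
    unfolding seq_op_partial_vec using ij k k' partial_vec_stable[of "j k" k' u] partial_vec_stable[of "j k" n u] by simp
  finally show ?thesis using fixed by (simp add: add.assoc)
qed

lemma seq_op_low: "l \<le> 2 \<Longrightarrow> seq_op n S u l = u l"
  unfolding seq_op_partial_vec using partial_vec_stable[of l n u] n_ge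
  by (cases l; cases "l - 1") auto

definition P :: "nat \<Rightarrow> nat \<Rightarrow> nat mpoly" where
  "P a b = plucker_poly n S (a, b)"

lemma P_flip: "P b a = - P a b"
  by (simp add: P_def plucker_poly_def wedge_coeff_def)

lemma P_plucker: "P a b * P c d - P a c * P b d + P a d * P b c = 0"
  by (simp add: P_def plucker_poly_def wedge_coeff_def algebra_simps)

lemma P_same [simp]: "P a a = 0"
  by (simp add: P_def plucker_poly_def wedge_coeff_def)

lemma P_12: "P 1 2 = 1"
  by (simp add: P_def plucker_poly_def wedge_coeff_def seq_op_low basis_vec_def)

lemma P_step:
  assumes "k \<in> {3..n}"
  shows "P k a = Var (Yvar k) * P (i k) a + Var (Zvar k) * P (j k) a"
  unfolding P_def plucker_poly_def wedge_coeff_def fst_conv snd_conv seq_op_step[OF assms]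
  using assms by (simp add: basis_vec_def algebra_simps)

definition zmap :: "nat monomial \<Rightarrow> (nat \<Rightarrow>\<^sub>0 int)" where
  "zmap m = Poly_Mapping.map int m"

lemma lookup_zmap [simp]: "lookup (zmap m) l = int (lookup m l)"
  by (simp add: zmap_def Poly_Mapping.map.rep_eq when_def)

lemma zmap_add: "zmap (a + b) = zmap a + zmap b"
  by (rule poly_mapping_eqI) (simp add: lookup_add)

lemma zmap_inj: "zmap a = zmap b \<longleftrightarrow> a = b"
  by (metis lookup_zmap of_nat_eq_iff poly_mapping_eqI)

lemma Psi_add: "Psi S (a + b) = Psi S a + Psi S b"
  by (simp add: Psi_def lookup_add distrib_right sum.distrib)

lemma prec_irrefl: "\<not> prec S a a"
  by (simp add: prec_def)

lemma prec_trans: "prec S a b \<Longrightarrow> prec S b c \<Longrightarrow> prec S a c"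
  unfolding prec_def by (auto intro: less_trans)

lemma prec_total: "a \<noteq> b \<Longrightarrow> prec S a b \<or> prec S b a"
  unfolding prec_def by (meson linorder_neqE)

lemma prec_add: "prec S a b \<Longrightarrow> prec S (a + c) (b + c)"
  unfolding prec_def Psi_add by auto

definition lt :: "nat monomial \<Rightarrow> nat monomial \<Rightarrow> bool" where
  "lt a b \<longleftrightarrow> prec S (zmap a) (zmap b)"

sublocale order: exponent_order lt
proof
  fix a b c :: "nat monomial"
  show "\<not> lt a a" by (simp add: lt_def prec_irrefl)
  show "lt a b \<Longrightarrow> lt b c \<Longrightarrow> lt a c" using prec_trans by (auto simp: lt_def)
  show "a \<noteq> b \<Longrightarrow> lt a b \<or> lt b a" using prec_total zmap_inj by (auto simp: lt_def)
  show "lt a b \<Longrightarrow> lt (a + c) (b + c)" using prec_add by (auto simp: lt_def zmap_add)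
qed

lemma Psi_var:
  assumes "k \<in> {3..n}"
  shows "Psi S (zmap (single (Yvar k) 1)) = int k - int (i k)" "Psi S (zmap (single (Zvar k) 1)) = int k - int (j k)"
proof -
  have "Psi S (zmap (single l 1)) = height (S ! (l - 1))" if "l \<in> {1..length S}" for l
  proof -
    have "Psi S (zmap (single l 1)) = (\<Sum>l'\<in>{1..length S}. if l = l' then height (S ! (l' - 1)) else 0)"
      unfolding Psi_def by (rule sum.cong) (auto simp: lookup_single when_def)
    then show ?thesis using that by simp
  qed
  moreover have "Yvar k \<in> {1..length S}" "Zvar k \<in> {1..length S}"
    using assms by (auto simp: length_iseq Yvar_def Zvar_def)
  ultimately show "Psi S (zmap (single (Yvar k) 1)) = int k - int (i k)" "Psi S (zmap (single (Zvar k) 1)) = int k - int (j k)"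
    using nth_iseq[OF assms, of i j] by (simp_all add: Yvar_def Zvar_def height_def)
qed

definition good :: "nat \<Rightarrow> nat \<Rightarrow> bool" where
  "good a b \<longleftrightarrow> (\<forall>m\<in>keys (P a b). Psi S (zmap m) = int a + int b - 3 \<and> keys m \<subseteq> {l. 2 * (n - max a b) < l \<and> l \<le> 2 * (n - 2)}) \<and>
    (\<exists>c. order.lead (P a b) (texp a b) c)"

lemma good_flip: assumes "good a b" shows "good b a"
proof -
  have "keys (P b a) = keys (P a b)" by (simp add: P_flip[of a b])
  moreover obtain c where "order.lead (P a b) (texp a b) c" using assms by (auto simp: good_def)
  then have "order.lead (P b a) (texp b a) (- c)" using order.lead_uminus P_flip[of b a] texp_sym by metis
  ultimately show ?thesis using assms unfolding good_def by (auto simp: max.commute add.commute)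
qed

lemma keys_Var_mult: "keys (Var l * G) \<subseteq> (\<lambda>m. single l 1 + m) ` keys G"
  using keys_mult[of "Var l" G] unfolding Var_def by (auto split: if_splits)

text \<open>
  Homogeneity in \<open>\<Psi>\<close> and the range of the variables are proved along with the leading exponent,
  because they are needed to compare the two summands of \<open>P_step\<close>: the weights agree, and the
  variable of smallest index, the first one of step \<open>k\<close>, occurs only in the first summand.
\<close>

lemma good_P: "a \<noteq> b \<Longrightarrow> {a, b} \<subseteq> {1..n} \<Longrightarrow> good a b"
proof (induction "a + b" arbitrary: a b rule: less_induct)
  case less
  have main: "good k a'" if ka: "a' < k" "a' \<in> {1..n}" "k \<in> {1..n}" "k + a' = a + b" for k a'
  proof (cases "k = 2")
    case True
    then have a1: "a' = 1" using ka by auto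
    have "good 1 2"
    proof -
      have "texp_ordered a 2 = 0" for a by (subst texp_ordered.simps) simp
      moreover have "min 1 2 = (1::nat)" "max 1 2 = (2::nat)" by auto
      ultimately have "texp 1 2 = 0" by (simp only: texp_def)
      moreover have "order.lead 1 0 1" using order.lead_single[of 1 0] by simp
      moreover have "Psi S (zmap 0) = 0" by (simp add: Psi_def)
      ultimately show ?thesis unfolding good_def P_12 by auto
    qed
    then show ?thesis using True a1 good_flip by simp
  next
    case False
    then have k: "k \<in> {3..n}" using ka by auto
    have ij: "i k \<in> {1..<k}" "j k \<in> {1..<k}" "i k \<noteq> j k" using i_less[OF k] j_less[OF k] i_neq_j[OF k] by auto
    have sub: "good x a'" if "x \<in> {1..<k}" "x \<noteq> a'" for x
      using less.hyps[of x a'] that ka k by auto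
    have var: "keys (Var v * P x a') \<subseteq> {m. Psi S (zmap m) = int k + int a' - 3 \<and>
        (\<exists>m'. m = single v 1 + m' \<and> m' \<in> keys (P x a') \<and> keys m' \<subseteq> {l. 2 * (n - k) + 2 < l \<and> l \<le> 2 * (n - 2)})}"
      if x: "x \<in> {1..<k}" and v: "Psi S (zmap (single v 1)) = int k - int x" for v x
    proof (cases "x = a'")
      case True
      then show ?thesis by simp
    next
      case False
      from sub[OF x False] have g: "\<And>m. m \<in> keys (P x a') \<Longrightarrow> Psi S (zmap m) = int x + int a' - 3 \<and>
          keys m \<subseteq> {l. 2 * (n - max x a') < l \<and> l \<le> 2 * (n - 2)}" unfolding good_def by blast
      have "2 * (n - k) + 2 \<le> 2 * (n - max x a')" using x ka k by auto
      then have incl: "{l. 2 * (n - max x a') < l \<and> l \<le> 2 * (n - 2)} \<subseteq> {l. 2 * (n - k) + 2 < l \<and> l \<le> 2 * (n - 2)}" by auto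
      have sub': "keys m \<subseteq> {l. 2 * (n - k) + 2 < l \<and> l \<le> 2 * (n - 2)}" if "m \<in> keys (P x a')" for m
        by (rule order_trans[OF conjunct2[OF g[OF that]] incl])
      show ?thesis
      proof
        fix m assume "m \<in> keys (Var v * P x a')"
        from subsetD[OF keys_Var_mult this] obtain m' where m': "m = single v 1 + m'" "m' \<in> keys (P x a')"
          by (rule imageE)
        have "Psi S (zmap m) = int k + int a' - 3" unfolding m'(1) zmap_add Psi_add v using g[OF m'(2)] by simp
        then show "m \<in> {m. Psi S (zmap m) = int k + int a' - 3 \<and>
          (\<exists>m'. m = single v 1 + m' \<and> m' \<in> keys (P x a') \<and> keys m' \<subseteq> {l. 2 * (n - k) + 2 < l \<and> l \<le> 2 * (n - 2)})}"
          using m' sub'[OF m'(2)] by blast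
      qed
    qed
    note varY = var[OF ij(1) Psi_var(1)[OF k]] and varZ = var[OF ij(2) Psi_var(2)[OF k]]
    have keysP: "keys (P k a') \<subseteq> keys (Var (Yvar k) * P (i k) a') \<union> keys (Var (Zvar k) * P (j k) a')"
      unfolding P_step[OF k] by (rule Poly_Mapping.keys_add)
    have 1: "\<forall>m\<in>keys (P k a'). Psi S (zmap m) = int k + int a' - 3 \<and> keys m \<subseteq> {l. 2 * (n - max k a') < l \<and> l \<le> 2 * (n - 2)}"
    proof
      fix m assume "m \<in> keys (P k a')"
      from subsetD[OF keysP this] consider "m \<in> keys (Var (Yvar k) * P (i k) a')" | "m \<in> keys (Var (Zvar k) * P (j k) a')"
        by blast
      then obtain v m' where m: "Psi S (zmap m) = int k + int a' - 3" "m = single v 1 + m'" "v = Yvar k \<or> v = Zvar k"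
          "keys m' \<subseteq> {l. 2 * (n - k) + 2 < l \<and> l \<le> 2 * (n - 2)}"
      proof cases
        case 1 from subsetD[OF varY this] show thesis using that by blast
      next
        case 2 from subsetD[OF varZ this] show thesis using that by blast
      qed
      have "v \<in> {l. 2 * (n - k) < l \<and> l \<le> 2 * (n - 2)}" using m(3) k by (auto simp: Yvar_def Zvar_def)
      then show "Psi S (zmap m) = int k + int a' - 3 \<and> keys m \<subseteq> {l. 2 * (n - max k a') < l \<and> l \<le> 2 * (n - 2)}"
        using m ka by (auto simp: keys_add_nat max_def)
    qed
    have leadVar: "order.lead (Var v) (single v 1) 1" for v unfolding Var_def by (rule order.lead_single) simp
    have 2: "\<exists>c. order.lead (P k a') (texp k a') c"
    proof (cases "a' = i k")
      case True
      obtain c where c: "order.lead (P (j k) a') (texp (j k) a') c" using sub[of "j k"] ij True unfolding good_def by auto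
      have "P k a' = Var (Zvar k) * P (j k) a'" using P_step[OF k, of a'] True by simp
      moreover have "texp k a' = single (Zvar k) 1 + texp (j k) a'"
        using texp_cherry[OF k] True texp_sym[of "i k" "j k"] by (simp add: Zvar_def add.commute)
      ultimately show ?thesis using order.lead_mult[OF leadVar c] by metis
    next
      case False
      obtain c where c: "order.lead (P (i k) a') (texp (i k) a') c" using sub[of "i k"] ij False unfolding good_def by auto
      have t: "texp k a' = single (Yvar k) 1 + texp (i k) a'"
        using texp_step[OF k, of a'] False ka by (simp add: Yvar_def add.commute)
      have lY: "order.lead (Var (Yvar k) * P (i k) a') (texp k a') (1 * c)"
        unfolding t by (rule order.lead_mult[OF leadVar c])
      have "order.above (texp k a') (Var (Zvar k) * P (j k) a')"
        unfolding order.above_def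
      proof
        fix m assume m: "m \<in> keys (Var (Zvar k) * P (j k) a')"
        obtain m' where m': "m = single (Zvar k) 1 + m'" "keys m' \<subseteq> {l. 2 * (n - k) + 2 < l \<and> l \<le> 2 * (n - 2)}"
          "Psi S (zmap m) = int k + int a' - 3" using subsetD[OF varZ m] by blast
        have "texp k a' \<in> keys (Var (Yvar k) * P (i k) a')" using order.lead_in_keys[OF lY] .
        then have tP: "Psi S (zmap (texp k a')) = int k + int a' - 3"
          and tk: "\<exists>m''. texp k a' = single (Yvar k) 1 + m'' \<and> keys m'' \<subseteq> {l. 2 * (n - k) + 2 < l \<and> l \<le> 2 * (n - 2)}"
          using subsetD[OF varY, of "texp k a'"] by blast+
        obtain m'' where m'': "texp k a' = single (Yvar k) 1 + m''" "keys m'' \<subseteq> {l. 2 * (n - k) + 2 < l \<and> l \<le> 2 * (n - 2)}"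
          using tk by blast
        have z: "lookup M l = 0" if "keys M \<subseteq> {l. 2 * (n - k) + 2 < l \<and> l \<le> 2 * (n - 2)}" "l \<le> 2 * (n - k) + 2" for M :: "nat monomial" and l
          using that in_keys_iff[of l M] by fastforce
        (* In the library order, the first variable of step k is the first place of difference. *)
        have "zmap m < zmap (texp k a')"
          unfolding less_poly_mapping.rep_eq less_fun_def
        proof (intro exI[of _ "Yvar k"] conjI allI impI)
          show "lookup (zmap m) (Yvar k) < lookup (zmap (texp k a')) (Yvar k)"
            unfolding m'(1) m''(1) using z[OF m'(2), of "Yvar k"] z[OF m''(2), of "Yvar k"]
            by (simp add: lookup_add lookup_single Yvar_def Zvar_def)
          fix l assume "l < Yvar k"
          then show "lookup (zmap m) l = lookup (zmap (texp k a')) l"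
            unfolding m'(1) m''(1) using z[OF m'(2), of l] z[OF m''(2), of l]
            by (simp add: lookup_add lookup_single Yvar_def Zvar_def)
        qed
        then show "lt (texp k a') m" unfolding lt_def prec_def using tP m'(3) by simp
      qed
      then show ?thesis using order.lead_add_above[OF lY] P_step[OF k, of a'] by auto
    qed
    show ?thesis using 1 2 by (simp add: good_def)
  qed
  show ?case
  proof (cases "b < a")
    case True
    then show ?thesis using main[of b a] less.prems by simp
  next
    case False
    then show ?thesis using main[of a b] less.prems good_flip by (simp add: add.commute)
  qed
qed

definition lc :: "nat \<Rightarrow> nat \<Rightarrow> complex" where
  "lc a b = lookup (P a b) (texp a b)"

lemma P_lead: "a \<noteq> b \<Longrightarrow> {a, b} \<subseteq> {1..n} \<Longrightarrow> order.lead (P a b) (texp a b) (lc a b)"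
  using good_P[of a b] order.lead_lookup unfolding good_def lc_def by metis

lemma P_keys: "a \<noteq> b \<Longrightarrow> {a, b} \<subseteq> {1..n} \<Longrightarrow> m \<in> keys (P a b) \<Longrightarrow> keys m \<subseteq> {1..2 * (n - 2)}"
  using good_P[of a b] unfolding good_def by fastforce

lemma mon_sum_mon_sum: "mon_sum h (mon_sum g m) = mon_sum (\<lambda>p. mon_sum h (g p)) m"
proof (induction m rule: monomial_induct)
  case (add v m')
  then show ?case by (simp add: mon_sum_add)
qed simp

lemma mon_sum_cong: "(\<And>p. p \<in> keys m \<Longrightarrow> g p = h p) \<Longrightarrow> mon_sum g m = mon_sum h m"
  unfolding mon_sum_def by (rule sum.cong) auto

lemma mon_sum_id: "mon_sum (\<lambda>p. single p 1) m = m"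
proof (induction m rule: monomial_induct)
  case (add v m')
  then show ?case by (simp add: mon_sum_add)
qed simp

text \<open>
  Connectedness is transported through the relabelling of multigraphs by \<open>\<sigma>\<close> and its inverse.
\<close>

lemma plucker_model_permuted:
  assumes \<sigma>: "\<sigma> permutes {1..n}"
  shows "plucker_model lt n (\<lambda>a b. texp (\<sigma> a) (\<sigma> b)) (\<lambda>a b. P (\<sigma> a) (\<sigma> b)) (\<lambda>a b. lc (\<sigma> a) (\<sigma> b))
    (\<lambda>a b c d. qt (\<sigma> a) (\<sigma> b) (\<sigma> c) (\<sigma> d)) (\<lambda>a b. tree_weight (\<sigma> a) (\<sigma> b))"
proof
  have inj: "\<sigma> a = \<sigma> b \<longleftrightarrow> a = b" for a b using permutes_inj[OF \<sigma>] by (auto simp: inj_def)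
  have rng: "\<sigma> a \<in> {1..n} \<longleftrightarrow> a \<in> {1..n}" for a using permutes_in_image[OF \<sigma>] by blast
  fix a b c d :: nat
  show "P (\<sigma> b) (\<sigma> a) = - P (\<sigma> a) (\<sigma> b)" by (rule P_flip)
  show "P (\<sigma> a) (\<sigma> b) * P (\<sigma> c) (\<sigma> d) - P (\<sigma> a) (\<sigma> c) * P (\<sigma> b) (\<sigma> d) + P (\<sigma> a) (\<sigma> d) * P (\<sigma> b) (\<sigma> c) = 0"
    by (rule P_plucker)
  show "a \<noteq> b \<Longrightarrow> {a, b} \<subseteq> {1..n} \<Longrightarrow> order.lead (P (\<sigma> a) (\<sigma> b)) (texp (\<sigma> a) (\<sigma> b)) (lc (\<sigma> a) (\<sigma> b))"
    using rng inj by (intro P_lead) auto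
  show "texp (\<sigma> a) (\<sigma> b) = texp (\<sigma> b) (\<sigma> a)" by (rule texp_sym)
  show "lookup (texp (\<sigma> a) (\<sigma> b)) 0 = 0" by (rule texp_lookup_0)
  show "qt (\<sigma> a) (\<sigma> b) (\<sigma> c) (\<sigma> d) \<Longrightarrow> texp (\<sigma> a) (\<sigma> c) + texp (\<sigma> b) (\<sigma> d) = texp (\<sigma> a) (\<sigma> d) + texp (\<sigma> b) (\<sigma> c)"
    by (rule texp_additive)
  show "qt (\<sigma> a) (\<sigma> b) (\<sigma> c) (\<sigma> d) \<Longrightarrow> texp (\<sigma> a) (\<sigma> c) + texp (\<sigma> b) (\<sigma> d) \<noteq> texp (\<sigma> a) (\<sigma> b) + texp (\<sigma> c) (\<sigma> d)"
    by (rule texp_strict)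
  show "qt (\<sigma> a) (\<sigma> b) (\<sigma> c) (\<sigma> d) \<Longrightarrow> distinct [a, b, c, d] \<and> {a, b, c, d} \<subseteq> {1..n}"
    using qt_distinct[of "\<sigma> a" "\<sigma> b" "\<sigma> c" "\<sigma> d"] inj rng by (simp only: distinct.simps list.set) auto
  show "distinct [a, b, c, d] \<Longrightarrow> {a, b, c, d} \<subseteq> {1..n} \<Longrightarrow>
      qt (\<sigma> a) (\<sigma> b) (\<sigma> c) (\<sigma> d) \<or> qt (\<sigma> a) (\<sigma> c) (\<sigma> b) (\<sigma> d) \<or> qt (\<sigma> a) (\<sigma> d) (\<sigma> b) (\<sigma> c)"
    unfolding resolved_def[symmetric] using inj rng by (intro resolvedI) auto
  show "tree_weight (\<sigma> a) (\<sigma> b) = tree_weight (\<sigma> b) (\<sigma> a)" by (rule tree_weight_sym)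
  show "qt (\<sigma> a) (\<sigma> b) (\<sigma> c) (\<sigma> d) \<Longrightarrow> tree_weight (\<sigma> a) (\<sigma> c) + tree_weight (\<sigma> b) (\<sigma> d) = tree_weight (\<sigma> a) (\<sigma> d) + tree_weight (\<sigma> b) (\<sigma> c)"
    by (rule tree_weight_additive)
  show "qt (\<sigma> a) (\<sigma> b) (\<sigma> c) (\<sigma> d) \<Longrightarrow> tree_weight (\<sigma> a) (\<sigma> c) + tree_weight (\<sigma> b) (\<sigma> d) < tree_weight (\<sigma> a) (\<sigma> b) + tree_weight (\<sigma> c) (\<sigma> d)"
    by (rule tree_weight_strict)
next
  fix m m' :: "(nat \<times> nat) monomial" and R :: "(nat \<times> nat) monomial \<Rightarrow> bool"
  let ?h = "\<lambda>p. single 0 1 + texp (\<sigma> (fst p)) (\<sigma> (snd p))"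
  assume m: "m \<in> monomials n" and m': "m' \<in> monomials n" and eq: "mon_sum ?h m = mon_sum ?h m'"
    and step: "\<And>\<mu> a b c d. qt (\<sigma> a) (\<sigma> b) (\<sigma> c) (\<sigma> d) \<Longrightarrow> R (\<mu> + edge b d + edge a c) \<Longrightarrow> R (\<mu> + edge b c + edge a d)"
    and R: "R m"
  define rl where "rl \<tau> = mon_sum (\<lambda>p. edge (\<tau> (fst p)) (\<tau> (snd p)))" for \<tau> :: "nat \<Rightarrow> nat"
  let ?\<tau> = "Hilbert_Choice.inv \<sigma>"
  have inv: "?\<tau> (\<sigma> a) = a" "\<sigma> (?\<tau> a) = a" for a
    by (rule permutes_inverses(2)[OF \<sigma>], rule permutes_inverses(1)[OF \<sigma>])
  have rl_edge: "rl \<tau> (edge a b) = edge (\<tau> a) (\<tau> b)" for \<tau> a b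
  proof -
    have "rl \<tau> (edge a b) = edge (\<tau> (min a b)) (\<tau> (max a b))" by (simp add: rl_def edge_def[of a b])
    then show ?thesis using edge_commute[of "\<tau> b" "\<tau> a"] by (cases "a \<le> b") (simp_all add: min_def max_def)
  qed
  have rl_add: "rl \<tau> (m1 + m2) = rl \<tau> m1 + rl \<tau> m2" for \<tau> m1 m2 by (simp add: rl_def mon_sum_add)
  have vh_rl: "vh (rl \<sigma> M) = mon_sum ?h M" for M
    unfolding rl_def mon_sum_mon_sum by (simp add: vh_edge)
  have rl_mon: "rl \<sigma> M \<in> monomials n" if "M \<in> monomials n" for M
    using that
  proof (induction M rule: monomial_induct)
    case (add p M')
    then have p: "fst p \<noteq> snd p" "fst p \<in> {1..n}" "snd p \<in> {1..n}" by (auto simp: keys_add_nat pairs_def)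
    have "\<sigma> (fst p) \<noteq> \<sigma> (snd p)" using p(1) inv by metis
    then have "edge (\<sigma> (fst p)) (\<sigma> (snd p)) \<in> monomials n"
      using p permutes_in_image[OF \<sigma>] by (intro edge_in_monomials) auto
    then show ?case using add by (auto simp: rl_def mon_sum_add keys_add_nat)
  qed (simp add: rl_def)
  have rl_inverse: "rl ?\<tau> (rl \<sigma> M) = M" if "M \<in> monomials n" for M
  proof -
    have "rl ?\<tau> (rl \<sigma> M) = mon_sum (\<lambda>p. rl ?\<tau> (edge (\<sigma> (fst p)) (\<sigma> (snd p)))) M"
      by (simp add: rl_def mon_sum_mon_sum)
    also have "\<dots> = mon_sum (\<lambda>p. single p 1) M"
    proof (rule mon_sum_cong)
      fix p assume "p \<in> keys M"
      then have "fst p < snd p" using that by (auto simp: pairs_def)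
      then show "rl ?\<tau> (edge (\<sigma> (fst p)) (\<sigma> (snd p))) = single p 1" unfolding rl_edge inv by (simp add: edge_lt)
    qed
    finally show ?thesis by (simp only: mon_sum_id)
  qed
  have "(move n)\<^sup>*\<^sup>* (rl \<sigma> m) (rl \<sigma> m')"
    using n_ge rl_mon[OF m] rl_mon[OF m'] eq by (intro moves_of_eq_vh) (auto simp: vh_rl)
  then have "R (rl ?\<tau> (rl \<sigma> m'))"
  proof (induction rule: rtranclp_induct)
    case base
    then show ?case using R rl_inverse[OF m] by simp
  next
    case (step X Y)
    from step(2) show ?case
    proof cases
      case (move a b c d \<mu>)
      have "qt (\<sigma> (?\<tau> a)) (\<sigma> (?\<tau> b)) (\<sigma> (?\<tau> c)) (\<sigma> (?\<tau> d))" using move(3) by (simp only: inv)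
      from \<open>\<And>\<mu> a b c d. qt (\<sigma> a) (\<sigma> b) (\<sigma> c) (\<sigma> d) \<Longrightarrow> R (\<mu> + edge b d + edge a c) \<Longrightarrow> R (\<mu> + edge b c + edge a d)\<close>[OF this, of "rl ?\<tau> \<mu>"]
      show ?thesis using step(3) unfolding move(1,2) rl_add rl_edge by blast
    qed
  qed
  then show "R m'" using rl_inverse[OF m'] by simp
qed

end

lemma iterated_sequence_iff:
  assumes "4 \<le> n"
  shows "iterated_sequence n S \<longleftrightarrow> (\<exists>i j. iterated_seq n i j \<and> S = iseq n i j)"
proof -
  have "iterated_seq n i j \<longleftrightarrow> (\<forall>k\<in>{3..n}. i k \<in> {1..k - 1} \<and> j k \<in> {1..k - 1} \<and> i k \<noteq> j k)" for i j
  proof -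
    have "{1..<k} = {1..k - 1}" if "k \<in> {3..n}" for k using that by auto
    then show ?thesis unfolding iterated_seq_def iterated_def iterated_seq_axioms_def using assms by blast
  qed
  then show ?thesis by (simp add: iterated_sequence_def iseq_def)
qed

section \<open>Every tropical point lies in a tree cone\<close>

definition four_point :: "nat set \<Rightarrow> (nat \<Rightarrow> nat \<Rightarrow> real) \<Rightarrow> bool" where
  "four_point X D \<longleftrightarrow> (\<forall>a b c d. distinct [a, b, c, d] \<and> {a, b, c, d} \<subseteq> X \<longrightarrow>
    \<not> (D a b + D c d < D a c + D b d \<and> D a b + D c d < D a d + D b c))"

lemma four_pointD:
  "four_point X D \<Longrightarrow> distinct [a, b, c, d] \<Longrightarrow> {a, b, c, d} \<subseteq> X \<Longrightarrow>
    D a c + D b d \<le> D a b + D c d \<or> D a d + D b c \<le> D a b + D c d"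
  unfolding four_point_def by (meson not_le)

text \<open>
  Fix a leaf \<open>r\<close> and maximise \<open>D x y - D x r - D y r\<close> over the pairs of other leaves.  By the
  four-point condition this quantity is an ultrametric, so a maximal pair has the same value with
  every further leaf.
\<close>

lemma cherry_exists:
  assumes sym: "\<And>a b. D a b = D b a" and fp: "four_point X D" and X: "3 \<le> card X"
  shows "\<exists>x\<in>X. \<exists>y\<in>X. x \<noteq> y \<and> (\<exists>\<delta>. \<forall>z\<in>X - {x, y}. D y z = D x z + \<delta>)"
proof -
  have fin: "finite X" using X by (metis card.infinite not_numeral_le_zero)
  obtain r where r: "r \<in> X" using X by (metis card.empty ex_in_conv not_numeral_le_zero)
  define g where "g p = D (fst p) (snd p) - D (fst p) r - D (snd p) r" for p
  define A where "A = {p \<in> (X - {r}) \<times> (X - {r}). fst p \<noteq> snd p}"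
  have finA: "finite A" using fin by (auto simp: A_def)
  have "2 \<le> card (X - {r})" using X r fin by simp
  then obtain T where "T \<subseteq> X - {r}" "card T = 2" by (meson obtain_subset_with_card_n)
  then obtain a b where "a \<in> X - {r}" "b \<in> X - {r}" "a \<noteq> b" by (auto simp: card_2_iff)
  then have "A \<noteq> {}" by (auto simp: A_def)
  then have "Max (g ` A) \<in> g ` A" using finA by (intro Max_in) auto
  then obtain p where "p \<in> A" "g p = Max (g ` A)" by auto
  then have p: "p \<in> A" "\<And>q. q \<in> A \<Longrightarrow> g q \<le> g p" using finA by auto
  obtain x y where xy: "p = (x, y)" by (cases p)
  have x: "x \<in> X" "x \<noteq> r" and y: "y \<in> X" "y \<noteq> r" and ne: "x \<noteq> y" using p(1) by (auto simp: A_def xy)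
  have "D y z = D x z + (D y r - D x r)" if z: "z \<in> X - {x, y}" for z
  proof (cases "z = r")
    case False
    have "g (x, z) \<le> g (x, y)" "g (y, z) \<le> g (x, y)"
      using p(2)[of "(x, z)"] p(2)[of "(y, z)"] x y z False by (auto simp: A_def xy)
    moreover have "D x y + D z r \<ge> D x z + D y r \<or> D x y + D z r \<ge> D x r + D y z"
      using four_pointD[OF fp, of x y z r] x y z r ne False by auto
    moreover have "D x z + D y r \<ge> D x y + D z r \<or> D x z + D y r \<ge> D x r + D z y"
      using four_pointD[OF fp, of x z y r] x y z r ne False by auto
    moreover have "D x r + D y z \<ge> D x y + D r z \<or> D x r + D y z \<ge> D x z + D r y"
      using four_pointD[OF fp, of x r y z] x y z r ne False by auto
    ultimately show ?thesis using sym[of z y] sym[of r z] sym[of r y] by (auto simp: g_def)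
  qed simp
  then show ?thesis using x y ne by blast
qed

text \<open>
  Remove one leaf of a cherry, order the remaining leaves, and attach the removed leaf last.
  The partner \<open>j\<close> may be any other leaf.
\<close>

lemma elimination_order:
  assumes sym: "\<And>a b. D a b = D b a"
  shows "2 \<le> k \<Longrightarrow> card X = k \<Longrightarrow> four_point X D \<Longrightarrow>
    \<exists>ord i j. bij_betw ord {1..k} X \<and> (\<forall>l\<in>{3..k}. i l \<in> {1..<l} \<and> j l \<in> {1..<l} \<and> i l \<noteq> j l \<and>
      (\<exists>\<delta>. \<forall>a\<in>{1..<l}. a \<noteq> i l \<longrightarrow> D (ord l) (ord a) = D (ord (i l)) (ord a) + \<delta>))"
proof (induction k arbitrary: X rule: dec_induct)
  case base
  then have "finite X" by (metis card.infinite zero_neq_numeral)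
  then obtain h where "bij_betw h {1..card X} X" using ex_bij_betw_nat_finite_1 by blast
  then show ?case using base by (intro exI[of _ h]) auto
next
  case (step k)
  have fin: "finite X" using step by (metis card.infinite nat.distinct(1))
  obtain x y \<delta> where xy: "x \<in> X" "y \<in> X" "x \<noteq> y" "\<forall>z\<in>X - {x, y}. D y z = D x z + \<delta>"
    using cherry_exists[of D X] sym step by auto
  have "four_point (X - {y}) D" using step.prems(2) unfolding four_point_def by blast
  moreover have "card (X - {y}) = k" using step.prems xy fin by simp
  ultimately obtain ord i j where IH: "bij_betw ord {1..k} (X - {y})"
    "\<forall>l\<in>{3..k}. i l \<in> {1..<l} \<and> j l \<in> {1..<l} \<and> i l \<noteq> j l \<and>
      (\<exists>\<delta>. \<forall>a\<in>{1..<l}. a \<noteq> i l \<longrightarrow> D (ord l) (ord a) = D (ord (i l)) (ord a) + \<delta>)"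
    using step.IH[of "X - {y}"] by blast
  have "x \<in> ord ` {1..k}" using IH(1) xy by (simp add: bij_betw_def)
  then obtain p where p: "p \<in> {1..k}" "ord p = x" by blast
  (* An arbitrary partner j for the new leaf, different from p; there are two leaves to choose from. *)
  define q where "q = (if p = 1 then 2 else 1 :: nat)"
  have q: "q \<in> {1..k}" "q \<noteq> p" using step.hyps by (auto simp: q_def)
  let ?ord = "ord(Suc k := y)" and ?i = "i(Suc k := p)" and ?j = "j(Suc k := q)"
  have "bij_betw ?ord {1..Suc k} X"
  proof -
    have "bij_betw ?ord {1..k} (X - {y})" using IH(1) by (subst bij_betw_cong[of _ _ ord]) auto
    then have "bij_betw ?ord ({1..k} \<union> {Suc k}) ((X - {y}) \<union> {y})"
      by (intro bij_betw_combine) auto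
    moreover have "{1..k} \<union> {Suc k} = {1..Suc k}" "(X - {y}) \<union> {y} = X" using xy by auto
    ultimately show ?thesis by simp
  qed
  moreover have "?i l \<in> {1..<l} \<and> ?j l \<in> {1..<l} \<and> ?i l \<noteq> ?j l \<and>
      (\<exists>\<delta>. \<forall>a\<in>{1..<l}. a \<noteq> ?i l \<longrightarrow> D (?ord l) (?ord a) = D (?ord (?i l)) (?ord a) + \<delta>)" if l: "l \<in> {3..Suc k}" for l
  proof (cases "l = Suc k")
    case True
    have "D y (ord a) = D x (ord a) + \<delta>" if a: "a \<in> {1..k}" "a \<noteq> p" for a
    proof -
      have "ord a \<in> X - {y}" by (rule bij_betwE[OF IH(1), rule_format, OF a(1)])
      moreover have "ord a \<noteq> x"
        using inj_on_eq_iff[OF bij_betw_imp_inj_on[OF IH(1)] a(1) p(1)] a(2) p(2) by simp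
      ultimately show ?thesis using xy(4) by blast
    qed
    then have "\<forall>a\<in>{1..<Suc k}. a \<noteq> p \<longrightarrow> D (?ord (Suc k)) (?ord a) = D (?ord p) (?ord a) + \<delta>"
      using p by auto
    then show ?thesis unfolding True using p q by auto
  next
    case False
    then have lk: "l \<in> {3..k}" using l by auto
    from IH(2) lk obtain \<delta>' where d: "i l \<in> {1..<l}" "j l \<in> {1..<l}" "i l \<noteq> j l"
      "\<And>a. a \<in> {1..<l} \<Longrightarrow> a \<noteq> i l \<Longrightarrow> D (ord l) (ord a) = D (ord (i l)) (ord a) + \<delta>'" by blast
    have e: "?i l = i l" "?j l = j l" "?ord l = ord l" "?ord (i l) = ord (i l)"
      "\<And>a. a \<in> {1..<l} \<Longrightarrow> ?ord a = ord a" using lk d(1) by auto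
    show ?thesis unfolding e(1-4) using d e(5) by (intro conjI exI[of _ \<delta>']) auto
  qed
  ultimately show ?case by blast
qed

definition tree_quartet :: "nat \<Rightarrow> (nat \<Rightarrow> nat) \<Rightarrow> (nat \<Rightarrow> nat) \<Rightarrow> nat \<Rightarrow> nat \<Rightarrow> nat \<Rightarrow> nat \<Rightarrow> bool" where
  "tree_quartet n i \<sigma> = (\<lambda>a b c d. iterated.qt n i (\<sigma> a) (\<sigma> b) (\<sigma> c) (\<sigma> d))"

definition tree_cone :: "nat \<Rightarrow> (nat \<Rightarrow> nat) \<Rightarrow> (nat \<Rightarrow> nat) \<Rightarrow> weight set" where
  "tree_cone n i \<sigma> = {w \<in> weights n. \<forall>a b c d. tree_quartet n i \<sigma> a b c d \<longrightarrow>
    equal_matchings w a b c d \<and> 0 \<le> matching_gap w a b c d}"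

locale labelled_tree = iterated_seq +
  fixes \<sigma> :: "nat \<Rightarrow> nat"
  assumes perm: "\<sigma> permutes {1..n}"
begin

sublocale M: plucker_model lt n "\<lambda>a b. texp (\<sigma> a) (\<sigma> b)" "\<lambda>a b. P (\<sigma> a) (\<sigma> b)" "\<lambda>a b. lc (\<sigma> a) (\<sigma> b)"
  "tree_quartet n i \<sigma>" "\<lambda>a b. tree_weight (\<sigma> a) (\<sigma> b)"
  using plucker_model_permuted[OF perm] unfolding tree_quartet_def .

lemma closed_cone_eq: "M.closed_cone = tree_cone n i \<sigma>"
  by (simp add: M.closed_cone_def tree_cone_def)

lemma tree_cone_in_fan: "tree_cone n i \<sigma> \<in> trop_fan n"
  using M.closed_cone_in_fan by (simp add: closed_cone_eq)

end

text \<open>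
  The elimination order says that \<open>w\<close> agrees on \<open>k\<close> and \<open>i k\<close> up to a constant, so it is
  additive on the quartets; at cherries the inequality is the four-point condition.
\<close>

lemma tree_exists:
  assumes n: "4 \<le> n" and w: "w \<in> trop_grass n"
  shows "\<exists>i j \<sigma>. labelled_tree n i j \<sigma> \<and> w \<in> tree_cone n i \<sigma>"
proof -
  let ?D = "edge_weight w"
  have fp: "four_point {1..n} ?D"
    unfolding four_point_def using trop_four_point[OF w] by blast
  obtain ord i j where ord: "bij_betw ord {1..n} {1..n}"
    and ij: "\<And>l. l \<in> {3..n} \<Longrightarrow> i l \<in> {1..<l} \<and> j l \<in> {1..<l} \<and> i l \<noteq> j l \<and>
      (\<exists>\<delta>. \<forall>a\<in>{1..<l}. a \<noteq> i l \<longrightarrow> ?D (ord l) (ord a) = ?D (ord (i l)) (ord a) + \<delta>)"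
  proof -
    have "2 \<le> n" "card {1..n} = n" using n by auto
    from elimination_order[OF edge_weight_sym this fp] show thesis using that by blast
  qed
  interpret iterated_seq n i j
    by unfold_locales (use ij n in auto)
  define \<tau> where "\<tau> x = (if x \<in> {1..n} then ord x else x)" for x
  have \<tau>: "\<tau> permutes {1..n}"
  proof (rule bij_imp_permutes)
    have "bij_betw \<tau> {1..n} {1..n} \<longleftrightarrow> bij_betw ord {1..n} {1..n}"
      by (rule bij_betw_cong) (simp add: \<tau>_def)
    then show "bij_betw \<tau> {1..n} {1..n}" using ord by simp
  qed (auto simp: \<tau>_def)
  define \<sigma> where "\<sigma> = Hilbert_Choice.inv \<tau>"
  have \<sigma>: "\<sigma> permutes {1..n}" unfolding \<sigma>_def by (rule permutes_inv[OF \<tau>])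
  have \<tau>\<sigma>: "\<tau> (\<sigma> a) = a" for a unfolding \<sigma>_def by (rule permutes_inverses(1)[OF \<tau>])
  define F where "F a b = ?D (\<tau> a) (\<tau> b)" for a b
  have symF: "F a b = F b a" for a b unfolding F_def by (rule edge_weight_sym)
  have "\<forall>k\<in>{3..n}. \<exists>\<delta>. \<forall>a\<in>{1..<k}. a \<noteq> i k \<longrightarrow> F k a = F (i k) a + \<delta>"
  proof
    fix k assume k: "k \<in> {3..n}"
    have "\<tau> k = ord k" "\<tau> (i k) = ord (i k)" "\<And>a. a \<in> {1..<k} \<Longrightarrow> \<tau> a = ord a"
      using k i_less[OF k] by (auto simp: \<tau>_def)
    then show "\<exists>\<delta>. \<forall>a\<in>{1..<k}. a \<noteq> i k \<longrightarrow> F k a = F (i k) a + \<delta>" using ij[OF k] by (auto simp: F_def)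
  qed
  from bchoice[OF this] obtain \<delta> where \<delta>: "\<And>k a. k \<in> {3..n} \<Longrightarrow> a \<in> {1..<k} \<Longrightarrow> a \<noteq> i k \<Longrightarrow> F k a = F (i k) a + \<delta> k"
    by blast
  have fpF: "F a c + F b d \<le> F a b + F c d \<or> F a d + F b c \<le> F a b + F c d"
    if "distinct [a, b, c, d]" "{a, b, c, d} \<subseteq> {1..n}" for a b c d
    unfolding F_def
  proof (rule four_pointD[OF fp])
    show "distinct [\<tau> a, \<tau> b, \<tau> c, \<tau> d]" using that(1) permutes_inj[OF \<tau>] by (auto simp: inj_eq)
    show "{\<tau> a, \<tau> b, \<tau> c, \<tau> d} \<subseteq> {1..n}" using that(2) permutes_in_image[OF \<tau>] by auto
  qed
  have le: "F a c + F b d \<le> F a b + F c d" if q: "qt a b c d" for a b c d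
  proof (rule qt_related[where R = "(\<le>)" and F = F and \<delta> = \<delta>, OF symF \<delta> _ _ q])
    fix k a b assume k: "k \<in> {3..n}" and ab: "a \<in> {1..<k}" "b \<in> {1..<k}" "a \<noteq> i k" "b \<noteq> i k" "a \<noteq> b"
    have "F k a + F (i k) b = F k b + F (i k) a" using \<delta>[OF k ab(1,3)] \<delta>[OF k ab(2,4)] by simp
    moreover have "F k a + F (i k) b \<le> F k (i k) + F a b \<or> F k b + F (i k) a \<le> F k (i k) + F a b"
      using i_less[OF k] k ab by (intro fpF) auto
    ultimately show "F k a + F (i k) b \<le> F k (i k) + F a b" by auto
  qed auto
  have eq: "F a c + F b d = F a d + F b c" if q: "qt a b c d" for a b c d
    by (rule qt_additive[where F = F and \<delta> = \<delta>, OF symF \<delta> q])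
  have "w \<in> tree_cone n i \<sigma>"
    unfolding tree_cone_def tree_quartet_def
  proof (intro CollectI conjI allI impI)
    show "w \<in> weights n" using w by (simp add: trop_grass_def)
    fix a b c d assume q: "qt (\<sigma> a) (\<sigma> b) (\<sigma> c) (\<sigma> d)"
    show "equal_matchings w a b c d" using eq[OF q] unfolding F_def \<tau>\<sigma> equal_matchings_def .
    show "0 \<le> matching_gap w a b c d" using le[OF q] unfolding F_def \<tau>\<sigma> matching_gap_def by simp
  qed
  moreover have "labelled_tree n i j \<sigma>"
    by (intro labelled_tree.intro iterated_seq_axioms labelled_tree_axioms.intro \<sigma>)
  ultimately show ?thesis by blast
qed

text \<open>
  A strict weight determines the quartets of its tree.  If it also lies in the cone of another
  tree, the quartets of the two trees agree, since each tree resolves all four-element sets.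
\<close>

lemma tree_cone_eq_if_subset:
  assumes 1: "labelled_tree n i j \<sigma>" and 2: "labelled_tree n i' j' \<sigma>'"
    and sub: "tree_cone n i \<sigma> \<subseteq> tree_cone n i' \<sigma>'"
  shows "tree_cone n i \<sigma> = tree_cone n i' \<sigma>'"
proof -
  interpret A: labelled_tree n i j \<sigma> by (rule 1)
  interpret B: labelled_tree n i' j' \<sigma>' by (rule 2)
  obtain w where w: "w \<in> A.M.open_cone" using A.M.tree_in_open_cone by blast
  then have w': "w \<in> tree_cone n i' \<sigma>'"
    using sub A.M.open_subset_closed unfolding A.closed_cone_eq by blast
  have a: "edge_weight w a c + edge_weight w b d = edge_weight w a d + edge_weight w b c"
    "edge_weight w a c + edge_weight w b d < edge_weight w a b + edge_weight w c d"
    if "tree_quartet n i \<sigma> a b c d" for a b c d using w that by (auto simp: A.M.open_cone_def)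
  have b: "edge_weight w a c + edge_weight w b d = edge_weight w a d + edge_weight w b c"
    "edge_weight w a c + edge_weight w b d \<le> edge_weight w a b + edge_weight w c d"
    if "tree_quartet n i' \<sigma>' a b c d" for a b c d
    using w' that by (auto simp: tree_cone_def equal_matchings_def matching_gap_def)
  have s: "edge_weight w x y = edge_weight w y x" for x y by (rule edge_weight_sym)
  have ba: "tree_quartet n i \<sigma> a b c d" if q: "tree_quartet n i' \<sigma>' a b c d" for a b c d
  proof -
    have "\<not> tree_quartet n i \<sigma> a c b d"
      using a[of a c b d] b[OF q] s[of c b] by auto
    moreover have "\<not> tree_quartet n i \<sigma> a d b c"
      using a[of a d b c] b[OF q] s[of d c] s[of d b] by auto
    moreover have "distinct [a, b, c, d] \<and> {a, b, c, d} \<subseteq> {1..n}" by (rule B.M.qt_distinct[OF q])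
    ultimately show ?thesis using A.M.qt_resolves[of a b c d] by blast
  qed
  have ab: "tree_quartet n i' \<sigma>' a b c d" if q: "tree_quartet n i \<sigma> a b c d" for a b c d
  proof -
    have "\<not> tree_quartet n i' \<sigma>' a c b d"
      using a[of a c b d] ba[of a c b d] a[OF q] s[of c b] by auto
    moreover have "\<not> tree_quartet n i' \<sigma>' a d b c"
      using a[of a d b c] ba[of a d b c] a[OF q] s[of d c] s[of d b] by auto
    moreover have "distinct [a, b, c, d] \<and> {a, b, c, d} \<subseteq> {1..n}" by (rule A.M.qt_distinct[OF q])
    ultimately show ?thesis using B.M.qt_resolves[of a b c d] by blast
  qed
  have "tree_quartet n i \<sigma> = tree_quartet n i' \<sigma>'" using ab ba by (intro ext) blast
  then show ?thesis by (simp add: tree_cone_def)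
qed

lemma fan_cone_in_tree_cone:
  assumes "4 \<le> n" "C \<in> trop_fan n"
  shows "\<exists>i j \<sigma>. labelled_tree n i j \<sigma> \<and> C \<subseteq> tree_cone n i \<sigma>"
proof -
  obtain w where w: "w \<in> trop_grass n" "C = groebner_cone n w" using assms by (auto simp: trop_fan_def)
  obtain i j \<sigma> where *: "labelled_tree n i j \<sigma>" "w \<in> tree_cone n i \<sigma>"
    using tree_exists[OF assms(1) w(1)] by blast
  interpret A: labelled_tree n i j \<sigma> by (rule *(1))
  have "C \<subseteq> tree_cone n i \<sigma>"
    using A.M.groebner_cone_subset[OF w(1)] *(2) w(2) by (simp add: A.closed_cone_eq)
  then show ?thesis using * by blast
qed

lemma maximal_tree_cone:
  assumes "4 \<le> n" "labelled_tree n i j \<sigma>"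
  shows "maximal_cone n (tree_cone n i \<sigma>)"
  unfolding maximal_cone_def
proof (intro conjI ballI impI labelled_tree.tree_cone_in_fan[OF assms(2)])
  fix D assume D: "D \<in> trop_fan n" "tree_cone n i \<sigma> \<subseteq> D"
  obtain i' j' \<sigma>' where *: "labelled_tree n i' j' \<sigma>'" "D \<subseteq> tree_cone n i' \<sigma>'"
    using fan_cone_in_tree_cone[OF assms(1) D(1)] by blast
  have "tree_cone n i \<sigma> = tree_cone n i' \<sigma>'"
    using D(2) *(2) by (intro tree_cone_eq_if_subset[OF assms(2) *(1)]) blast
  then show "D = tree_cone n i \<sigma>" using D(2) *(2) by blast
qed

lemma maximal_cone_is_tree_cone:
  assumes "4 \<le> n" "maximal_cone n C"
  shows "\<exists>i j \<sigma>. labelled_tree n i j \<sigma> \<and> C = tree_cone n i \<sigma>"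
proof -
  have "C \<in> trop_fan n" using assms by (simp add: maximal_cone_def)
  from fan_cone_in_tree_cone[OF assms(1) this] obtain i j \<sigma> where
    *: "labelled_tree n i j \<sigma>" "C \<subseteq> tree_cone n i \<sigma>" by blast
  then have "tree_cone n i \<sigma> = C" using assms(2) labelled_tree.tree_cone_in_fan[OF *(1)] by (simp add: maximal_cone_def)
  then show ?thesis using * by blast
qed

section \<open>The value semigroup\<close>

context iterated_seq
begin

sublocale tm: plucker_model lt n texp P lc qt tree_weight
  using plucker_model_permuted[OF permutes_id] by (simp add: id_def)

definition ev :: "(nat \<times> nat) mpoly \<Rightarrow> nat mpoly" where
  "ev = poly_subst (plucker_poly n S)"

definition tv :: "(nat \<times> nat) monomial \<Rightarrow> nat monomial" where
  "tv = mon_sum (\<lambda>p. texp (fst p) (snd p))"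

definition quot :: "(nat \<times> nat) mpoly \<Rightarrow> (nat \<times> nat) mpoly set" where
  "quot F = plucker_ideal n +>\<^bsub>pring n\<^esub> F"

lemma plucker_poly_P: "plucker_poly n S p = P (fst p) (snd p)"
  by (simp add: P_def)

lemma tm_vh: "tm.vh m = single 0 (total_degree m) + tv m"
proof (induction m rule: monomial_induct)
  case (add p m')
  have one: "single (0::nat) (Suc k) = 1 + single 0 k" for k
    by (metis plus_1_eq_Suc single_add single_one)
  show ?case using add(3) by (simp add: mon_sum_add tm.hV_def tv_def total_degree_add one ac_simps)
qed (simp add: tv_def)

lemma tv_index: "keys (tv m) \<subseteq> {1..2 * (n - 2)}"
proof (induction m rule: monomial_induct)
  case (add p m')
  have "keys (texp a b) \<subseteq> {1..2 * (n - 2)}" for a b using texp_index_bound[of _ a b] by fastforce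
  then show ?case using add by (simp add: tv_def mon_sum_add keys_add_nat)
qed (simp add: tv_def)

lemma phi_homogeneous:
  assumes "homogeneous r F" shows "tm.phi F = Var 0 ^ r * ev F"
proof -
  have mon: "mon_eval (\<lambda>p. Var 0 * P (fst p) (snd p)) m = Var 0 ^ total_degree m * mon_eval (plucker_poly n S) m"
    for m :: "(nat \<times> nat) monomial"
  proof (induction m rule: monomial_induct)
    case (add p m')
    then show ?case
      by (simp add: mon_eval_add mon_eval_single total_degree_add plucker_poly_P ac_simps)
  qed simp
  have "tm.phi F = (\<Sum>m\<in>keys F. Const (lookup F m) * mon_eval (\<lambda>p. Var 0 * P (fst p) (snd p)) m)"
    unfolding tm.phi_def by (rule poly_subst_superset) auto
  also have "\<dots> = (\<Sum>m\<in>keys F. Var 0 ^ r * (Const (lookup F m) * mon_eval (plucker_poly n S) m))"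
    using assms by (intro sum.cong) (auto simp: mon homogeneous_def ac_simps)
  also have "\<dots> = Var 0 ^ r * ev F"
    unfolding ev_def sum_distrib_left[symmetric] by (subst poly_subst_superset[of "keys F"]) auto
  finally show ?thesis .
qed

lemma ev_plucker_ideal: "F \<in> plucker_ideal n \<Longrightarrow> ev F = 0"
  unfolding ev_def by (rule plucker_ideal_vanishes) (simp_all add: plucker_poly_P P_plucker)

lemma quot_eq_iff:
  "F \<in> carrier (pring n) \<Longrightarrow> G \<in> carrier (pring n) \<Longrightarrow> quot F = quot G \<longleftrightarrow> F - G \<in> plucker_ideal n"
  unfolding quot_def by (rule coset_pring_eq_iff[OF ideal_plucker])

lemma class_subst_quot:
  assumes "F \<in> carrier (pring n)" shows "class_subst n S (quot F) = ev F"
proof -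
  have "poly_subst (plucker_poly n S) ` quot F = {ev F}"
  proof
    show "poly_subst (plucker_poly n S) ` quot F \<subseteq> {ev F}"
    proof (rule image_subsetI)
      fix G assume "G \<in> quot F"
      then have "G - F \<in> plucker_ideal n" unfolding quot_def coset_pring[OF ideal_plucker assms] by simp
      from ev_plucker_ideal[OF this] show "poly_subst (plucker_poly n S) G \<in> {ev F}"
        by (simp add: ev_def poly_subst_minus)
    qed
    have "F \<in> quot F" unfolding quot_def coset_pring[OF ideal_plucker assms] by (simp add: ideal_pring_0[OF ideal_plucker])
    then show "{ev F} \<subseteq> poly_subst (plucker_poly n S) ` quot F" by (auto simp: ev_def)
  qed
  then show ?thesis by (simp add: class_subst_def)
qed

lemma zero_grass: "\<zero>\<^bsub>grass_ring n\<^esub> = quot 0"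
proof -
  have "quot 0 = plucker_ideal n" unfolding quot_def by (subst coset_pring[OF ideal_plucker]) auto
  then show ?thesis by (simp add: grass_ring_def FactRing_def)
qed

lemma component_quot: "grass_component n r = quot ` {F \<in> carrier (pring n). homogeneous r F}"
  by (auto simp: quot_component_def quot_def)

lemma ev_eq_0_iff:
  assumes "F \<in> carrier (pring n)" "homogeneous r F" shows "ev F = 0 \<longleftrightarrow> F \<in> plucker_ideal n"
  using tm.plucker_ideal_iff[OF assms(1)] ev_plucker_ideal phi_homogeneous[OF assms(2)] by auto

lemma lead_Var0_power: "order.lead (Var 0 ^ r) (single 0 r) 1"
proof (induction r)
  case 0
  then show ?case using order.lead_single[of 1 0] by simp
next
  case (Suc r)
  have "order.lead (Var 0) (single (0::nat) 1) (1::complex)" unfolding Var_def by (rule order.lead_single) simp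
  from order.lead_mult[OF this Suc] show ?case by (simp add: single_add[symmetric])
qed

lemma ev_keys:
  assumes F: "F \<in> carrier (pring n)" and k: "k \<in> keys (ev F)" shows "keys k \<subseteq> {1..2 * (n - 2)}"
proof -
  let ?A = "{G :: nat mpoly. \<forall>k\<in>keys G. keys k \<subseteq> {1..2 * (n - 2)}}"
  have add: "G + H \<in> ?A" if "G \<in> ?A" "H \<in> ?A" for G H
    using that Poly_Mapping.keys_add[of G H] by blast
  have mult: "G * H \<in> ?A" if "G \<in> ?A" "H \<in> ?A" for G H
  proof clarify
    fix k l assume "k \<in> keys (G * H)" "l \<in> keys k"
    then obtain a b where "k = a + b" "a \<in> keys G" "b \<in> keys H" using keys_mult[of G H] by blast
    then have "keys a \<subseteq> {1..2 * (n - 2)}" "keys b \<subseteq> {1..2 * (n - 2)}" "l \<in> keys a \<union> keys b"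
      using that \<open>l \<in> keys k\<close> unfolding keys_add_nat[symmetric] by blast+
    then show "l \<in> {1..2 * (n - 2)}" by blast
  qed
  have mon: "mon_eval (plucker_poly n S) m \<in> ?A" if "m \<in> monomials n" for m
    using that
  proof (induction m rule: monomial_induct)
    case (add p m')
    then have p: "fst p \<noteq> snd p" "{fst p, snd p} \<subseteq> {1..n}" by (auto simp: keys_add_nat pairs_def)
    have "plucker_poly n S p \<in> ?A" using P_keys[OF p] by (auto simp: plucker_poly_P)
    moreover have "m' \<in> monomials n" using add(4) by (simp add: keys_add_nat)
    then have "mon_eval (plucker_poly n S) m' \<in> ?A" by (rule add(3))
    ultimately show ?case unfolding mon_eval_add mon_eval_single power_one_right by (rule mult)
  qed auto
  have c: "Const c \<in> ?A" for c by (auto simp: Const_def split: if_splits)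
  have "ev F = (\<Sum>m\<in>keys F. Const (lookup F m) * mon_eval (plucker_poly n S) m)"
    unfolding ev_def by (rule poly_subst_superset) auto
  moreover have "sum f B \<in> ?A" if "\<And>m. m \<in> B \<Longrightarrow> f m \<in> ?A"
    for f and B :: "(nat \<times> nat) monomial set"
    using that
  proof (induction B rule: infinite_finite_induct)
    case (insert m B)
    have "f m \<in> ?A" "sum f B \<in> ?A" using insert by blast+
    then show ?case unfolding sum.insert[OF insert(1,2)] by (rule add)
  qed simp_all
  moreover have "Const (lookup F m) * mon_eval (plucker_poly n S) m \<in> ?A" if "m \<in> keys F" for m
    using mult[OF c mon] F that unfolding in_pring_iff by blast
  ultimately have "ev F \<in> ?A" by (simp only:)
  then show ?thesis using k by blast
qed

lemma single0_plus_eq_iff: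
  assumes "lookup b 0 = 0" "lookup b' 0 = (0::nat)"
  shows "single 0 r + b = single 0 r' + b' \<longleftrightarrow> r = r' \<and> b = (b' :: nat monomial)"
proof
  assume eq: "single 0 r + b = single 0 r' + b'"
  have "lookup (single 0 r + b) 0 = lookup (single 0 r' + b') 0" by (simp only: eq)
  then have "r = r'" using assms by (simp add: lookup_add)
  then show "r = r' \<and> b = b'" using eq by simp
qed simp

lemma tv_lookup_0: "lookup (tv m) 0 = 0"
  using tv_index[of m] in_keys_iff[of 0 "tv m"] by fastforce

text \<open>
  Reduce to standard monomials: the value is the exponent of one of them, and its degree is read
  off from the power of \<open>Var 0\<close>.
\<close>

lemma lead_ev:
  assumes F: "F \<in> carrier (pring n)" "homogeneous r F" "F \<notin> plucker_ideal n"
  shows "\<exists>m\<in>monomials n. total_degree m = r \<and> (\<exists>c. order.lead (ev F) (tv m) c)"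
proof -
  obtain m c where m: "m \<in> monomials n" "order.lead (tm.phi F) (tm.vh m) c" using tm.lead_phi[OF F(1,3)] by blast
  have "ev F \<noteq> 0" using ev_eq_0_iff F by blast
  then obtain b c' where b: "order.lead (ev F) b c'" using order.lead_exists by blast
  have "order.lead (tm.phi F) (single 0 r + b) (1 * c')"
    unfolding phi_homogeneous[OF F(2)] by (rule order.lead_mult[OF lead_Var0_power b])
  then have eq: "single 0 (total_degree m) + tv m = single 0 r + b"
    using order.lead_unique[OF m(2)] tm_vh by metis
  have "lookup b 0 = 0"
    using ev_keys[OF F(1) order.lead_in_keys[OF b]] in_keys_iff[of 0 b] by fastforce
  then have "total_degree m = r" "b = tv m" using eq single0_plus_eq_iff[OF tv_lookup_0] by metis+
  then show ?thesis using m b by blast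
qed

lemma lead_ev_monomial:
  assumes m: "m \<in> monomials n" and c: "c \<noteq> 0"
  shows "order.lead (ev (single m c)) (tv m) (c * tm.eps m)"
proof -
  have hom: "homogeneous (total_degree m) (single m c)" by (simp add: homogeneous_def)
  have F: "single m c \<in> carrier (pring n)" by (rule pring_single[OF m])
  have lead: "order.lead (tm.phi (single m c)) (tm.vh m) (c * tm.eps m)" by (rule tm.lead_phi_monomial[OF m c])
  have "ev (single m c) \<noteq> 0"
    using lead order.lead_nonzero phi_homogeneous[OF hom] by fastforce
  then obtain b c' where b: "order.lead (ev (single m c)) b c'" using order.lead_exists by blast
  have "order.lead (tm.phi (single m c)) (single 0 (total_degree m) + b) (1 * c')"
    unfolding phi_homogeneous[OF hom] by (rule order.lead_mult[OF lead_Var0_power b])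
  then have "tm.vh m = single 0 (total_degree m) + b \<and> c * tm.eps m = c'" using order.lead_unique[OF lead] by simp
  then have "b = tv m" "c' = c * tm.eps m" unfolding tm_vh by auto
  then show ?thesis using b by simp
qed

lemma exponents_zmap: "exponents G = zmap ` keys G"
  by (simp add: exponents_def zmap_def[abs_def])

lemma val_eqI:
  assumes F: "F \<in> carrier (pring n)" and lead: "order.lead (ev F) b c"
  shows "val n S (quot F) = zmap b"
  unfolding val_def class_subst_quot[OF F] exponents_zmap
proof (rule the_equality)
  show 1: "zmap b \<in> zmap ` keys (ev F) \<and> (\<forall>a\<in>zmap ` keys (ev F). a \<noteq> zmap b \<longrightarrow> prec S (zmap b) a)"
    using order.lead_in_keys[OF lead] order.lead_lt[OF lead] zmap_inj by (auto simp: lt_def)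
  fix a assume a: "a \<in> zmap ` keys (ev F) \<and> (\<forall>b\<in>zmap ` keys (ev F). b \<noteq> a \<longrightarrow> prec S a b)"
  show "a = zmap b"
  proof (rule ccontr)
    assume ne: "a \<noteq> zmap b"
    have "prec S a (zmap b)" using a 1 ne by (metis (no_types, lifting))
    moreover have "prec S (zmap b) a" using a 1 ne by (metis (no_types, lifting))
    ultimately show False using prec_trans prec_irrefl by metis
  qed
qed

definition \<Gamma> :: "(nat \<times> (nat \<Rightarrow>\<^sub>0 int)) set" where
  "\<Gamma> = (\<lambda>m. (total_degree m, zmap (tv m))) ` monomials n"

lemma quot_neq_zero: "F \<in> carrier (pring n) \<Longrightarrow> quot F \<noteq> \<zero>\<^bsub>grass_ring n\<^esub> \<longleftrightarrow> F \<notin> plucker_ideal n"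
  unfolding zero_grass by (simp add: quot_eq_iff)

lemma value_semigroup_eq: "value_semigroup n S = \<Gamma>"
proof
  show "value_semigroup n S \<subseteq> \<Gamma>"
  proof
    fix x assume "x \<in> value_semigroup n S"
    then obtain r F where x: "x = (r, val n S (quot F))" and F: "F \<in> carrier (pring n)" "homogeneous r F"
      "quot F \<noteq> \<zero>\<^bsub>grass_ring n\<^esub>" unfolding value_semigroup_def component_quot by blast
    then obtain m c where m: "m \<in> monomials n" "total_degree m = r" "order.lead (ev F) (tv m) c"
      using lead_ev[OF F(1,2)] quot_neq_zero[OF F(1)] by blast
    show "x \<in> \<Gamma>" unfolding x val_eqI[OF F(1) m(3)] \<Gamma>_def using m(1,2) by blast
  qed
  show "\<Gamma> \<subseteq> value_semigroup n S"
  proof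
    fix x assume "x \<in> \<Gamma>"
    then obtain m where m: "m \<in> monomials n" "x = (total_degree m, zmap (tv m))" by (auto simp: \<Gamma>_def)
    let ?F = "single m (1::complex)"
    have F: "?F \<in> carrier (pring n)" "homogeneous (total_degree m) ?F"
      using pring_single[OF m(1)] by (auto simp: homogeneous_def)
    have lead: "order.lead (ev ?F) (tv m) (1 * tm.eps m)" by (rule lead_ev_monomial[OF m(1)]) simp
    have "quot ?F \<noteq> \<zero>\<^bsub>grass_ring n\<^esub>"
      using quot_neq_zero[OF F(1)] ev_plucker_ideal[of ?F] order.lead_nonzero[OF lead] by blast
    then show "x \<in> value_semigroup n S"
      unfolding value_semigroup_def component_quot m(2) using F val_eqI[OF F(1) lead] by force
  qed
qed

lemma \<Gamma>_add: assumes "u \<in> \<Gamma>" "v \<in> \<Gamma>" shows "u + v \<in> \<Gamma>"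
proof -
  obtain m m' where m: "m \<in> monomials n" "m' \<in> monomials n" "u = (total_degree m, zmap (tv m))" "v = (total_degree m', zmap (tv m'))"
    using assms unfolding \<Gamma>_def by blast
  have "u + v = (total_degree (m + m'), zmap (tv (m + m')))"
    unfolding m(3,4) by (simp add: total_degree_add tv_def mon_sum_add zmap_add)
  then show ?thesis unfolding \<Gamma>_def using monomials_add[OF m(1,2)] by blast
qed

lemma zmap_0 [simp]: "zmap 0 = 0"
  by (rule poly_mapping_eqI) simp

lemma tv_Var: "tv (single p 1) = texp (fst p) (snd p)"
  by (simp add: tv_def)

lemma val_pbar: assumes "p \<in> pairs n" shows "val n S (pbar n p) = zmap (texp (fst p) (snd p))"
proof -
  have m: "single p 1 \<in> monomials n" using assms by simp
  have "pbar n p = quot (Var p)" by (simp add: pbar_def quot_def)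
  moreover have "Var p \<in> carrier (pring n)" unfolding Var_def by (rule pring_single[OF m])
  moreover have "order.lead (ev (Var p)) (tv (single p 1)) (1 * tm.eps (single p 1))"
    unfolding Var_def by (rule lead_ev_monomial[OF m]) simp
  ultimately show ?thesis using val_eqI tv_Var by metis
qed

lemma value_semigroup_generated:
  "value_semigroup n S = submonoid_closed hull ((\<lambda>p. (1, val n S (pbar n p))) ` pairs n)"
  unfolding value_semigroup_eq
proof (rule hull_unique[symmetric])
  show "(\<lambda>p. (1, val n S (pbar n p))) ` pairs n \<subseteq> \<Gamma>"
  proof (rule image_subsetI)
    fix p assume p: "p \<in> pairs n"
    have "(1, val n S (pbar n p)) = (total_degree (single p 1), zmap (tv (single p 1)))"
      using val_pbar[OF p] tv_Var by simp
    moreover have "single p 1 \<in> monomials n" using p by simp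
    ultimately show "(1, val n S (pbar n p)) \<in> \<Gamma>" unfolding \<Gamma>_def by (rule image_eqI)
  qed
  have "0 = (total_degree 0, zmap (tv 0))" by (simp add: tv_def zero_prod_def)
  then have "0 \<in> \<Gamma>" unfolding \<Gamma>_def by (rule image_eqI) simp
  then show "submonoid_closed \<Gamma>" unfolding submonoid_closed_def using \<Gamma>_add by blast
next
  fix T :: "(nat \<times> (nat \<Rightarrow>\<^sub>0 int)) set"
  assume T: "(\<lambda>p. (1, val n S (pbar n p))) ` pairs n \<subseteq> T" "submonoid_closed T"
  have "(total_degree m, zmap (tv m)) \<in> T" if "m \<in> monomials n" for m
    using that
  proof (induction m rule: monomial_induct)
    case zero
    have "(0::nat, 0 :: nat \<Rightarrow>\<^sub>0 int) = 0" by (simp add: zero_prod_def)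
    then show ?case using T(2) by (simp add: tv_def submonoid_closed_def)
  next
    case (add p m')
    then have p: "p \<in> pairs n" by (auto simp: keys_add_nat)
    have "m' \<in> monomials n" using add by (auto simp: keys_add_nat)
    then have "(total_degree m', zmap (tv m')) \<in> T" using add by blast
    moreover have "(1, zmap (texp (fst p) (snd p))) \<in> T" using T(1) p val_pbar[OF p] by force
    ultimately have "(1, zmap (texp (fst p) (snd p))) + (total_degree m', zmap (tv m')) \<in> T"
      using T(2) unfolding submonoid_closed_def by blast
    then show ?case by (simp add: total_degree_add tv_def mon_sum_add zmap_add)
  qed
  then show "\<Gamma> \<subseteq> T" unfolding \<Gamma>_def by blast
qed

end

section \<open>The associated graded algebra is a semigroup algebra\<close>

lemma lookup_mult_sum:
  fixes F G :: "'a::comm_monoid_add \<Rightarrow>\<^sub>0 'b::comm_semiring_1"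
  shows "lookup (F * G) m = (\<Sum>(a, b)\<in>keys F \<times> keys G. lookup F a * lookup G b when a + b = m)"
proof -
  have "F * G = (\<Sum>a\<in>keys F. single a (lookup F a)) * (\<Sum>b\<in>keys G. single b (lookup G b))"
    by (simp flip: poly_mapping_sum_single)
  also have "\<dots> = (\<Sum>(a, b)\<in>keys F \<times> keys G. single (a + b) (lookup F a * lookup G b))"
    by (simp add: sum_product mult_single sum.cartesian_product)
  finally show ?thesis by (simp add: lookup_sum lookup_single case_prod_unfold)
qed

lemma homogeneous_add: "homogeneous r F \<Longrightarrow> homogeneous r G \<Longrightarrow> homogeneous r (F + G)"
  using Poly_Mapping.keys_add[of F G] unfolding homogeneous_def by blast

lemma homogeneous_mult: "homogeneous r F \<Longrightarrow> homogeneous s G \<Longrightarrow> homogeneous (r + s) (F * G)"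
  using keys_mult[of F G] unfolding homogeneous_def by (force simp: total_degree_add)

lemma homogeneous_uminus: "homogeneous r F \<Longrightarrow> homogeneous r (- F)"
  by (simp add: homogeneous_def)

lemma homogeneous_0 [simp]: "homogeneous r 0"
  by (simp add: homogeneous_def)

context iterated_seq
begin

lemma ev_add: "ev (F + G) = ev F + ev G"
  by (simp add: ev_def poly_subst_add)
lemma ev_uminus: "ev (- F) = - ev F"
  by (simp add: ev_def poly_subst_uminus)
lemma ev_mult: "ev (F * G) = ev F * ev G"
  by (simp add: ev_def poly_subst_mult)

definition zinv :: "(nat \<Rightarrow>\<^sub>0 int) \<Rightarrow> nat monomial" where
  "zinv = Hilbert_Choice.inv zmap"

lemma zinv_zmap [simp]: "zinv (zmap b) = b"
  unfolding zinv_def by (rule inv_f_f) (simp add: inj_def zmap_inj)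

definition zcoeff :: "nat mpoly \<Rightarrow> (nat \<Rightarrow>\<^sub>0 int) \<Rightarrow> complex" where
  "zcoeff G a = (if a \<in> range zmap then lookup G (zinv a) else 0)"

lemma zcoeff_zmap [simp]: "zcoeff G (zmap b) = lookup G b"
  by (simp add: zcoeff_def)

lemma zcoeff_add: "zcoeff (F + G) a = zcoeff F a + zcoeff G a"
  by (simp add: zcoeff_def lookup_add)

lemma zcoeff_uminus: "zcoeff (- F) a = - zcoeff F a"
  by (simp add: zcoeff_def)

lemma zcoeff_zero: "(\<And>k. k \<in> keys G \<Longrightarrow> zmap k \<noteq> a) \<Longrightarrow> zcoeff G a = 0"
  unfolding zcoeff_def by (metis imageE in_keys_iff zinv_zmap)

lemma zcoeff_nonzero: "zcoeff G a \<noteq> 0 \<Longrightarrow> \<exists>k\<in>keys G. zmap k = a"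
  using zcoeff_zero by blast

text \<open>
  Representatives of the filtration pieces, stratified by the coefficient at the value \<open>snd u\<close>: all of
  them together represent the elements of value at least \<open>snd u\<close> in degree \<open>fst u\<close>, and those with
  \<open>c = 0\<close> the elements of larger value.
\<close>

definition X :: "nat \<times> (nat \<Rightarrow>\<^sub>0 int) \<Rightarrow> complex \<Rightarrow> (nat \<times> nat) mpoly set" where
  "X u c = {F \<in> carrier (pring n). homogeneous (fst u) F \<and>
    (\<forall>k\<in>keys (ev F). zmap k = snd u \<or> prec S (snd u) (zmap k)) \<and> zcoeff (ev F) (snd u) = c}"

text \<open>
  By \<open>cs_coset\<close> below these are the elements of the graded piece at \<open>u\<close>, so that the piece is
  coordinatised by the coefficient \<open>c\<close>.
\<close>

definition cs :: "nat \<times> (nat \<Rightarrow>\<^sub>0 int) \<Rightarrow> complex \<Rightarrow> (nat \<times> nat) mpoly set set" where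
  "cs u c = quot ` X u c"

lemma X_0: "0 \<in> X u 0"
  by (simp add: X_def ev_def zcoeff_def)

lemma X_add: assumes "F \<in> X u c" "G \<in> X u d" shows "F + G \<in> X u (c + d)"
proof -
  have "\<forall>k\<in>keys (ev F + ev G). zmap k = snd u \<or> prec S (snd u) (zmap k)"
    using Poly_Mapping.keys_add[of "ev F" "ev G"] assms unfolding X_def by blast
  then show ?thesis using assms by (auto simp: X_def homogeneous_add ev_add zcoeff_add)
qed

lemma X_uminus: "F \<in> X u c \<Longrightarrow> - F \<in> X u (- c)"
  by (auto simp: X_def homogeneous_uminus ev_uminus zcoeff_uminus)

lemma X_diff: "F \<in> X u c \<Longrightarrow> G \<in> X u d \<Longrightarrow> F - G \<in> X u (c - d)"
  using X_add[of F u c "- G" "- d"] X_uminus by fastforce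

lemma X_lead:
  assumes "F \<in> X u c" "c \<noteq> 0" shows "\<exists>k. zmap k = snd u \<and> order.lead (ev F) k c"
proof -
  obtain k where k: "k \<in> keys (ev F)" "zmap k = snd u" using zcoeff_nonzero[of "ev F" "snd u"] assms by (auto simp: X_def)
  have "order.lead (ev F) k (lookup (ev F) k)"
  proof (rule order.leadI[OF k(1)])
    fix l assume l: "l \<in> keys (ev F)" "l \<noteq> k"
    then have "zmap l \<noteq> snd u" using k(2) zmap_inj by metis
    then show "lt k l" using l assms(1) k(2) unfolding X_def lt_def by auto
  qed
  moreover have "lookup (ev F) k = c" using assms(1) zcoeff_zmap[of "ev F" k] unfolding k(2) by (simp add: X_def)
  ultimately show ?thesis using k(2) by blast
qed

lemma X_above:
  assumes "F \<in> X u 0" "k \<in> keys (ev F)" shows "prec S (snd u) (zmap k)"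
proof -
  have "zmap k \<noteq> snd u"
  proof
    assume "zmap k = snd u"
    then have "lookup (ev F) k = 0" using assms(1) zcoeff_zmap[of "ev F" k] by (simp add: X_def)
    then show False using assms(2) by (simp add: in_keys_iff)
  qed
  then show ?thesis using assms by (auto simp: X_def)
qed

lemma prec_add_both: "prec S a b \<Longrightarrow> prec S c d \<Longrightarrow> prec S (a + c) (b + d)"
  using prec_add[of a b c] prec_add[of c d b] prec_trans by (metis add.commute)

lemma prec_add_left: "prec S a b \<Longrightarrow> prec S (c + a) (c + b)"
  using prec_add[of a b c] by (simp add: add.commute)

lemma X_mult: assumes F: "F \<in> X u c" and G: "G \<in> X v d" shows "F * G \<in> X (u + v) (c * d)"
proof -
  have ge: "zmap k = snd u \<or> prec S (snd u) (zmap k)" if "k \<in> keys (ev F)" for k using F that by (auto simp: X_def)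
  have ge': "zmap k = snd v \<or> prec S (snd v) (zmap k)" if "k \<in> keys (ev G)" for k using G that by (auto simp: X_def)
  have key: "\<exists>a b. k = a + b \<and> a \<in> keys (ev F) \<and> b \<in> keys (ev G)" if "k \<in> keys (ev F * ev G)" for k
    using keys_mult[of "ev F" "ev G"] that by blast
  have 1: "zmap k = snd (u + v) \<or> prec S (snd (u + v)) (zmap k)" if k: "k \<in> keys (ev F * ev G)" for k
  proof -
    obtain a b where ab: "k = a + b" "a \<in> keys (ev F)" "b \<in> keys (ev G)" using key[OF k] by blast
    show ?thesis unfolding ab(1) zmap_add snd_add
      using ge[OF ab(2)] ge'[OF ab(3)] prec_add_both prec_add prec_add_left by metis
  qed
  have 2: "zcoeff (ev F * ev G) (snd (u + v)) = c * d"
  proof (cases "c = 0 \<or> d = 0")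
    case True
    have "zmap k \<noteq> snd (u + v)" if k: "k \<in> keys (ev F * ev G)" for k
    proof -
      obtain a b where ab: "k = a + b" "a \<in> keys (ev F)" "b \<in> keys (ev G)" using key[OF k] by blast
      have "prec S (snd u + snd v) (zmap a + zmap b)"
        using True
      proof
        assume "c = 0"
        then have "prec S (snd u) (zmap a)" using X_above F ab(2) by blast
        then show ?thesis using ge'[OF ab(3)] prec_add_both prec_add by metis
      next
        assume "d = 0"
        then have "prec S (snd v) (zmap b)" using X_above G ab(3) by blast
        then show ?thesis using ge[OF ab(2)] prec_add_both prec_add_left by metis
      qed
      then show ?thesis unfolding ab(1) zmap_add snd_add using prec_irrefl by metis
    qed
    then have "zcoeff (ev F * ev G) (snd (u + v)) = 0" by (rule zcoeff_zero)
    then show ?thesis using True by auto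
  next
    case False
    then obtain k l where k: "zmap k = snd u" "order.lead (ev F) k c" and l: "zmap l = snd v" "order.lead (ev G) l d"
      using X_lead F G by blast
    have "lookup (ev F * ev G) (k + l) = c * d" by (rule order.lead_lookup[OF order.lead_mult[OF k(2) l(2)]])
    moreover have "snd (u + v) = zmap (k + l)" by (simp add: zmap_add k l)
    ultimately show ?thesis by simp
  qed
  show ?thesis using F G 1 2 by (auto simp: X_def homogeneous_mult ev_mult)
qed

lemma X_monomial: assumes "m \<in> monomials n" shows "single m (c / tm.eps m) \<in> X (total_degree m, zmap (tv m)) c"
proof (cases "c = 0")
  case True
  then show ?thesis using X_0 by simp
next
  case False
  let ?F = "single m (c / tm.eps m)"
  have e: "tm.eps m \<noteq> 0" by (rule tm.eps_nonzero[OF assms])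
  have lead: "order.lead (ev ?F) (tv m) (c / tm.eps m * tm.eps m)"
    using False e by (intro lead_ev_monomial[OF assms]) simp
  have "zmap k = zmap (tv m) \<or> prec S (zmap (tv m)) (zmap k)" if "k \<in> keys (ev ?F)" for k
    using order.lead_lt[OF lead that] by (auto simp: lt_def)
  then show ?thesis using order.lead_lookup[OF lead] e pring_single[OF assms]
    by (simp add: X_def homogeneous_def)
qed

text \<open>
  So a graded piece is one-dimensional if its index is a value, and zero otherwise.
\<close>

lemma X_nonempty_iff: "X u c \<noteq> {} \<longleftrightarrow> c = 0 \<or> u \<in> \<Gamma>"
proof
  assume "X u c \<noteq> {}"
  then obtain F where F: "F \<in> X u c" by blast
  show "c = 0 \<or> u \<in> \<Gamma>"
  proof (cases "c = 0")
    case False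
    obtain k where k: "zmap k = snd u" "order.lead (ev F) k c" using X_lead[OF F False] by blast
    have "F \<notin> plucker_ideal n" using ev_plucker_ideal[of F] order.lead_nonzero[OF k(2)] by blast
    then obtain m d where m: "m \<in> monomials n" "total_degree m = fst u" "order.lead (ev F) (tv m) d"
      using lead_ev[of F "fst u"] F by (auto simp: X_def)
    have "k = tv m" using order.lead_unique[OF k(2) m(3)] by blast
    then have "u = (total_degree m, zmap (tv m))" using k(1) m(2) by (simp add: prod_eq_iff)
    then show ?thesis using m(1) unfolding \<Gamma>_def by blast
  qed simp
next
  assume "c = 0 \<or> u \<in> \<Gamma>"
  then show "X u c \<noteq> {}" using X_0 X_monomial unfolding \<Gamma>_def by blast
qed

lemma quot_hom: "quot \<in> ring_hom (pring n) (grass_ring n)"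
proof -
  have "(+>\<^bsub>pring n\<^esub>) (plucker_ideal n) \<in> ring_hom (pring n) (grass_ring n)"
    unfolding grass_ring_def by (rule ideal.rcos_ring_hom[OF ideal_plucker])
  moreover have "quot = (+>\<^bsub>pring n\<^esub>) (plucker_ideal n)" by (rule ext) (simp add: quot_def)
  ultimately show ?thesis by simp
qed

lemma quot_add: "F \<in> carrier (pring n) \<Longrightarrow> G \<in> carrier (pring n) \<Longrightarrow> quot F \<oplus>\<^bsub>grass_ring n\<^esub> quot G = quot (F + G)"
  using ring_hom_add[OF quot_hom, of F G] by simp

lemma quot_mult: "F \<in> carrier (pring n) \<Longrightarrow> G \<in> carrier (pring n) \<Longrightarrow> quot F \<otimes>\<^bsub>grass_ring n\<^esub> quot G = quot (F * G)"
  using ring_hom_mult[OF quot_hom, of F G] by simp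

lemma one_grass: "\<one>\<^bsub>grass_ring n\<^esub> = quot 1"
  using ring_hom_one[OF quot_hom] by simp

lemma X_carrier: "F \<in> X u c \<Longrightarrow> F \<in> carrier (pring n)"
  by (simp add: X_def)

text \<open>
  The coefficient at the value depends only on the residue class, because elements of the
  Pluecker ideal evaluate to zero.
\<close>

lemma cs_inj: assumes "X u c \<noteq> {}" "cs u c = cs u d" shows "c = d"
proof -
  obtain F where F: "F \<in> X u c" using assms by blast
  then obtain G where G: "G \<in> X u d" "quot F = quot G" using assms(2) unfolding cs_def by blast
  have "ev F = ev G" using class_subst_quot[OF X_carrier[OF F]] class_subst_quot[OF X_carrier[OF G(1)]] G(2) by simp
  then show ?thesis using F G(1) by (simp add: X_def)
qed

lemma filt_ge_eq: "filt_ge n S u = (\<Union>c. cs u c)"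
proof
  show "filt_ge n S u \<subseteq> (\<Union>c. cs u c)"
  proof
    fix f assume f: "f \<in> filt_ge n S u"
    show "f \<in> (\<Union>c. cs u c)"
    proof (cases "f = quot 0")
      case True
      then show ?thesis using X_0 unfolding cs_def by blast
    next
      case False
      then obtain F where F: "f = quot F" "F \<in> carrier (pring n)" "homogeneous (fst u) F"
        and le: "snd u = val n S f \<or> prec S (snd u) (val n S f)"
        using f by (auto simp: filt_ge_def zero_grass component_quot case_prod_unfold)
      have "F \<notin> plucker_ideal n" using False F quot_neq_zero[OF F(2)] by (simp add: zero_grass)
      then obtain m c where m: "order.lead (ev F) (tv m) c" using lead_ev[OF F(2,3)] by blast
      have v: "val n S f = zmap (tv m)" unfolding F(1) by (rule val_eqI[OF F(2) m])
      have "zmap k = snd u \<or> prec S (snd u) (zmap k)" if k: "k \<in> keys (ev F)" for k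
      proof (cases "k = tv m")
        case True then show ?thesis using le v by auto
      next
        case False
        then have "prec S (zmap (tv m)) (zmap k)" using order.lead_lt[OF m k] by (simp add: lt_def)
        then show ?thesis using le v prec_trans by metis
      qed
      then have "F \<in> X u (zcoeff (ev F) (snd u))" using F by (simp add: X_def)
      then show ?thesis unfolding F(1) cs_def by blast
    qed
  qed
  show "(\<Union>c. cs u c) \<subseteq> filt_ge n S u"
  proof
    fix f assume "f \<in> (\<Union>c. cs u c)"
    then obtain c F where F: "f = quot F" "F \<in> X u c" unfolding cs_def by blast
    then have Fc: "F \<in> carrier (pring n)" "homogeneous (fst u) F" by (auto simp: X_def)
    show "f \<in> filt_ge n S u"
    proof (cases "f = \<zero>\<^bsub>grass_ring n\<^esub>")
      case True
      then show ?thesis by (simp add: filt_ge_def case_prod_unfold)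
    next
      case False
      then obtain m c' where m: "order.lead (ev F) (tv m) c'" using lead_ev[OF Fc] quot_neq_zero[OF Fc(1)] F(1) by blast
      have "zmap (tv m) = snd u \<or> prec S (snd u) (zmap (tv m))"
        using F(2) order.lead_in_keys[OF m] by (auto simp: X_def)
      then have "snd u = val n S f \<or> prec S (snd u) (val n S f)"
        unfolding F(1) val_eqI[OF Fc(1) m] by auto
      then show ?thesis using False Fc F(1) by (auto simp: filt_ge_def case_prod_unfold component_quot)
    qed
  qed
qed

lemma filt_gt_eq: "filt_gt n S u = cs u 0"
proof
  show "filt_gt n S u \<subseteq> cs u 0"
  proof
    fix f assume f: "f \<in> filt_gt n S u"
    show "f \<in> cs u 0"
    proof (cases "f = quot 0")
      case True
      then show ?thesis using X_0 unfolding cs_def by blast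
    next
      case False
      then obtain F where F: "f = quot F" "F \<in> carrier (pring n)" "homogeneous (fst u) F"
        and le: "prec S (snd u) (val n S f)"
        using f by (auto simp: filt_gt_def zero_grass component_quot case_prod_unfold)
      have "F \<notin> plucker_ideal n" using False F quot_neq_zero[OF F(2)] by (simp add: zero_grass)
      then obtain m c where m: "order.lead (ev F) (tv m) c" using lead_ev[OF F(2,3)] by blast
      have v: "val n S f = zmap (tv m)" unfolding F(1) by (rule val_eqI[OF F(2) m])
      have pr: "prec S (snd u) (zmap k)" if k: "k \<in> keys (ev F)" for k
      proof (cases "k = tv m")
        case True then show ?thesis using le v by auto
      next
        case False
        then have "prec S (zmap (tv m)) (zmap k)" using order.lead_lt[OF m k] by (simp add: lt_def)
        then show ?thesis using le v prec_trans by metis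
      qed
      then have "zcoeff (ev F) (snd u) = 0" using prec_irrefl by (intro zcoeff_zero) metis
      then have "F \<in> X u 0" using F pr by (simp add: X_def)
      then show ?thesis unfolding F(1) cs_def by blast
    qed
  qed
  show "cs u 0 \<subseteq> filt_gt n S u"
  proof
    fix f assume "f \<in> cs u 0"
    then obtain F where F: "f = quot F" "F \<in> X u 0" unfolding cs_def by blast
    then have Fc: "F \<in> carrier (pring n)" "homogeneous (fst u) F" by (auto simp: X_def)
    show "f \<in> filt_gt n S u"
    proof (cases "f = \<zero>\<^bsub>grass_ring n\<^esub>")
      case True
      then show ?thesis by (simp add: filt_gt_def case_prod_unfold)
    next
      case False
      then obtain m c' where m: "order.lead (ev F) (tv m) c'" using lead_ev[OF Fc] quot_neq_zero[OF Fc(1)] F(1) by blast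
      have "prec S (snd u) (zmap (tv m))" by (rule X_above[OF F(2) order.lead_in_keys[OF m]])
      then have "prec S (snd u) (val n S f)" unfolding F(1) val_eqI[OF Fc(1) m] .
      then show ?thesis using False Fc F(1) by (auto simp: filt_gt_def case_prod_unfold component_quot)
    qed
  qed
qed

lemma cs_coset: assumes F: "F \<in> X u c" shows "filt_gt n S u +>\<^bsub>grass_ring n\<^esub> quot F = cs u c"
proof -
  have "filt_gt n S u +>\<^bsub>grass_ring n\<^esub> quot F = (\<lambda>G. quot G \<oplus>\<^bsub>grass_ring n\<^esub> quot F) ` X u 0"
    unfolding filt_gt_eq cs_def a_r_coset_def' by blast
  also have "\<dots> = (\<lambda>G. quot (G + F)) ` X u 0"
    using quot_add[OF X_carrier X_carrier[OF F]] by (intro image_cong[OF refl]) blast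
  also have "\<dots> = cs u c"
  proof
    show "(\<lambda>G. quot (G + F)) ` X u 0 \<subseteq> cs u c" unfolding cs_def using X_add[OF _ F, of _ 0] by auto
    show "cs u c \<subseteq> (\<lambda>G. quot (G + F)) ` X u 0"
    proof
      fix f assume "f \<in> cs u c"
      then obtain G where "G \<in> X u c" "f = quot G" unfolding cs_def by blast
      then have "G - F \<in> X u 0" "f = quot ((G - F) + F)" using X_diff[OF _ F, of G c] by auto
      then show "f \<in> (\<lambda>G. quot (G + F)) ` X u 0" by blast
    qed
  qed
  finally show ?thesis .
qed

lemma piece_carrier: "carrier (gr_piece n S u) = {cs u c | c. X u c \<noteq> {}}"
proof -
  have "carrier (gr_piece n S u) = (\<lambda>f. filt_gt n S u +>\<^bsub>grass_ring n\<^esub> f) ` filt_ge n S u"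
    by (auto simp: gr_piece_def A_FactGroup_def' A_RCOSETS_def' a_r_coset_def')
  also have "\<dots> = {cs u c | c. X u c \<noteq> {}}"
  proof (intro equalityI subsetI)
    fix A assume "A \<in> (\<lambda>f. filt_gt n S u +>\<^bsub>grass_ring n\<^esub> f) ` filt_ge n S u"
    then obtain c F where F: "F \<in> X u c" "A = filt_gt n S u +>\<^bsub>grass_ring n\<^esub> quot F"
      unfolding filt_ge_eq cs_def by blast
    have "A = cs u c" unfolding F(2) by (rule cs_coset[OF F(1)])
    then show "A \<in> {cs u c | c. X u c \<noteq> {}}" using F(1) by blast
  next
    fix A assume "A \<in> {cs u c | c. X u c \<noteq> {}}"
    then obtain c F where F: "A = cs u c" "F \<in> X u c" by blast
    have "A = filt_gt n S u +>\<^bsub>grass_ring n\<^esub> quot F" unfolding F(1) by (rule cs_coset[OF F(2), symmetric])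
    moreover have "quot F \<in> filt_ge n S u" unfolding filt_ge_eq cs_def using F(2) by blast
    ultimately show "A \<in> (\<lambda>f. filt_gt n S u +>\<^bsub>grass_ring n\<^esub> f) ` filt_ge n S u" by (rule image_eqI)
  qed
  finally show ?thesis .
qed

lemma piece_mult:
  assumes "X u c \<noteq> {}" "X u d \<noteq> {}" shows "cs u c \<otimes>\<^bsub>gr_piece n S u\<^esub> cs u d = cs u (c + d)"
proof -
  have "cs u c \<otimes>\<^bsub>gr_piece n S u\<^esub> cs u d = {f \<oplus>\<^bsub>grass_ring n\<^esub> g | f g. f \<in> cs u c \<and> g \<in> cs u d}"
    unfolding gr_piece_def A_FactGroup_def' by (auto simp: set_add_def' )
  also have "\<dots> = cs u (c + d)"
  proof
    show "{f \<oplus>\<^bsub>grass_ring n\<^esub> g | f g. f \<in> cs u c \<and> g \<in> cs u d} \<subseteq> cs u (c + d)"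
    proof clarify
      fix f g assume "f \<in> cs u c" "g \<in> cs u d"
      then obtain F G where "F \<in> X u c" "G \<in> X u d" "f = quot F" "g = quot G" unfolding cs_def by blast
      then show "f \<oplus>\<^bsub>grass_ring n\<^esub> g \<in> cs u (c + d)" using X_add quot_add X_carrier unfolding cs_def by auto
    qed
    show "cs u (c + d) \<subseteq> {f \<oplus>\<^bsub>grass_ring n\<^esub> g | f g. f \<in> cs u c \<and> g \<in> cs u d}"
    proof
      fix h assume "h \<in> cs u (c + d)"
      then obtain H where H: "H \<in> X u (c + d)" "h = quot H" unfolding cs_def by blast
      obtain F where F: "F \<in> X u c" using assms by blast
      have D: "H - F \<in> X u d" using X_diff[OF H(1) F] by simp
      have "h = quot F \<oplus>\<^bsub>grass_ring n\<^esub> quot (H - F)" using quot_add[OF X_carrier[OF F] X_carrier[OF D]] H by simp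
      then show "h \<in> {f \<oplus>\<^bsub>grass_ring n\<^esub> g | f g. f \<in> cs u c \<and> g \<in> cs u d}" using F D unfolding cs_def by blast
    qed
  qed
  finally show ?thesis .
qed

lemma piece_one: "\<one>\<^bsub>gr_piece n S u\<^esub> = cs u 0"
  by (simp add: gr_piece_def A_FactGroup_def' filt_gt_eq)

lemma X_nonempty_0: "X u 0 \<noteq> {}"
  using X_0 by blast

lemma X_nonempty_add: "X u c \<noteq> {} \<Longrightarrow> X u d \<noteq> {} \<Longrightarrow> X u (c + d) \<noteq> {}"
  using X_add by blast

lemma piece_comm_group: "comm_group (gr_piece n S u)"
proof (rule comm_groupI)
  fix x y z assume "x \<in> carrier (gr_piece n S u)"
  then obtain c where x: "x = cs u c" "X u c \<noteq> {}" unfolding piece_carrier by blast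
  show "\<one>\<^bsub>gr_piece n S u\<^esub> \<otimes>\<^bsub>gr_piece n S u\<^esub> x = x"
    unfolding piece_one x(1) by (simp add: piece_mult[OF X_nonempty_0 x(2)])
  have "X u (- c) \<noteq> {}" using x(2) X_uminus by blast
  then show "\<exists>y\<in>carrier (gr_piece n S u). y \<otimes>\<^bsub>gr_piece n S u\<^esub> x = \<one>\<^bsub>gr_piece n S u\<^esub>"
    unfolding piece_one x(1) piece_carrier using piece_mult[of u "- c" c] x(2) by (intro bexI[of _ "cs u (- c)"]) auto
  assume "y \<in> carrier (gr_piece n S u)"
  then obtain d where y: "y = cs u d" "X u d \<noteq> {}" unfolding piece_carrier by blast
  show "x \<otimes>\<^bsub>gr_piece n S u\<^esub> y \<in> carrier (gr_piece n S u)"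
    unfolding x(1) y(1) piece_mult[OF x(2) y(2)] piece_carrier using X_nonempty_add[OF x(2) y(2)] by blast
  show "x \<otimes>\<^bsub>gr_piece n S u\<^esub> y = y \<otimes>\<^bsub>gr_piece n S u\<^esub> x"
    unfolding x(1) y(1) piece_mult[OF x(2) y(2)] piece_mult[OF y(2) x(2)] by (simp add: add.commute)
  assume "z \<in> carrier (gr_piece n S u)"
  then obtain e where z: "z = cs u e" "X u e \<noteq> {}" unfolding piece_carrier by blast
  show "x \<otimes>\<^bsub>gr_piece n S u\<^esub> y \<otimes>\<^bsub>gr_piece n S u\<^esub> z = x \<otimes>\<^bsub>gr_piece n S u\<^esub> (y \<otimes>\<^bsub>gr_piece n S u\<^esub> z)"
    unfolding x(1) y(1) z(1) piece_mult[OF x(2) y(2)] piece_mult[OF y(2) z(2)]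
      piece_mult[OF X_nonempty_add[OF x(2) y(2)] z(2)] piece_mult[OF x(2) X_nonempty_add[OF y(2) z(2)]]
    by (simp add: add.assoc)
next
  show "\<one>\<^bsub>gr_piece n S u\<^esub> \<in> carrier (gr_piece n S u)"
    unfolding piece_one piece_carrier using X_nonempty_0 by blast
qed

lemma piece_group: "group (gr_piece n S u)"
  using piece_comm_group by (rule comm_group.axioms)

lemma piece_finprod:
  assumes "finite A" "\<And>x. x \<in> A \<Longrightarrow> X u (f x) \<noteq> {}"
  shows "finprod (gr_piece n S u) (\<lambda>x. cs u (f x)) A = cs u (\<Sum>x\<in>A. f x) \<and> X u (\<Sum>x\<in>A. f x) \<noteq> {}"
  using assms
proof (induction A rule: finite_induct)
  case empty
  interpret comm_group "gr_piece n S u" by (rule piece_comm_group)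
  show ?case using X_nonempty_0 by (simp add: piece_one)
next
  case (insert x A)
  interpret comm_group "gr_piece n S u" by (rule piece_comm_group)
  have "finprod (gr_piece n S u) (\<lambda>x. cs u (f x)) (insert x A)
      = cs u (f x) \<otimes>\<^bsub>gr_piece n S u\<^esub> finprod (gr_piece n S u) (\<lambda>x. cs u (f x)) A"
    using insert by (intro finprod_insert) (auto simp: piece_carrier)
  then show ?case using insert piece_mult[of u "f x" "\<Sum>x\<in>A. f x"] X_nonempty_add[of u "f x" "\<Sum>x\<in>A. f x"] by simp
qed

lemma piece_rcoset_mult:
  assumes "X u c \<noteq> {}" "X v d \<noteq> {}"
  shows "rcoset_mult (grass_ring n) (filt_gt n S (u + v)) (cs u c) (cs v d) = cs (u + v) (c * d)"
proof -
  have "filt_gt n S (u + v) +>\<^bsub>grass_ring n\<^esub> (f \<otimes>\<^bsub>grass_ring n\<^esub> g) = cs (u + v) (c * d)"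
    if fg: "f \<in> cs u c" "g \<in> cs v d" for f g
  proof -
    obtain F G where FG: "F \<in> X u c" "G \<in> X v d" "f = quot F" "g = quot G" using fg unfolding cs_def by blast
    then show ?thesis using cs_coset[OF X_mult[OF FG(1,2)]] quot_mult X_carrier by simp
  qed
  moreover have "cs u c \<noteq> {}" "cs v d \<noteq> {}" using assms by (auto simp: cs_def)
  ultimately show ?thesis unfolding rcoset_mult_def by auto
qed

end

definition monomial_algebra :: "nat monomial set \<Rightarrow> nat mpoly ring" where
  "monomial_algebra M = \<lparr>carrier = {H. keys H \<subseteq> M}, mult = (*), one = 1, zero = 0, add = (+)\<rparr>"

lemma monomial_algebra_simps [simp]:
  "carrier (monomial_algebra M) = {H. keys H \<subseteq> M}"
  "F \<otimes>\<^bsub>monomial_algebra M\<^esub> G = F * G" "\<one>\<^bsub>monomial_algebra M\<^esub> = 1"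
  "\<zero>\<^bsub>monomial_algebra M\<^esub> = 0" "F \<oplus>\<^bsub>monomial_algebra M\<^esub> G = F + G"
  by (simp_all add: monomial_algebra_def)

lemma cring_monomial_algebra:
  assumes "0 \<in> M" and add: "\<And>a b. a \<in> M \<Longrightarrow> b \<in> M \<Longrightarrow> a + b \<in> M"
  shows "cring (monomial_algebra M)"
proof (rule cringI)
  have plus: "keys (F + G) \<subseteq> M" if "keys F \<subseteq> M" "keys G \<subseteq> M" for F G :: "nat mpoly"
    using Poly_Mapping.keys_add[of F G] that by blast
  have times: "keys (F * G) \<subseteq> M" if FG: "keys F \<subseteq> M" "keys G \<subseteq> M" for F G :: "nat mpoly"
  proof
    fix k assume "k \<in> keys (F * G)"
    then obtain a b where ab: "k = a + b" "a \<in> keys F" "b \<in> keys G" using keys_mult[of F G] by blast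
    then have "a \<in> M" "b \<in> M" using FG by blast+
    then show "k \<in> M" unfolding ab(1) by (rule add)
  qed
  show "abelian_group (monomial_algebra M)"
  proof (rule abelian_groupI)
    fix F assume "F \<in> carrier (monomial_algebra M)"
    then show "\<exists>G\<in>carrier (monomial_algebra M). G \<oplus>\<^bsub>monomial_algebra M\<^esub> F = \<zero>\<^bsub>monomial_algebra M\<^esub>"
      by (intro bexI[of _ "- F"]) auto
  qed (use plus in \<open>auto simp: algebra_simps\<close>)
  show "comm_monoid (monomial_algebra M)"
    by (rule comm_monoidI) (use times assms(1) in \<open>auto simp: algebra_simps\<close>)
qed (auto simp: algebra_simps)

definition degree_part :: "nat monomial set \<Rightarrow> nat \<Rightarrow> nat mpoly set" where
  "degree_part M r = {H. keys H \<subseteq> M \<and> (\<forall>k\<in>keys H. lookup k 0 = r)}"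

context iterated_seq
begin

abbreviation SA :: "nat mpoly ring" where
  "SA \<equiv> monomial_algebra (tm.vh ` monomials n)"

lemma cring_SA: "cring SA"
  by (rule cring_monomial_algebra[OF tm.vh_image_closed])

text \<open>
  Translates an index of the graded algebra into an exponent with degree, the inverse of
  reading off degree and value from a monomial.
\<close>

definition Mu :: "nat \<times> (nat \<Rightarrow>\<^sub>0 int) \<Rightarrow> nat monomial" where
  "Mu u = single 0 (fst u) + zinv (snd u)"

lemma Mu_monomial: "Mu (total_degree m, zmap (tv m)) = tm.vh m"
  by (simp add: Mu_def tm_vh)

lemma Mu_image: "Mu ` \<Gamma> = tm.vh ` monomials n"
  unfolding \<Gamma>_def image_image Mu_monomial ..

lemma Mu_lookup_0: "u \<in> \<Gamma> \<Longrightarrow> lookup (Mu u) 0 = fst u"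
  unfolding \<Gamma>_def by (auto simp: Mu_def lookup_add tv_lookup_0)

lemma Mu_inj: assumes "u \<in> \<Gamma>" "v \<in> \<Gamma>" "Mu u = Mu v" shows "u = v"
proof -
  obtain m m' where m: "u = (total_degree m, zmap (tv m))" "v = (total_degree m', zmap (tv m'))"
    using assms(1,2) unfolding \<Gamma>_def by blast
  have "single 0 (total_degree m) + tv m = single 0 (total_degree m') + tv m'"
    using assms(3) unfolding m Mu_monomial tm_vh .
  then show ?thesis unfolding m using single0_plus_eq_iff[OF tv_lookup_0 tv_lookup_0] by simp
qed

lemma Mu_add: assumes "u \<in> \<Gamma>" "v \<in> \<Gamma>" shows "Mu (u + v) = Mu u + Mu v"
proof -
  obtain m m' where m: "u = (total_degree m, zmap (tv m))" "v = (total_degree m', zmap (tv m'))"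
    using assms unfolding \<Gamma>_def by blast
  show ?thesis unfolding m by (simp add: Mu_def zmap_add[symmetric] single_add ac_simps)
qed

lemma \<Gamma>_0: "0 \<in> \<Gamma>"
  unfolding \<Gamma>_def by (rule image_eqI[of _ _ 0]) (simp_all add: tv_def zero_prod_def)

lemma Mu_0: "Mu 0 = 0"
  using Mu_monomial[of 0] by (simp add: tv_def zero_prod_def)

lemma \<Gamma>_index: "\<Gamma> \<subseteq> gr_index S"
proof
  fix u assume "u \<in> \<Gamma>"
  then obtain m where m: "u = (total_degree m, zmap (tv m))" unfolding \<Gamma>_def by blast
  have "keys (zmap (tv m)) = keys (tv m)" by (auto simp: in_keys_iff)
  then show "u \<in> gr_index S" using tv_index[of m] unfolding m gr_index_def lattice_Z_def by (simp add: length_iseq)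
qed

text \<open>
  The guard matters: \<open>zinv\<close> is arbitrary on vectors with negative entries, which \<open>Mu\<close> could
  send to the exponent of a monomial.
\<close>

definition hc :: "nat mpoly \<Rightarrow> nat \<times> (nat \<Rightarrow>\<^sub>0 int) \<Rightarrow> complex" where
  "hc H u = (if u \<in> \<Gamma> then lookup H (Mu u) else 0)"

lemma hc_\<Gamma>: "hc H u \<noteq> 0 \<Longrightarrow> u \<in> \<Gamma>"
  by (simp add: hc_def split: if_splits)

lemma hc_X: "X u (hc H u) \<noteq> {}"
  unfolding X_nonempty_iff by (simp add: hc_def)

lemma hc_add: "hc (F + G) u = hc F u + hc G u"
  by (simp add: hc_def lookup_add)

lemma hc_0 [simp]: "hc 0 u = 0"
  by (simp add: hc_def)

lemma hc_support_finite: "finite {u. hc H u \<noteq> 0}"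
proof -
  have "Mu ` {u. hc H u \<noteq> 0} \<subseteq> keys H" by (auto simp: hc_def in_keys_iff)
  then have "finite (Mu ` {u. hc H u \<noteq> 0})" by (rule finite_subset) simp
  moreover have "inj_on Mu {u. hc H u \<noteq> 0}"
    using hc_\<Gamma> Mu_inj by (intro inj_onI) blast
  ultimately show ?thesis by (rule finite_imageD)
qed

lemma hc_eqD:
  assumes "keys F \<subseteq> tm.vh ` monomials n" "keys G \<subseteq> tm.vh ` monomials n" "\<And>u. u \<in> \<Gamma> \<Longrightarrow> hc F u = hc G u"
  shows "F = G"
proof (rule poly_mapping_eqI)
  fix k show "lookup F k = lookup G k"
  proof (cases "k \<in> Mu ` \<Gamma>")
    case True
    then obtain u where "u \<in> \<Gamma>" "k = Mu u" by blast
    then show ?thesis using assms(3)[of u] by (simp add: hc_def)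
  next
    case False
    then have "k \<notin> keys F" "k \<notin> keys G" using assms(1,2) unfolding Mu_image by blast+
    then show ?thesis by (simp add: in_keys_iff)
  qed
qed

text \<open>
  The convolution product, with its exponents reindexed by pairs of indices of the graded
  algebra.  This matches the sum that defines the product there.
\<close>

lemma hc_mult:
  assumes F: "keys F \<subseteq> tm.vh ` monomials n" and G: "keys G \<subseteq> tm.vh ` monomials n"
  shows "hc (F * G) w = (\<Sum>(u, v)\<in>{(u, v). u + v = w \<and> hc F u \<noteq> 0 \<and> hc G v \<noteq> 0}. hc F u * hc G v)"
proof (cases "w \<in> \<Gamma>")
  case False
  then have empty: "{(u, v). u + v = w \<and> hc F u \<noteq> 0 \<and> hc G v \<noteq> 0} = {}"
    using \<Gamma>_add hc_\<Gamma> by blast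
  show ?thesis unfolding empty using False by (simp add: hc_def)
next
  case True
  let ?T = "{(u, v). u + v = w \<and> hc F u \<noteq> 0 \<and> hc G v \<noteq> 0}"
  let ?h = "\<lambda>(u, v). (Mu u, Mu v)"
  have T\<Gamma>: "u \<in> \<Gamma>" "v \<in> \<Gamma>" if "(u, v) \<in> ?T" for u v using that hc_\<Gamma> by blast+
  have inj: "inj_on ?h ?T"
  proof (rule inj_onI, clarify)
    fix a b c d assume "hc F a \<noteq> 0" "hc G b \<noteq> 0" "hc F c \<noteq> 0" "hc G d \<noteq> 0" "Mu a = Mu c" "Mu b = Mu d"
    then show "a = c \<and> b = d" using hc_\<Gamma> Mu_inj by blast
  qed
  have img: "?h ` ?T = {(k, l) \<in> keys F \<times> keys G. k + l = Mu w}"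
  proof
    show "?h ` ?T \<subseteq> {(k, l) \<in> keys F \<times> keys G. k + l = Mu w}"
    proof (rule image_subsetI)
      fix x assume "x \<in> ?T"
      then obtain u v where x: "x = (u, v)" and uv: "hc F u \<noteq> 0" "hc G v \<noteq> 0" "u + v = w" by blast
      have \<Gamma>: "u \<in> \<Gamma>" "v \<in> \<Gamma>" using uv hc_\<Gamma> by blast+
      then have "Mu u \<in> keys F" "Mu v \<in> keys G" using uv by (simp_all add: hc_def in_keys_iff)
      then show "?h x \<in> {(k, l) \<in> keys F \<times> keys G. k + l = Mu w}"
        using Mu_add[OF \<Gamma>] uv(3) by (simp add: x)
    qed
    show "{(k, l) \<in> keys F \<times> keys G. k + l = Mu w} \<subseteq> ?h ` ?T"
    proof (rule subsetI)
      fix x assume "x \<in> {(k, l) \<in> keys F \<times> keys G. k + l = Mu w}"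
      then obtain k l where x: "x = (k, l)" and kl: "k \<in> keys F" "l \<in> keys G" "k + l = Mu w" by blast
      have "k \<in> Mu ` \<Gamma>" "l \<in> Mu ` \<Gamma>" using kl F G unfolding Mu_image by blast+
      then obtain u v where uv: "u \<in> \<Gamma>" "k = Mu u" "v \<in> \<Gamma>" "l = Mu v" by blast
      have "u + v = w" using kl(3) uv Mu_inj[OF \<Gamma>_add[OF uv(1,3)] True] Mu_add[OF uv(1,3)] by simp
      moreover have "hc F u \<noteq> 0" "hc G v \<noteq> 0" using kl uv by (auto simp: hc_def in_keys_iff)
      ultimately have "(u, v) \<in> ?T" by simp
      moreover have "x = ?h (u, v)" by (simp add: x uv)
      ultimately show "x \<in> ?h ` ?T" by (rule image_eqI[rotated])
    qed
  qed
  have "hc (F * G) w = (\<Sum>(k, l)\<in>keys F \<times> keys G. lookup F k * lookup G l when k + l = Mu w)"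
    using True by (simp add: hc_def lookup_mult_sum)
  also have "\<dots> = (\<Sum>(k, l)\<in>{(k, l) \<in> keys F \<times> keys G. k + l = Mu w}. lookup F k * lookup G l)"
    by (rule sum.mono_neutral_cong_right) (auto simp: when_def split: if_splits)
  also have "\<dots> = (\<Sum>x\<in>?T. case ?h x of (k, l) \<Rightarrow> lookup F k * lookup G l)"
    unfolding img[symmetric] by (subst sum.reindex[OF inj]) simp
  also have "\<dots> = (\<Sum>(u, v)\<in>?T. hc F u * hc G v)"
  proof (rule sum.cong[OF refl])
    fix x assume "x \<in> ?T"
    then obtain u v where x: "x = (u, v)" and uv: "(u, v) \<in> ?T" by (cases x) blast
    show "(case ?h x of (k, l) \<Rightarrow> lookup F k * lookup G l) = (case x of (u, v) \<Rightarrow> hc F u * hc G v)"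
      unfolding x using T\<Gamma>(1)[OF uv] T\<Gamma>(2)[OF uv] by (simp add: hc_def)
  qed
  finally show ?thesis .
qed

definition Phi :: "nat mpoly \<Rightarrow> gr_elem" where
  "Phi H = (\<lambda>u\<in>gr_index S. cs u (hc H u))"

lemma gr_carrier: "carrier (gr_ring n S) = {g \<in> \<Pi>\<^sub>E u\<in>gr_index S. carrier (gr_piece n S u).
    finite {u \<in> gr_index S. g u \<noteq> \<one>\<^bsub>gr_piece n S u\<^esub>}}"
  unfolding gr_ring_def Let_def by (simp add: carrier_sum_group[OF piece_group])

lemma cs_eq_one_iff: "X u c \<noteq> {} \<Longrightarrow> cs u c = \<one>\<^bsub>gr_piece n S u\<^esub> \<longleftrightarrow> c = 0"
  unfolding piece_one using cs_inj by blast

lemma Phi_apply: "u \<in> gr_index S \<Longrightarrow> Phi H u = cs u (hc H u)"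
  by (simp add: Phi_def)

lemma Phi_one_iff: "u \<in> gr_index S \<Longrightarrow> Phi H u = \<one>\<^bsub>gr_piece n S u\<^esub> \<longleftrightarrow> hc H u = 0"
  using cs_eq_one_iff[OF hc_X] by (simp only: Phi_apply)

lemma Phi_carrier: "Phi H \<in> carrier (gr_ring n S)"
proof -
  have "{u \<in> gr_index S. Phi H u \<noteq> \<one>\<^bsub>gr_piece n S u\<^esub>} \<subseteq> {u. hc H u \<noteq> 0}"
    using Phi_one_iff by blast
  then have "finite {u \<in> gr_index S. Phi H u \<noteq> \<one>\<^bsub>gr_piece n S u\<^esub>}"
    using hc_support_finite finite_subset by blast
  moreover have "Phi H \<in> (\<Pi>\<^sub>E u\<in>gr_index S. carrier (gr_piece n S u))"
    unfolding Phi_def piece_carrier using hc_X by (intro restrict_PiE[THEN iffD2]) blast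
  ultimately show ?thesis unfolding gr_carrier by blast
qed

lemma gr_class_Phi:
  assumes u: "u \<in> \<Gamma>" and F: "F \<in> X u c"
  shows "gr_class n S u (quot F) = Phi (single (Mu u) c)"
  unfolding gr_class_def Phi_def
proof (rule restrict_ext)
  fix w assume "w \<in> gr_index S"
  have "hc (single (Mu u) c) w = (if w = u then c else 0)"
    using Mu_inj[OF u, of w] u by (auto simp: hc_def lookup_single when_def)
  then show "(if w = u then filt_gt n S u +>\<^bsub>grass_ring n\<^esub> quot F else \<one>\<^bsub>gr_piece n S w\<^esub>) = cs w (hc (single (Mu u) c) w)"
    using cs_coset[OF F] by (simp add: piece_one)
qed

lemma Const_X: "Const c \<in> X 0 c"
  using X_monomial[of 0 c] by (simp add: tv_def zero_prod_def tm.eps_def Const_def)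

lemma gr_one_Phi: "\<one>\<^bsub>gr_ring n S\<^esub> = Phi 1"
proof -
  have "\<one>\<^bsub>gr_ring n S\<^esub> = gr_class n S 0 (quot (Const 1))"
    by (simp add: gr_ring_def Let_def one_grass)
  also have "\<dots> = Phi (single (Mu 0) 1)" by (rule gr_class_Phi[OF \<Gamma>_0 Const_X])
  finally show ?thesis by (simp add: Mu_0)
qed

lemma gr_const_Phi: "gr_const n S c = Phi (Const c)"
proof -
  have "gr_const n S c = gr_class n S 0 (quot (Const c))" by (simp add: gr_const_def quot_const_def quot_def)
  also have "\<dots> = Phi (single (Mu 0) c)" by (rule gr_class_Phi[OF \<Gamma>_0 Const_X])
  finally show ?thesis by (simp add: Mu_0 Const_def)
qed

lemma gr_add_Phi: "Phi F \<oplus>\<^bsub>gr_ring n S\<^esub> Phi G = Phi (F + G)"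
proof -
  have "Phi F \<oplus>\<^bsub>gr_ring n S\<^esub> Phi G = (\<lambda>u\<in>gr_index S. Phi F u \<otimes>\<^bsub>gr_piece n S u\<^esub> Phi G u)"
    by (simp add: gr_ring_def Let_def)
  also have "\<dots> = Phi (F + G)"
    unfolding Phi_def[of "F + G"]
    by (rule restrict_ext) (simp add: Phi_apply piece_mult[OF hc_X hc_X] hc_add)
  finally show ?thesis .
qed

lemma gr_mult_Phi:
  assumes F: "keys F \<subseteq> tm.vh ` monomials n" and G: "keys G \<subseteq> tm.vh ` monomials n"
  shows "Phi F \<otimes>\<^bsub>gr_ring n S\<^esub> Phi G = Phi (F * G)"
proof -
  have "Phi F \<otimes>\<^bsub>gr_ring n S\<^esub> Phi G = (\<lambda>w\<in>gr_index S. finprod (gr_piece n S w)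
      (\<lambda>(u, v). rcoset_mult (grass_ring n) (filt_gt n S w) (Phi F u) (Phi G v))
      {(u, v). u \<in> gr_index S \<and> v \<in> gr_index S \<and> u + v = w \<and>
         Phi F u \<noteq> \<one>\<^bsub>gr_piece n S u\<^esub> \<and> Phi G v \<noteq> \<one>\<^bsub>gr_piece n S v\<^esub>})"
    by (simp add: gr_ring_def Let_def)
  also have "\<dots> = Phi (F * G)"
    unfolding Phi_def[of "F * G"]
  proof (rule restrict_ext)
    fix w assume w: "w \<in> gr_index S"
    let ?T = "{(u, v). u + v = w \<and> hc F u \<noteq> 0 \<and> hc G v \<noteq> 0}"
    have idx: "u \<in> gr_index S" if "hc H u \<noteq> 0" for H u
      using that \<Gamma>_index by (auto simp: hc_def split: if_splits)
    have T: "{(u, v). u \<in> gr_index S \<and> v \<in> gr_index S \<and> u + v = w \<and>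
         Phi F u \<noteq> \<one>\<^bsub>gr_piece n S u\<^esub> \<and> Phi G v \<noteq> \<one>\<^bsub>gr_piece n S v\<^esub>} = ?T"
      unfolding set_eq_iff mem_Collect_eq split_paired_All case_prod_conv using idx Phi_one_iff by blast
    have fin: "finite ?T"
      by (rule finite_subset[of _ "{u. hc F u \<noteq> 0} \<times> {u. hc G u \<noteq> 0}"]) (auto intro: hc_support_finite)
    have eq: "rcoset_mult (grass_ring n) (filt_gt n S w) (Phi F (fst x)) (Phi G (snd x)) = cs w (hc F (fst x) * hc G (snd x))"
      and ne: "X w (hc F (fst x) * hc G (snd x)) \<noteq> {}" if x: "x \<in> ?T" for x
    proof -
      have x': "fst x + snd x = w" "hc F (fst x) \<noteq> 0" "hc G (snd x) \<noteq> 0" using x by auto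
      show "rcoset_mult (grass_ring n) (filt_gt n S w) (Phi F (fst x)) (Phi G (snd x)) = cs w (hc F (fst x) * hc G (snd x))"
        using piece_rcoset_mult[of "fst x" "hc F (fst x)" "snd x" "hc G (snd x)", OF hc_X hc_X] x' idx by (simp add: Phi_apply)
      show "X w (hc F (fst x) * hc G (snd x)) \<noteq> {}"
        using X_mult[of _ "fst x" "hc F (fst x)" _ "snd x" "hc G (snd x)"] hc_X[of "fst x" F] hc_X[of "snd x" G] x'(1) by blast
    qed
    interpret comm_group "gr_piece n S w" by (rule piece_comm_group)
    have "finprod (gr_piece n S w) (\<lambda>(u, v). rcoset_mult (grass_ring n) (filt_gt n S w) (Phi F u) (Phi G v)) ?T
        = finprod (gr_piece n S w) (\<lambda>x. cs w (hc F (fst x) * hc G (snd x))) ?T"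
    proof (rule finprod_cong'[OF refl])
      show "(\<lambda>x. cs w (hc F (fst x) * hc G (snd x))) \<in> ?T \<rightarrow> carrier (gr_piece n S w)"
        unfolding piece_carrier using ne by blast
      show "(case x of (u, v) \<Rightarrow> rcoset_mult (grass_ring n) (filt_gt n S w) (Phi F u) (Phi G v)) = cs w (hc F (fst x) * hc G (snd x))"
        if "x \<in> ?T" for x using eq[OF that] by (simp add: case_prod_unfold)
    qed
    also have "\<dots> = cs w (\<Sum>x\<in>?T. hc F (fst x) * hc G (snd x))"
      by (rule conjunct1[OF piece_finprod[where f = "\<lambda>x. hc F (fst x) * hc G (snd x)", OF fin ne]])
    also have "(\<Sum>x\<in>?T. hc F (fst x) * hc G (snd x)) = hc (F * G) w"
      unfolding hc_mult[OF F G] by (simp add: case_prod_unfold)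
    finally show "finprod (gr_piece n S w) (\<lambda>(u, v). rcoset_mult (grass_ring n) (filt_gt n S w) (Phi F u) (Phi G v))
      {(u, v). u \<in> gr_index S \<and> v \<in> gr_index S \<and> u + v = w \<and>
         Phi F u \<noteq> \<one>\<^bsub>gr_piece n S u\<^esub> \<and> Phi G v \<noteq> \<one>\<^bsub>gr_piece n S v\<^esub>} = cs w (hc (F * G) w)"
      unfolding T .
  qed
  finally show ?thesis .
qed

lemma Phi_inj:
  assumes "keys F \<subseteq> tm.vh ` monomials n" "keys G \<subseteq> tm.vh ` monomials n" "Phi F = Phi G"
  shows "F = G"
proof (rule hc_eqD[OF assms(1,2)])
  fix u assume "u \<in> \<Gamma>"
  then have u: "u \<in> gr_index S" using \<Gamma>_index by blast
  have "cs u (hc F u) = cs u (hc G u)" using assms(3) Phi_apply[OF u] by metis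
  then show "hc F u = hc G u" by (rule cs_inj[OF hc_X])
qed

lemma Phi_surj:
  assumes "g \<in> carrier (gr_ring n S)" shows "\<exists>H. keys H \<subseteq> tm.vh ` monomials n \<and> Phi H = g"
proof -
  have g: "g \<in> (\<Pi>\<^sub>E u\<in>gr_index S. carrier (gr_piece n S u))" and fin: "finite {u \<in> gr_index S. g u \<noteq> \<one>\<^bsub>gr_piece n S u\<^esub>}"
    using assms unfolding gr_carrier by blast+
  let ?A = "{u \<in> gr_index S. g u \<noteq> \<one>\<^bsub>gr_piece n S u\<^esub>}"
  have "\<forall>u\<in>gr_index S. \<exists>c. X u c \<noteq> {} \<and> g u = cs u c"
  proof
    fix u assume "u \<in> gr_index S"
    then have "g u \<in> carrier (gr_piece n S u)" by (rule PiE_mem[OF g])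
    then show "\<exists>c. X u c \<noteq> {} \<and> g u = cs u c" unfolding piece_carrier by blast
  qed
  from bchoice[OF this] obtain c where c: "\<And>u. u \<in> gr_index S \<Longrightarrow> X u (c u) \<noteq> {} \<and> g u = cs u (c u)" by blast
  have A: "u \<in> ?A \<longleftrightarrow> c u \<noteq> 0" if "u \<in> gr_index S" for u
    using c[OF that] cs_eq_one_iff[of u "c u"] that by simp
  have A\<Gamma>: "u \<in> \<Gamma>" if "u \<in> ?A" for u
    using A[of u] c[of u] X_nonempty_iff[of u "c u"] that by blast
  define H where "H = (\<Sum>u\<in>?A. single (Mu u) (c u))"
  have "keys H \<subseteq> tm.vh ` monomials n"
  proof -
    have "keys H \<subseteq> (\<Union>u\<in>?A. keys (single (Mu u) (c u)))" unfolding H_def by (rule Poly_Mapping.keys_sum)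
    also have "\<dots> \<subseteq> Mu ` \<Gamma>" using A\<Gamma> by (auto split: if_splits)
    finally show ?thesis unfolding Mu_image .
  qed
  moreover have "hc H u = c u" if u: "u \<in> gr_index S" for u
  proof (cases "u \<in> \<Gamma>")
    case True
    have "lookup H (Mu u) = (\<Sum>v\<in>?A. if v = u then c v else 0)"
      unfolding H_def lookup_sum
    proof (rule sum.cong[OF refl])
      fix v assume "v \<in> ?A"
      then show "lookup (single (Mu v) (c v)) (Mu u) = (if v = u then c v else 0)"
        using Mu_inj[OF A\<Gamma> True, of v] by (auto simp: lookup_single when_def)
    qed
    also have "\<dots> = (if u \<in> ?A then c u else 0)" by (rule sum.delta[OF fin])
    also have "\<dots> = c u" using A[OF u] by simp
    finally show ?thesis using True by (simp add: hc_def)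
  next
    case False
    then have "c u = 0" using c[OF u] X_nonempty_iff by blast
    then show ?thesis using False by (simp add: hc_def)
  qed
  then have "Phi H = g"
    using c PiE_arb[OF g] by (intro ext) (simp add: Phi_def restrict_def)
  ultimately show ?thesis by blast
qed

lemma Phi_iso: "Phi \<in> ring_iso SA (gr_ring n S)"
proof (rule ring_iso_memI)
  show "bij_betw Phi (carrier SA) (carrier (gr_ring n S))"
    unfolding bij_betw_def
  proof
    show "inj_on Phi (carrier SA)" by (rule inj_onI) (use Phi_inj in simp)
    show "Phi ` carrier SA = carrier (gr_ring n S)"
    proof
      show "Phi ` carrier SA \<subseteq> carrier (gr_ring n S)" using Phi_carrier by blast
      show "carrier (gr_ring n S) \<subseteq> Phi ` carrier SA"
      proof
        fix g assume "g \<in> carrier (gr_ring n S)"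
        from Phi_surj[OF this] obtain H where "H \<in> carrier SA" "g = Phi H" by auto
        then show "g \<in> Phi ` carrier SA" by blast
      qed
    qed
  qed
qed (simp_all add: Phi_carrier gr_mult_Phi gr_add_Phi gr_one_Phi)

lemma Phi_component: "Phi ` degree_part (tm.vh ` monomials n) r = gr_component n S r"
proof -
  have iff: "(\<forall>u\<in>gr_index S. fst u \<noteq> r \<longrightarrow> Phi H u = \<one>\<^bsub>gr_piece n S u\<^esub>) \<longleftrightarrow> (\<forall>k\<in>keys H. lookup k 0 = r)"
    if H: "keys H \<subseteq> tm.vh ` monomials n" for H
  proof -
    have "(\<forall>u\<in>gr_index S. fst u \<noteq> r \<longrightarrow> Phi H u = \<one>\<^bsub>gr_piece n S u\<^esub>) \<longleftrightarrow> (\<forall>u\<in>gr_index S. fst u \<noteq> r \<longrightarrow> hc H u = 0)"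
      using Phi_one_iff by blast
    also have "\<dots> \<longleftrightarrow> (\<forall>u\<in>\<Gamma>. fst u \<noteq> r \<longrightarrow> lookup H (Mu u) = 0)"
      using \<Gamma>_index by (auto simp: hc_def)
    also have "\<dots> \<longleftrightarrow> (\<forall>k\<in>keys H. lookup k 0 = r)"
    proof
      assume *: "\<forall>u\<in>\<Gamma>. fst u \<noteq> r \<longrightarrow> lookup H (Mu u) = 0"
      show "\<forall>k\<in>keys H. lookup k 0 = r"
      proof
        fix k assume k: "k \<in> keys H"
        then have "k \<in> Mu ` \<Gamma>" using H unfolding Mu_image by blast
        then obtain u where u: "u \<in> \<Gamma>" "k = Mu u" by blast
        then have "lookup H (Mu u) \<noteq> 0" using k by (simp add: in_keys_iff)
        then show "lookup k 0 = r" using * u Mu_lookup_0[OF u(1)] by auto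
      qed
    next
      assume *: "\<forall>k\<in>keys H. lookup k 0 = r"
      show "\<forall>u\<in>\<Gamma>. fst u \<noteq> r \<longrightarrow> lookup H (Mu u) = 0"
      proof (intro ballI impI)
        fix u assume u: "u \<in> \<Gamma>" "fst u \<noteq> r"
        then have "Mu u \<notin> keys H" using * Mu_lookup_0[OF u(1)] by metis
        then show "lookup H (Mu u) = 0" by (simp add: in_keys_iff)
      qed
    qed
    finally show ?thesis .
  qed
  show ?thesis
  proof
    show "Phi ` degree_part (tm.vh ` monomials n) r \<subseteq> gr_component n S r"
    proof (rule image_subsetI)
      fix H assume "H \<in> degree_part (tm.vh ` monomials n) r"
      then show "Phi H \<in> gr_component n S r" using iff[of H] Phi_carrier by (simp add: degree_part_def gr_component_def)
    qed
    show "gr_component n S r \<subseteq> Phi ` degree_part (tm.vh ` monomials n) r"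
    proof
      fix g assume g: "g \<in> gr_component n S r"
      then have "g \<in> carrier (gr_ring n S)" by (simp add: gr_component_def)
      from Phi_surj[OF this] obtain H where H: "keys H \<subseteq> tm.vh ` monomials n" "Phi H = g" by blast
      then have "H \<in> degree_part (tm.vh ` monomials n) r" using g iff[OF H(1)] by (simp add: degree_part_def gr_component_def)
      then show "g \<in> Phi ` degree_part (tm.vh ` monomials n) r" using H(2) by blast
    qed
  qed
qed

lemma ring_gr: "ring (gr_ring n S)"
proof -
  have "ring (gr_ring n S \<lparr>zero := Phi \<zero>\<^bsub>SA\<^esub>\<rparr>)"
    by (rule ring.ring_iso_imp_img_ring[OF cring.axioms(1)[OF cring_SA] Phi_iso])
  moreover have "Phi \<zero>\<^bsub>SA\<^esub> = \<zero>\<^bsub>gr_ring n S\<^esub>"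
    by (simp add: gr_ring_def Let_def Phi_def piece_one)
  ultimately show ?thesis by simp
qed

lemma gr_class_pbar:
  assumes p: "p \<in> pairs n"
  shows "gr_class n S (1, val n S (pbar n p)) (pbar n p) = Phi (single (tm.hV p) (lc (fst p) (snd p)))"
proof -
  let ?m = "single p 1 :: (nat \<times> nat) monomial"
  have m: "?m \<in> monomials n" using p by simp
  have eps: "tm.eps ?m = lc (fst p) (snd p)" by (simp add: tm.eps_def mon_eval_single)
  have u: "(1, val n S (pbar n p)) = (total_degree ?m, zmap (tv ?m))" using val_pbar[OF p] tv_Var by simp
  have "single ?m (tm.eps ?m / tm.eps ?m) \<in> X (total_degree ?m, zmap (tv ?m)) (tm.eps ?m)" by (rule X_monomial[OF m])
  then have "Var p \<in> X (total_degree ?m, zmap (tv ?m)) (tm.eps ?m)"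
    using tm.eps_nonzero[OF m] by (simp add: Var_def)
  moreover have "(total_degree ?m, zmap (tv ?m)) \<in> \<Gamma>" unfolding \<Gamma>_def using m by (rule imageI)
  ultimately have "gr_class n S (total_degree ?m, zmap (tv ?m)) (quot (Var p)) = Phi (single (tm.vh ?m) (tm.eps ?m))"
    using gr_class_Phi Mu_monomial by metis
  then show ?thesis unfolding u eps by (simp add: pbar_def quot_def)
qed

text \<open>
  The semigroup algebra is generated by the monomials of the coordinates, and these are the
  images of the classes of the coordinates up to nonzero constants.
\<close>

lemma khovanskii: "plucker_khovanskii_basis n S"
  unfolding plucker_khovanskii_basis_def generated_subalgebra_def
proof
  let ?G = "range (gr_const n S) \<union> (\<lambda>p. gr_class n S (1, val n S (pbar n p)) (pbar n p)) ` pairs n"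
  have "?G \<subseteq> carrier (gr_ring n S)" using gr_const_Phi gr_class_pbar Phi_carrier by auto
  then show "generate_ring (gr_ring n S) ?G \<subseteq> carrier (gr_ring n S)" by (rule ring.generate_ring_incl[OF ring_gr])
  let ?A = "generate_ring (gr_ring n S) ?G"
  have const: "Phi (Const c) \<in> ?A" for c
    unfolding gr_const_Phi[symmetric] by (rule generate_ring.incl) blast
  have mult: "Phi (F * G) \<in> ?A" if "Phi F \<in> ?A" "Phi G \<in> ?A" "keys F \<subseteq> tm.vh ` monomials n" "keys G \<subseteq> tm.vh ` monomials n" for F G
    using generate_ring.eng_mult[OF that(1,2)] gr_mult_Phi[OF that(3,4)] by simp
  have constSA: "keys (Const c) \<subseteq> tm.vh ` monomials n" for c using tm.vh_image_closed(1) by (simp add: Const_def)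
  have mon: "Phi (single (tm.vh m) 1) \<in> ?A" if "m \<in> monomials n" for m
    using that
  proof (induction m rule: monomial_induct)
    case zero
    then show ?case using const[of 1] by simp
  next
    case (add p m')
    then have p: "p \<in> pairs n" and m': "m' \<in> monomials n" by (auto simp: keys_add_nat)
    let ?l = "lc (fst p) (snd p)"
    have l: "?l \<noteq> 0" using tm.e_nonzero[of "fst p" "snd p"] p by (auto simp: pairs_def)
    have hV: "tm.hV p \<in> tm.vh ` monomials n" by (rule image_eqI[of _ _ "single p 1"]) (use p in simp_all)
    have "Phi (single (tm.hV p) ?l) \<in> ?A"
      unfolding gr_class_pbar[OF p, symmetric] using p by (intro generate_ring.incl) blast
    then have "Phi (Const (1 / ?l) * single (tm.hV p) ?l) \<in> ?A"
      using hV by (intro mult const constSA) auto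
    then have "Phi (single (tm.hV p) 1) \<in> ?A" using l by (simp add: Const_times_single)
    then have "Phi (single (tm.hV p) 1 * single (tm.vh m') 1) \<in> ?A"
      using hV m' add by (intro mult) auto
    then show ?case by (simp add: mult_single mon_sum_add)
  qed
  show "carrier (gr_ring n S) \<subseteq> ?A"
  proof
    fix g assume "g \<in> carrier (gr_ring n S)"
    then obtain H where H: "keys H \<subseteq> tm.vh ` monomials n" "g = Phi H" using Phi_surj by metis
    have "Phi (\<Sum>k\<in>B. Const (lookup H k) * single k 1) \<in> ?A" if "finite B" "B \<subseteq> keys H" for B
      using that
    proof (induction B rule: finite_induct)
      case empty
      then show ?case using const[of 0] by simp
    next
      case (insert k B)
      then obtain m where m: "m \<in> monomials n" "k = tm.vh m" using H by blast
      have "Phi (Const (lookup H k) * single k 1) \<in> ?A"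
        unfolding m(2) using m(1) by (intro mult const constSA mon) auto
      then have "Phi (Const (lookup H k) * single k 1) \<oplus>\<^bsub>gr_ring n S\<^esub> Phi (\<Sum>k\<in>B. Const (lookup H k) * single k 1) \<in> ?A"
        using insert by (intro generate_ring.eng_add) auto
      then show ?case unfolding gr_add_Phi sum.insert[OF insert(1,2)] .
    qed
    from this[of "keys H"] show "g \<in> ?A" unfolding H(2) by (simp add: sum_single_Const)
  qed
qed

end

section \<open>Comparison of the degenerations\<close>

lemma graded_alg_isomorphic_sym:
  assumes "ring R" "graded_alg_isomorphic R s D R' s' D'"
    and s: "\<And>c. s c \<in> carrier R" and D: "\<And>r. D r \<subseteq> carrier R"
  shows "graded_alg_isomorphic R' s' D' R s D"
proof -
  obtain h where h: "h \<in> ring_iso R R'" "\<And>c. h (s c) = s' c" "\<And>r. h ` D r = D' r"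
    using assms(2) unfolding graded_alg_isomorphic_def by blast
  have inj: "inj_on h (carrier R)" using ring_iso_memE(5)[OF h(1)] by (simp add: bij_betw_def)
  let ?g = "inv_into (carrier R) h"
  have "?g (s' c) = s c" for c unfolding h(2)[symmetric] by (rule inv_into_f_f[OF inj s])
  moreover have "?g ` D' r = D r" for r
    unfolding h(3)[symmetric] image_image using inv_into_f_f[OF inj] D[of r] by (simp add: subset_iff cong: image_cong_simp)
  ultimately show ?thesis unfolding graded_alg_isomorphic_def using ring_iso_set_sym[OF assms(1) h(1)] by blast
qed

lemma graded_alg_isomorphic_trans:
  assumes "graded_alg_isomorphic R s D R' s' D'" "graded_alg_isomorphic R' s' D' R'' s'' D''"
  shows "graded_alg_isomorphic R s D R'' s'' D''"
proof -
  obtain h where h: "h \<in> ring_iso R R'" "\<And>c. h (s c) = s' c" "\<And>r. h ` D r = D' r"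
    using assms(1) unfolding graded_alg_isomorphic_def by blast
  obtain g where g: "g \<in> ring_iso R' R''" "\<And>c. g (s' c) = s'' c" "\<And>r. g ` D' r = D'' r"
    using assms(2) unfolding graded_alg_isomorphic_def by blast
  have "\<forall>c. (g \<circ> h) (s c) = s'' c" using h(2) g(2) by simp
  moreover have "\<forall>r. (g \<circ> h) ` D r = D'' r" by (simp only: image_comp[symmetric] h(3) g(3)) simp
  ultimately show ?thesis unfolding graded_alg_isomorphic_def using ring_iso_set_trans[OF h(1) g(1)] by blast
qed

context plucker_model
begin

lemma psi_sum: "psi F = (\<Sum>m\<in>keys F. single (vh m) (lookup F m * eps m))"
proof -
  have "psi F = psi (\<Sum>m\<in>keys F. single m (lookup F m))" by (simp flip: poly_mapping_sum_single)
  also have "\<dots> = (\<Sum>m\<in>keys F. psi (single m (lookup F m)))" by (simp add: psi_def poly_subst_sum)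
  finally show ?thesis by (simp add: psi_single)
qed

lemma keys_psi: "keys (psi F) \<subseteq> vh ` keys F"
proof -
  have "keys (psi F) \<subseteq> (\<Union>m\<in>keys F. keys (single (vh m) (lookup F m * eps m)))"
    unfolding psi_sum by (rule Poly_Mapping.keys_sum)
  then show ?thesis by (auto split: if_splits)
qed

text \<open>The monomials of the preimage are controlled, so that the surjection respects degrees.\<close>

lemma psi_preimage:
  assumes H: "keys H \<subseteq> vh ` monomials n"
  shows "\<exists>F. keys F \<subseteq> {m \<in> monomials n. vh m \<in> keys H} \<and> psi F = H"
proof -
  have "\<forall>k\<in>keys H. \<exists>m. m \<in> monomials n \<and> vh m = k" using H by blast
  from bchoice[OF this] obtain f where f: "\<And>k. k \<in> keys H \<Longrightarrow> f k \<in> monomials n \<and> vh (f k) = k" by blast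
  define F where "F = (\<Sum>k\<in>keys H. single (f k) (lookup H k / eps (f k)))"
  have "keys F \<subseteq> (\<Union>k\<in>keys H. keys (single (f k) (lookup H k / eps (f k))))"
    unfolding F_def by (rule Poly_Mapping.keys_sum)
  also have "\<dots> \<subseteq> {m \<in> monomials n. vh m \<in> keys H}"
  proof (rule UN_least)
    fix k assume k: "k \<in> keys H"
    have "f k \<in> {m \<in> monomials n. vh m \<in> keys H}" using f[OF k] k by simp
    then show "keys (single (f k) (lookup H k / eps (f k))) \<subseteq> {m \<in> monomials n. vh m \<in> keys H}"
      by (simp del: mem_Collect_eq)
  qed
  finally have 1: "keys F \<subseteq> {m \<in> monomials n. vh m \<in> keys H}" .
  have "psi F = (\<Sum>k\<in>keys H. psi (single (f k) (lookup H k / eps (f k))))"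
    by (simp add: F_def psi_def poly_subst_sum)
  also have "\<dots> = (\<Sum>k\<in>keys H. single k (lookup H k))"
  proof (rule sum.cong[OF refl])
    fix k assume "k \<in> keys H"
    then have "f k \<in> monomials n" "vh (f k) = k" using f by blast+
    then show "psi (single (f k) (lookup H k / eps (f k))) = single k (lookup H k)"
      using eps_nonzero[of "f k"] by (simp add: psi_single)
  qed
  finally have "psi F = H" using poly_mapping_sum_single[of H] by simp
  then show ?thesis using 1 by blast
qed

lemma quotient_isomorphic:
  "graded_alg_isomorphic (pring n Quot J) (quot_const n J) (quot_component n J)
    (monomial_algebra (vh ` monomials n)) Const (degree_part (vh ` monomials n))"
proof -
  let ?A = "monomial_algebra (vh ` monomials n)"
  have A: "cring ?A" by (rule cring_monomial_algebra[OF vh_image_closed])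
  have keys: "keys (psi F) \<subseteq> vh ` monomials n" if "F \<in> carrier (pring n)" for F
    using keys_psi[of F] that unfolding in_pring_iff by blast
  interpret hom: ring_hom_ring "pring n" ?A psi
  proof (rule ring_hom_ringI2[OF pring.ring_axioms cring.axioms(1)[OF A]])
    show "psi \<in> ring_hom (pring n) ?A"
    proof (rule ring_hom_memI)
      show "psi F \<in> carrier ?A" if "F \<in> carrier (pring n)" for F
        using keys[OF that] by (simp only: monomial_algebra_simps mem_Collect_eq)
    qed (simp_all only: psi_def poly_subst_add poly_subst_mult poly_subst_1 monomial_algebra_simps pring_simps)
  qed
  have ker: "a_kernel (pring n) ?A psi = J" 
    unfolding a_kernel_def' J_def by (simp only: monomial_algebra_simps)
  have "psi ` carrier (pring n) = carrier ?A"
  proof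
    show "psi ` carrier (pring n) \<subseteq> carrier ?A"
      using keys by (simp only: image_subset_iff monomial_algebra_simps mem_Collect_eq) blast
    show "carrier ?A \<subseteq> psi ` carrier (pring n)"
    proof
      fix H assume "H \<in> carrier ?A"
      then obtain F where "keys F \<subseteq> {m \<in> monomials n. vh m \<in> keys H}" "psi F = H" using psi_preimage[of H] by auto
      then show "H \<in> psi ` carrier (pring n)" by (intro image_eqI[of _ _ F]) (auto simp: in_pring_iff)
    qed
  qed
  then have iso: "(\<lambda>Y. the_elem (psi ` Y)) \<in> ring_iso (pring n Quot J) ?A"
    using hom.FactRing_iso_set unfolding ker by blast
  have coset: "the_elem (psi ` (J +>\<^bsub>pring n\<^esub> F)) = psi F" if "F \<in> carrier (pring n)" for F
    using hom.the_elem_simp[OF that] unfolding ker .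
  have "the_elem (psi ` quot_const n J c) = Const c" for c
    unfolding quot_const_def coset[OF pring_Const] by (simp add: psi_def)
  moreover have "(\<lambda>Y. the_elem (psi ` Y)) ` quot_component n J r = degree_part (vh ` monomials n) r" for r
  proof -
    have "(\<lambda>Y. the_elem (psi ` Y)) ` quot_component n J r = psi ` {F \<in> carrier (pring n). homogeneous r F}"
    proof -
      have "quot_component n J r = (\<lambda>F. J +>\<^bsub>pring n\<^esub> F) ` {F \<in> carrier (pring n). homogeneous r F}"
        unfolding quot_component_def by blast
      then show ?thesis unfolding image_image by (simp add: image_image coset)
    qed
    also have "\<dots> = degree_part (vh ` monomials n) r"
    proof
      show "psi ` {F \<in> carrier (pring n). homogeneous r F} \<subseteq> degree_part (vh ` monomials n) r"
      proof (rule image_subsetI)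
        fix F assume F: "F \<in> {F \<in> carrier (pring n). homogeneous r F}"
        have "lookup k 0 = r" if "k \<in> keys (psi F)" for k
        proof -
          obtain m where "m \<in> keys F" "k = vh m" using keys_psi[of F] \<open>k \<in> keys (psi F)\<close> by blast
          then show ?thesis using F by (simp add: lookup_vh_0 homogeneous_def)
        qed
        then show "psi F \<in> degree_part (vh ` monomials n) r" using keys[of F] F by (simp add: degree_part_def)
      qed
      show "degree_part (vh ` monomials n) r \<subseteq> psi ` {F \<in> carrier (pring n). homogeneous r F}"
      proof
        fix H assume H: "H \<in> degree_part (vh ` monomials n) r"
        then obtain F where F: "keys F \<subseteq> {m \<in> monomials n. vh m \<in> keys H}" "psi F = H"
          using psi_preimage[of H] by (auto simp: degree_part_def)
        have "homogeneous r F"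
          unfolding homogeneous_def
        proof
          fix m assume "m \<in> keys F"
          then have "vh m \<in> keys H" using F(1) by blast
          then show "total_degree m = r" using H lookup_vh_0[of m] by (simp add: degree_part_def)
        qed
        moreover have "F \<in> carrier (pring n)" using F(1) unfolding in_pring_iff by blast
        ultimately show "H \<in> psi ` {F \<in> carrier (pring n). homogeneous r F}" using F(2) by blast
      qed
    qed
    finally show ?thesis .
  qed
  ultimately show ?thesis unfolding graded_alg_isomorphic_def by (intro bexI[OF _ iso]) simp
qed

end

lemma mon_sum_image_subset:
  assumes "\<And>p. p \<in> pairs n \<Longrightarrow> \<exists>q\<in>pairs n. f p = g q"
  shows "mon_sum f ` monomials n \<subseteq> mon_sum g ` monomials n"
proof (rule image_subsetI)
  fix m assume "m \<in> monomials n"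
  then show "mon_sum f m \<in> mon_sum g ` monomials n"
  proof (induction m rule: monomial_induct)
    case zero
    show ?case by (rule image_eqI[of _ _ 0]) simp_all
  next
    case (add p m')
    then have "p \<in> pairs n" "m' \<in> monomials n" by (auto simp: keys_add_nat)
    then obtain q m'' where q: "q \<in> pairs n" "f p = g q" "m'' \<in> monomials n" "mon_sum f m' = mon_sum g m''"
      using assms add(3) by blast
    then show ?case by (intro image_eqI[of _ _ "single q 1 + m''"]) (simp_all add: mon_sum_add keys_add_nat)
  qed
qed

context iterated_seq
begin

text \<open>
  A permutation of the leaves permutes the generators of the semigroup of exponents.
\<close>

lemma permuted_exponents:
  assumes \<sigma>: "\<sigma> permutes {1..n}"
  shows "mon_sum (\<lambda>p. single 0 1 + texp (\<sigma> (fst p)) (\<sigma> (snd p))) ` monomials n = tm.vh ` monomials n"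
proof -
  have perm: "\<exists>q\<in>pairs n. texp (\<tau> (fst p)) (\<tau> (snd p)) = texp (\<rho> (fst q)) (\<rho> (snd q))"
    if \<tau>: "\<tau> permutes {1..n}" and \<rho>: "\<rho> permutes {1..n}" and p: "p \<in> pairs n" for \<tau> \<rho> p
  proof -
    let ?r = "Hilbert_Choice.inv \<rho>"
    define a b where "a = ?r (\<tau> (fst p))" and "b = ?r (\<tau> (snd p))"
    have \<rho>ab: "\<rho> a = \<tau> (fst p)" "\<rho> b = \<tau> (snd p)"
      unfolding a_def b_def by (rule permutes_inverses(1)[OF \<rho>])+
    have fs: "fst p \<in> {1..n}" "snd p \<in> {1..n}" "fst p \<noteq> snd p" using p by (auto simp: pairs_def)
    have "a \<in> {1..n}" "b \<in> {1..n}"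
      unfolding a_def b_def using fs permutes_in_image[OF \<tau>] permutes_in_image[OF permutes_inv[OF \<rho>]] by blast+
    moreover have "a \<noteq> b"
    proof
      assume "a = b"
      then have "\<tau> (fst p) = \<tau> (snd p)" using \<rho>ab by metis
      then show False using fs(3) permutes_inj[OF \<tau>] by (simp add: inj_eq)
    qed
    ultimately have "(min a b, max a b) \<in> pairs n" by (auto simp: pairs_def min_def max_def)
    moreover have "texp (\<tau> (fst p)) (\<tau> (snd p)) = texp (\<rho> (min a b)) (\<rho> (max a b))"
      unfolding \<rho>ab[symmetric] using texp_sym[of "\<rho> a" "\<rho> b"] by (auto simp: min_def max_def)
    ultimately show ?thesis by (intro bexI[of _ "(min a b, max a b)"]) simp_all
  qed
  have id: "id permutes {1..n}" by (rule permutes_id)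
  have hV: "tm.hV = (\<lambda>p. single 0 1 + texp (id (fst p)) (id (snd p)))" by (rule ext) (simp add: tm.hV_def)
  show ?thesis
    unfolding hV
  proof
    show "mon_sum (\<lambda>p. single 0 1 + texp (\<sigma> (fst p)) (\<sigma> (snd p))) ` monomials n
      \<subseteq> mon_sum (\<lambda>p. single 0 1 + texp (id (fst p)) (id (snd p))) ` monomials n"
      using perm[OF \<sigma> id] by (intro mon_sum_image_subset) fastforce
    show "mon_sum (\<lambda>p. single 0 1 + texp (id (fst p)) (id (snd p))) ` monomials n
      \<subseteq> mon_sum (\<lambda>p. single 0 1 + texp (\<sigma> (fst p)) (\<sigma> (snd p))) ` monomials n"
      using perm[OF id \<sigma>] by (intro mon_sum_image_subset) fastforce
  qed
qed

lemma gr_isomorphic: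
  "graded_alg_isomorphic (gr_ring n S) (gr_const n S) (gr_component n S)
    SA Const (degree_part (tm.vh ` monomials n))"
proof (rule graded_alg_isomorphic_sym[OF cring.axioms(1)[OF cring_SA]])
  show "graded_alg_isomorphic SA Const (degree_part (tm.vh ` monomials n)) (gr_ring n S) (gr_const n S) (gr_component n S)"
    unfolding graded_alg_isomorphic_def using Phi_iso gr_const_Phi Phi_component by metis
  show "Const c \<in> carrier SA" for c using tm.vh_image_closed(1) by (simp add: Const_def)
  show "degree_part (tm.vh ` monomials n) r \<subseteq> carrier SA" for r by (auto simp: degree_part_def)
qed

end

context labelled_tree
begin

lemma tree_cone_degeneration:
  shows "primeideal (cone_initial_ideal n (tree_cone n i \<sigma>)) (pring n)"
    and "degenerations_isomorphic n S (tree_cone n i \<sigma>)"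
proof -
  have J: "cone_initial_ideal n (tree_cone n i \<sigma>) = M.J"
    using M.cone_initial_ideal_closed_cone by (simp add: closed_cone_eq)
  show "primeideal (cone_initial_ideal n (tree_cone n i \<sigma>)) (pring n)" unfolding J by (rule M.primeideal_J)
  have "M.hV = (\<lambda>p. single 0 1 + texp (\<sigma> (fst p)) (\<sigma> (snd p)))" by (rule ext) (simp add: M.hV_def)
  then have img: "M.vh ` monomials n = tm.vh ` monomials n" using permuted_exponents[OF perm] by simp
  have "graded_alg_isomorphic SA Const (degree_part (tm.vh ` monomials n)) (pring n Quot M.J) (quot_const n M.J) (quot_component n M.J)"
  proof (rule graded_alg_isomorphic_sym)
    show "ring (pring n Quot M.J)" by (rule ideal.quotient_is_ring[OF M.ideal_J])
    show "graded_alg_isomorphic (pring n Quot M.J) (quot_const n M.J) (quot_component n M.J) SA Const (degree_part (tm.vh ` monomials n))"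
      using M.quotient_isomorphic unfolding img .
    have coset: "M.J +>\<^bsub>pring n\<^esub> F \<in> carrier (pring n Quot M.J)" if "F \<in> carrier (pring n)" for F
      using ring_hom_closed[OF ideal.rcos_ring_hom[OF M.ideal_J] that] .
    show "quot_const n M.J c \<in> carrier (pring n Quot M.J)" for c unfolding quot_const_def by (rule coset[OF pring_Const])
    show "quot_component n M.J r \<subseteq> carrier (pring n Quot M.J)" for r
      unfolding quot_component_def using coset by blast
  qed
  from graded_alg_isomorphic_trans[OF gr_isomorphic this] show "degenerations_isomorphic n S (tree_cone n i \<sigma>)"
    unfolding degenerations_isomorphic_def J .
qed

end

theorem theorem2:
  fixes n :: nat
  assumes "n \<ge> 4"
  shows "(\<forall>S. iterated_sequence n S \<longrightarrow>
            value_semigroup n S =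
              submonoid_closed hull ((\<lambda>p. (1, val n S (pbar n p))) ` pairs n) \<and>
            plucker_khovanskii_basis n S) \<and>
         (\<forall>S. iterated_sequence n S \<longrightarrow>
            (\<exists>C. maximal_prime_cone n C \<and> degenerations_isomorphic n S C)) \<and>
         (\<forall>C. maximal_prime_cone n C \<longrightarrow>
            (\<exists>S. iterated_sequence n S \<and> degenerations_isomorphic n S C))"
proof (intro conjI allI impI)
  fix S assume "iterated_sequence n S"
  then obtain i j where ij: "iterated_seq n i j" "S = iseq n i j" unfolding iterated_sequence_iff[OF assms] by blast
  show "value_semigroup n S = submonoid_closed hull ((\<lambda>p. (1, val n S (pbar n p))) ` pairs n)"
    unfolding ij(2) by (rule iterated_seq.value_semigroup_generated[OF ij(1)])
  show "plucker_khovanskii_basis n S"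
    unfolding ij(2) by (rule iterated_seq.khovanskii[OF ij(1)])
next
  fix S assume "iterated_sequence n S"
  then obtain i j where ij: "iterated_seq n i j" "S = iseq n i j" unfolding iterated_sequence_iff[OF assms] by blast
  then have T: "labelled_tree n i j id"
    by (intro labelled_tree.intro labelled_tree_axioms.intro permutes_id) simp_all
  have "maximal_prime_cone n (tree_cone n i id)"
    unfolding maximal_prime_cone_def
    using maximal_tree_cone[OF assms T] labelled_tree.tree_cone_degeneration(1)[OF T] by blast
  then show "\<exists>C. maximal_prime_cone n C \<and> degenerations_isomorphic n S C"
    unfolding ij(2) using labelled_tree.tree_cone_degeneration(2)[OF T] by blast
next
  fix C assume "maximal_prime_cone n C"
  then have "maximal_cone n C" by (simp add: maximal_prime_cone_def)
  then obtain i j \<sigma> where *: "labelled_tree n i j \<sigma>" "C = tree_cone n i \<sigma>"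
    using maximal_cone_is_tree_cone[OF assms] by blast
  have "iterated_sequence n (iseq n i j)" unfolding iterated_sequence_iff[OF assms] using labelled_tree.axioms(1)[OF *(1)] by blast
  then show "\<exists>S. iterated_sequence n S \<and> degenerations_isomorphic n S C"
    unfolding *(2) using labelled_tree.tree_cone_degeneration(2)[OF *(1)] by blast
qed

end
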